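(* There are constants $c,c'>0$ such that, for every integer $k\ge 2$, $$2^{k-c\log k}\le ES^p(k)\le 2^{k+c'\sqrt{k\log k}}.$$
   Context: A finite set of points in the real projective plane $\mathbb{R}\mathcal{P}^2$ is in general position if no three of its points lie on a common projective line. A Euclidean plane $\rho\subset\mathbb{R}\mathcal{P}^2$ is the set obtained from $\mathbb{R}\mathcal{P}^2$ by removing a projective line. A finite set of points in a Euclidean plane is in convex position if it is the vertex set of a convex polygon. A finite set of points in $\mathbb{R}\mathcal{P}^2$ is in projective convex position if it is contained in, and is in convex position in, some Euclidean plane $\rho\subset\mathbb{R}\mathcal{P}^2$. For an integer $k\ge2$, $ES^p(k)$ denotes the minimum positive integer $N$ such that every finite set of at least $N$ points in $\mathbb{R}\mathcal{P}^2$ in general position contains $k$ points in projective convex position. *)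

theory Defs
  imports "HOL-Analysis.Analysis"
begin

text \<open>Points of the real projective plane are the one-dimensional linear subspaces of
  \<open>\<real>\<^sup>3\<close>; projective lines correspond to the two-dimensional ones.\<close>

typedef rp2 = "{L :: (real ^ 3) set. subspace L \<and> dim L = 1}"
  morphisms line_of Abs_rp2
proof -
  have "axis 1 1 \<noteq> (0 :: real ^ 3)" by (simp add: axis_eq_0_iff)
  then have "dim (span {axis 1 1 :: real ^ 3}) = 1" by (simp add: dim_span)
  then show ?thesis by (metis (mono_tags) mem_Collect_eq subspace_span)
qed

definition proj_line :: "rp2 set \<Rightarrow> bool" where
  "proj_line l \<longleftrightarrow> (\<exists>W. subspace W \<and> dim W = 2 \<and> l = {p. line_of p \<subseteq> W})"

definition general_position :: "rp2 set \<Rightarrow> bool" where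
  "general_position S \<longleftrightarrow> (\<forall>T\<subseteq>S. card T = 3 \<longrightarrow> \<not> (\<exists>l. proj_line l \<and> T \<subseteq> l))"

definition euclidean_plane :: "rp2 set \<Rightarrow> bool" where
  "euclidean_plane \<rho> \<longleftrightarrow> (\<exists>l. proj_line l \<and> \<rho> = - l)"

text \<open>Removing the projective line \<open>a \<bullet> x = 0\<close> leaves a Euclidean plane, identified with the
  affine plane \<open>a \<bullet> x = 1\<close> in \<open>\<real>\<^sup>3\<close>: each remaining point, as a linear subspace, meets
  the latter in exactly one vector.  A Euclidean plane determines \<open>a\<close> up to a nonzero factor,
  and rescaling \<open>a\<close> only rescales the chart, so the choice of \<open>a\<close> does not affect convexity.\<close>

definition plane_at :: "real ^ 3 \<Rightarrow> rp2 set" where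
  "plane_at a = - {p. line_of p \<subseteq> {x. a \<bullet> x = 0}}"

definition chart :: "real ^ 3 \<Rightarrow> rp2 \<Rightarrow> real ^ 3" where
  "chart a p = (THE x. x \<in> line_of p \<and> a \<bullet> x = 1)"

text \<open>The polygon may be degenerate (a point or a segment), so that two points are in convex
  position.\<close>

definition convex_position :: "'a::euclidean_space set \<Rightarrow> bool" where
  "convex_position X \<longleftrightarrow> (\<exists>P. polytope P \<and> X = {x. x extreme_point_of P})"

definition convex_position_in :: "rp2 set \<Rightarrow> rp2 set \<Rightarrow> bool" where
  "convex_position_in \<rho> X \<longleftrightarrow>
     X \<subseteq> \<rho> \<and> (\<exists>a. a \<noteq> 0 \<and> \<rho> = plane_at a \<and> convex_position (chart a ` X))"

definition proj_convex_position :: "rp2 set \<Rightarrow> bool" where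
  "proj_convex_position X \<longleftrightarrow>
     finite X \<and> (\<exists>\<rho>. euclidean_plane \<rho> \<and> X \<subseteq> \<rho> \<and> convex_position_in \<rho> X)"

text \<open>On \<^typ>\<open>nat\<close>, \<open>Inf\<close> is the minimum of a nonempty set and \<open>Inf {} = 0\<close>; hence a positive
  lower bound on \<open>ESp k\<close> entails that the minimum exists.\<close>

definition ESp :: "nat \<Rightarrow> nat" where
  "ESp k = Inf {N. 0 < N \<and>
     (\<forall>S. finite S \<and> general_position S \<and> N \<le> card S \<longrightarrow>
        (\<exists>T\<subseteq>S. card T = k \<and> proj_convex_position T))}"

end

theory Submission
  imports Defs
begin

text \<open>A point of the projective plane is handled through a vector spanning it. Three points are
collinear iff the determinant \<open>orient\<close> of their vectors vanishes, and in the Euclidean plane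
\<open>inner f v = 1\<close> four points are in convex position iff the product \<open>quad\<close> of their four
determinants is positive. By Caratheodory's theorem a finite set is in convex position iff all its
quadruples are, so both bounds become statements about signs of determinants.

\<^bold>\<open>Upper bound.\<close> Already one affine chart of a large set in general position contains a convex
\<open>k\<close>-gon. This is the Erdos-Szekeres bound of Suk, with the error term of Holmsen, Mojarrad, Pach and
Tardos, and the argument is this. Suppose that \<open>N\<close> points contain no convex \<open>k\<close>-gon. By the
theorem on cups and caps (\<open>cups_caps\<close>) and double counting, a fraction \<open>2 ^ (- O(t\<^sup>2))\<close> of all
\<open>(2 * t + 1)\<close>-tuples are caps, say. Every second point of such a cap forms a cap \<open>X\<close> with \<open>t\<close>
edges, and the remaining points lie in the \<open>t\<close> triangular cells beyond the edges of \<open>X\<close>, one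
in each. The product of the sizes of the cells of \<open>X\<close> therefore bounds the number of caps
extending \<open>X\<close>.

In a cell a point precedes another if it lies in the triangle spanned by the other one and a fixed
segment. A chain whose triples all turn one way in a cell and a chain whose triples all turn the
other way in the next cell together form a convex polygon, so that their lengths add up to less
than \<open>k\<close> (\<open>union_of_chains\<close>). An antichain which is a cap can be united with such
antichains in other cells, of the same parity, to a cap, so that their sizes also add up to
less than \<open>k\<close> (\<open>union_of_flat_caps\<close>). By Mirsky's theorem and \<open>cups_caps\<close>, a cell in
which the longest chains of the two kinds have \<open>r\<close> and \<open>l\<close> points, and the largest
antichain cap has \<open>a\<close> points, has size at most \<open>2 ^ (r + l) * k ^ a\<close>. In the product over all
cells each of the exponents is thus controlled only on average: the product is at most
\<open>N\<^sup>2 * 2 ^ ((t - 1) * k) * k ^ (2 * k)\<close> (\<open>prod_card_cells\<close>), which yields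
\<open>log N \<le> k + O(t + k * log k / t)\<close>; finally \<open>t\<close> is about \<open>sqrt (k * log k)\<close>.

\<^bold>\<open>Lower bound.\<close> Take the points with abscissa \<open>word_x w\<close> and ordinate \<open>word_y w\<close>, for the binary
words \<open>w\<close> of length \<open>n\<close> with a fixed number of letters \<open>False\<close>. A line through two of these points
is the steeper, the earlier the two words differ. Hence two words starting with \<open>False\<close> and one
starting with \<open>True\<close> form a cup, and one starting with \<open>False\<close> and two starting with \<open>True\<close>
form a cap. If a set is in projective convex position, then whether the lines from \<open>p\<close> to \<open>q\<close> and
\<open>r\<close> separate those from \<open>p\<close> to \<open>s\<close> and \<open>t\<close> does not depend on the point \<open>p\<close> of the set. For words this
forces, whenever both halves (by first letter) have at least two elements, that each half is a cup
or a cap, and that they are of different kinds if both have at least three elements. Cups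
and caps of words have at most one more element than there are letters \<open>False\<close> and \<open>True\<close>,
respectively, so that by induction at most \<open>n + 3\<close> words are in projective convex position
(\<open>card_coherent\<close>), while for some number of letters \<open>False\<close> there are at least
\<open>2 ^ n / (n + 1)\<close> words.\<close>

section \<open>Orientation of triples of vectors\<close>

text \<open>The determinant of the three vectors. In a plane \<open>inner f v = 1\<close> it is the signed area of the triangle
\<open>a\<close>, \<open>b\<close>, \<open>c\<close> up to a nonzero factor depending only on \<open>f\<close>.\<close>

definition orient :: "real^3 \<Rightarrow> real^3 \<Rightarrow> real^3 \<Rightarrow> real" where
  "orient a b c = inner a (cross3 b c)"

lemma orient_expand:
  "orient a b c = a$1 * (b$2 * c$3 - b$3 * c$2) + a$2 * (b$3 * c$1 - b$1 * c$3)
     + a$3 * (b$1 * c$2 - b$2 * c$1)"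
  by (simp add: orient_def cross3_def inner_vec_def sum_3)

lemma orient_rotate: "orient b c a = orient a b c"
  by (simp add: orient_expand algebra_simps)

lemma orient_swap: "orient b a c = - orient a b c" "orient a c b = - orient a b c"
  "orient c b a = - orient a b c"
  by (simp_all add: orient_expand algebra_simps)

lemma orient_repeated [simp]: "orient a a b = 0" "orient a b a = 0" "orient b a a = 0"
  by (simp_all add: orient_expand algebra_simps)

lemma orient_linear:
  "orient (x + y) b c = orient x b c + orient y b c"
  "orient (r *\<^sub>R x) b c = r * orient x b c"
  "orient b (x + y) c = orient b x c + orient b y c"
  "orient b (r *\<^sub>R x) c = r * orient b x c"
  "orient b c (x + y) = orient b c x + orient b c y"
  "orient b c (r *\<^sub>R x) = r * orient b c x"
  by (simp_all add: orient_expand algebra_simps)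

text \<open>The three-term relation among the determinants that contain \<open>a\<close>. It is what makes the order in which
\<open>a\<close> sees the points on one side of a line through \<open>a\<close> transitive.\<close>

lemma grassmann_pluecker:
  "orient a b c * orient a d e - orient a b d * orient a c e + orient a b e * orient a c d = 0"
  unfolding orient_expand by algebra

lemma cramer:
  "orient x y z *\<^sub>R p - orient p y z *\<^sub>R x + orient p x z *\<^sub>R y - orient p x y *\<^sub>R z = 0"
  unfolding vec_eq_iff forall_3 by (simp add: orient_expand algebra_simps)

lemma cramer_dual:
  "orient x y z *\<^sub>R f = inner f x *\<^sub>R cross3 y z + inner f y *\<^sub>R cross3 z x + inner f z *\<^sub>R cross3 x y"
  unfolding vec_eq_iff forall_3
  by (simp add: orient_expand cross3_def inner_vec_def sum_3 algebra_simps)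

text \<open>The vector \<open>cross3 f g\<close> is the point at infinity of the vertical lines if \<open>inner f v = 1\<close> is the
plane and \<open>inner g v\<close> the abscissa. Comparing abscissas is thus an instance of the orientation.\<close>

lemma orient_cross: "orient (cross3 f g) v w = inner f v * inner g w - inner f w * inner g v"
  by (simp add: orient_expand cross3_def inner_vec_def sum_3 algebra_simps)

section \<open>Convex position and orientations\<close>

text \<open>The sign tells convex quadruples from nonconvex ones: these determinants are, up to sign, the
coefficients of the affine dependency of the four points.\<close>

definition quad :: "real^3 \<Rightarrow> real^3 \<Rightarrow> real^3 \<Rightarrow> real^3 \<Rightarrow> real" where
  "quad a b c d = orient b c d * orient a b c * orient a c d * orient a b d"

lemma quad_swap: "quad b a c d = quad a b c d" "quad a c b d = quad a b c d" "quad a b d c = quad a b c d"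
  using orient_swap(1)[of b a c] orient_swap(1)[of b a d] orient_swap(1)[of c b d]
    orient_swap(2)[of a c b] orient_swap(2)[of b d c] orient_swap(2)[of a d c]
  by (simp_all add: quad_def)

lemma in_convex_hull_of_dependency:
  fixes p x y z :: "'a::real_vector"
  assumes "\<alpha> *\<^sub>R p + \<beta> *\<^sub>R x + \<gamma> *\<^sub>R y + \<delta> *\<^sub>R z = 0" "\<alpha> + \<beta> + \<gamma> + \<delta> = 0"
    and "\<alpha> * \<beta> \<le> 0" "\<alpha> * \<gamma> \<le> 0" "\<alpha> * \<delta> \<le> 0" "\<alpha> \<noteq> 0"
  shows "p \<in> convex hull {x, y, z}"
proof -
  have "\<alpha> *\<^sub>R p = (-\<beta>) *\<^sub>R x + (-\<gamma>) *\<^sub>R y + (-\<delta>) *\<^sub>R z"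
    using assms(1) by (simp add: algebra_simps add_eq_0_iff) (metis add.assoc add.commute neg_eq_iff_add_eq_0)
  then have "p = (1/\<alpha>) *\<^sub>R ((-\<beta>) *\<^sub>R x + (-\<gamma>) *\<^sub>R y + (-\<delta>) *\<^sub>R z)"
    using assms(6) by (metis divide_inverse mult.left_neutral scaleR_scaleR scaleR_one left_inverse)
  then have "p = (-\<beta>/\<alpha>) *\<^sub>R x + (-\<gamma>/\<alpha>) *\<^sub>R y + (-\<delta>/\<alpha>) *\<^sub>R z"
    by (simp add: scaleR_add_right scaleR_right_diff_distrib)
  moreover have "-\<beta>/\<alpha> \<ge> 0" "-\<gamma>/\<alpha> \<ge> 0" "-\<delta>/\<alpha> \<ge> 0"
    using assms(3-6) by (auto simp: zero_le_divide_iff mult_le_0_iff divide_le_0_iff)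
  moreover have "-\<beta>/\<alpha> + -\<gamma>/\<alpha> + -\<delta>/\<alpha> = 1"
  proof -
    have "\<alpha> = -\<beta> + -\<gamma> + -\<delta>" using assms(2) by linarith
    then have "(-\<beta> + -\<gamma> + -\<delta>) / \<alpha> = 1" using assms(6) by simp
    then show ?thesis by (simp add: add_divide_distrib diff_divide_distrib)
  qed
  ultimately show ?thesis unfolding convex_hull_3 by blast
qed

lemma four_signs:
  fixes a b c d :: real
  assumes "a * b * c * d < 0"
  shows "(a * b < 0 \<and> a * c < 0 \<and> a * d < 0) \<or> (b * a < 0 \<and> b * c < 0 \<and> b * d < 0) \<or>
    (c * a < 0 \<and> c * b < 0 \<and> c * d < 0) \<or> (d * a < 0 \<and> d * b < 0 \<and> d * c < 0)"
proof -
  have *: "x * y < 0 \<longleftrightarrow> (x < 0) \<noteq> (y < 0)" if "x \<noteq> 0" "y \<noteq> 0" for x y :: real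
    using that by (auto simp: mult_less_0_iff)
  have nz: "a \<noteq> 0" "b \<noteq> 0" "c \<noteq> 0" "d \<noteq> 0" using assms by auto
  then have "(((a < 0) \<noteq> (b < 0)) \<noteq> (c < 0)) \<noteq> (d < 0)"
    using assms *[of "a * b * c" d] *[of "a * b" c] *[of a b] by simp
  then show ?thesis using nz by (simp add: *) blast
qed

definition convex_independent :: "'a::real_vector set \<Rightarrow> bool" where
  "convex_independent Y \<longleftrightarrow> (\<forall>y\<in>Y. y \<notin> convex hull (Y - {y}))"

text \<open>Were the product negative, one of the four coefficients in Cramer's rule would have a sign
different from the others, and its point would lie in the triangle of the others.\<close>

lemma quad_pos_if_convex_independent:
  assumes ci: "convex_independent Y" and Y: "p \<in> Y" "x \<in> Y" "y \<in> Y" "z \<in> Y"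
    and dist: "distinct [p, x, y, z]"
    and f: "inner f p = 1" "inner f x = 1" "inner f y = 1" "inner f z = 1"
    and nz: "quad p x y z \<noteq> 0"
  shows "quad p x y z > 0"
proof (rule ccontr)
  assume "\<not> quad p x y z > 0"
  then have neg: "quad p x y z < 0" using nz by simp
  define \<alpha> \<beta> \<gamma> \<delta> where
    "\<alpha> = orient x y z" and "\<beta> = - orient p y z" and "\<gamma> = orient p x z" and "\<delta> = - orient p x y"
  have dep: "\<alpha> *\<^sub>R p + \<beta> *\<^sub>R x + \<gamma> *\<^sub>R y + \<delta> *\<^sub>R z = 0"
    using cramer[of x y z p] by (simp add: \<alpha>_def \<beta>_def \<gamma>_def \<delta>_def)
  from arg_cong[OF this, of "inner f"] have sum: "\<alpha> + \<beta> + \<gamma> + \<delta> = 0"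
    by (simp add: inner_add_right f)
  have "\<alpha> * \<beta> * \<gamma> * \<delta> < 0"
    using neg by (simp add: quad_def \<alpha>_def \<beta>_def \<gamma>_def \<delta>_def mult_ac)
  note signs = four_signs[OF this]
  have out: "v \<notin> convex hull {a, b, c}"
    if "v \<in> Y" "{a, b, c} \<subseteq> Y - {v}" for v a b c
    using ci that hull_mono[of "{a,b,c}" "Y - {v}" convex] unfolding convex_independent_def by blast
  have "p \<notin> convex hull {x, y, z}" "x \<notin> convex hull {p, y, z}" "y \<notin> convex hull {p, x, z}"
    "z \<notin> convex hull {p, x, y}"
    using Y dist by (intro out; auto)+
  moreover have "p \<in> convex hull {x, y, z}" if "\<alpha> * \<beta> < 0 \<and> \<alpha> * \<gamma> < 0 \<and> \<alpha> * \<delta> < 0"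
    by (rule in_convex_hull_of_dependency[OF dep sum]) (use that in auto)
  moreover have "x \<in> convex hull {p, y, z}" if "\<beta> * \<alpha> < 0 \<and> \<beta> * \<gamma> < 0 \<and> \<beta> * \<delta> < 0"
    by (rule in_convex_hull_of_dependency[of \<beta> x \<alpha> p \<gamma> y \<delta> z]) (use that dep sum in \<open>auto simp: add_ac\<close>)
  moreover have "y \<in> convex hull {p, x, z}" if "\<gamma> * \<alpha> < 0 \<and> \<gamma> * \<beta> < 0 \<and> \<gamma> * \<delta> < 0"
    by (rule in_convex_hull_of_dependency[of \<gamma> y \<alpha> p \<beta> x \<delta> z]) (use that dep sum in \<open>auto simp: add_ac\<close>)
  moreover have "z \<in> convex hull {p, x, y}" if "\<delta> * \<alpha> < 0 \<and> \<delta> * \<beta> < 0 \<and> \<delta> * \<gamma> < 0"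
    by (rule in_convex_hull_of_dependency[of \<delta> z \<alpha> p \<beta> x \<gamma> y]) (use that dep sum in \<open>auto simp: add_ac\<close>)
  ultimately show False using signs by blast
qed

text \<open>In a plane Caratheodory's theorem reduces membership in a convex hull to membership in a
triangle, and a point in a triangle makes \<open>quad\<close> nonpositive by multilinearity.\<close>

lemma convex_independent_if_quad_pos:
  fixes Y :: "(real^3) set"
  assumes fin: "finite Y" and f: "\<And>y. y \<in> Y \<Longrightarrow> inner f y = 1"
    and nz: "\<And>a b c. a \<in> Y \<Longrightarrow> b \<in> Y \<Longrightarrow> c \<in> Y \<Longrightarrow> distinct [a, b, c] \<Longrightarrow> orient a b c \<noteq> 0"
    and quad: "\<And>a b c d. a \<in> Y \<Longrightarrow> b \<in> Y \<Longrightarrow> c \<in> Y \<Longrightarrow> d \<in> Y \<Longrightarrow> distinct [a, b, c, d] \<Longrightarrow> quad a b c d > 0"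
  shows "convex_independent Y"
  unfolding convex_independent_def
proof (intro ballI notI)
  fix y assume y: "y \<in> Y" and hull: "y \<in> convex hull (Y - {y})"
  from hull obtain S where S: "finite S" "S \<subseteq> Y - {y}" "card S \<le> aff_dim (Y - {y}) + 1" "y \<in> convex hull S"
    unfolding caratheodory_aff_dim[of "Y - {y}"] by auto
  have "f \<noteq> 0" using f[OF y] by auto
  have "aff_dim (Y - {y}) \<le> aff_dim {x. inner f x = 1}"
    by (rule aff_dim_subset) (use f in auto)
  also have "\<dots> = 2" using \<open>f \<noteq> 0\<close> by simp
  finally have "card S \<le> 3" using S(3) by linarith
  then consider "card S = 0" | "card S = 1" | "card S = 2" | "card S = 3" by linarith
  then show False
  proof cases
    case 1 then show False using S by simp
  next
    case 2 then obtain p where "S = {p}" by (auto simp: card_1_singleton_iff)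
    then show False using S by auto
  next
    case 3 then obtain p q where pq: "S = {p, q}" "p \<noteq> q" by (auto simp: card_2_iff)
    then obtain u v where "y = u *\<^sub>R p + v *\<^sub>R q" using S(4) by (auto simp: convex_hull_2)
    then have "orient y p q = 0" by (simp add: orient_linear)
    then show False using nz[of y p q] y pq S(2) by auto
  next
    case 4 then obtain p q r where pqr: "S = {p, q, r}" "p \<noteq> q" "q \<noteq> r" "p \<noteq> r" by (auto simp: card_3_iff)
    then obtain u v w where uvw: "y = u *\<^sub>R p + v *\<^sub>R q + w *\<^sub>R r" "u \<ge> 0" "v \<ge> 0" "w \<ge> 0"
      using S(4) by (auto simp: convex_hull_3)
    have "orient y q r = u * orient p q r" "orient y p q = w * orient p q r" "orient y p r = - v * orient p q r"
      using orient_rotate[of r p q] orient_rotate[of p q r] orient_swap(1)[of q p r]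
      by (simp_all add: uvw(1) orient_linear)
    then have "quad y p q r = - (u * v * w) * (orient p q r)^4"
      by (simp add: quad_def power4_eq_xxxx mult_ac)
    also have "\<dots> \<le> 0" using uvw by simp
    finally show False using quad[of y p q r] y pqr S(2) by auto
  qed
qed

lemma convex_position_iff_convex_independent:
  assumes "finite Y"
  shows "convex_position Y \<longleftrightarrow> convex_independent Y"
proof
  assume "convex_position Y"
  then obtain P where P: "polytope P" "Y = {x. x extreme_point_of P}"
    unfolding convex_position_def by blast
  show "convex_independent Y"
    unfolding convex_independent_def
  proof (intro ballI notI)
    fix y assume y: "y \<in> Y" and hull: "y \<in> convex hull (Y - {y})"
    have "convex (P - {y})"
      using extreme_point_of_stillconvex[OF polytope_imp_convex[OF P(1)], of y] y P(2) by simp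
    moreover have "Y - {y} \<subseteq> P - {y}" using P(2) by (auto simp: extreme_point_of_def)
    ultimately show False using hull hull_minimal[of "Y - {y}" "P - {y}" convex] by blast
  qed
next
  assume "convex_independent Y"
  then have "x extreme_point_of convex hull Y \<longleftrightarrow> x \<in> Y" for x
    using extreme_point_of_convex_hull_convex_independent[OF finite_imp_compact[OF assms], of x]
    unfolding convex_independent_def by blast
  then show "convex_position Y"
    unfolding convex_position_def using polytope_convex_hull[OF assms] by (intro exI[of _ "convex hull Y"]) auto
qed


section \<open>Points of the projective plane as vectors\<close>

lemma dim_plane: "a \<noteq> (0::real^3) \<Longrightarrow> dim {x. inner a x = 0} = 2"
  by (simp add: dim_hyperplane)

lemma euclidean_plane_at: "a \<noteq> 0 \<Longrightarrow> euclidean_plane (plane_at a)"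
  unfolding euclidean_plane_def plane_at_def proj_line_def
  using dim_plane subspace_hyperplane by blast

lemma line_of_spanned:
  obtains v where "v \<noteq> 0" "line_of p = span {v}"
proof -
  have L: "subspace (line_of p)" "dim (line_of p) = 1" using line_of[of p] by auto
  obtain B where B: "B \<subseteq> line_of p" "independent B" "line_of p \<subseteq> span B" "card B = dim (line_of p)"
    using basis_exists[of "line_of p"] by blast
  then obtain v where v: "B = {v}" using L by (auto simp: card_1_singleton_iff)
  then have "v \<noteq> 0" using B(2) dependent_zero by auto
  moreover have "line_of p = span {v}" using B v L span_minimal by blast
  ultimately show ?thesis using that by blast
qed

lemma line_of_Abs: "v \<noteq> 0 \<Longrightarrow> line_of (Abs_rp2 (span {v})) = span {v}"
  by (rule Abs_rp2_inverse) auto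

lemma chart_props:
  assumes "p \<in> plane_at a"
  shows "inner a (chart a p) = 1" "line_of p = span {chart a p}" "chart a p \<noteq> 0"
proof -
  obtain v where v: "v \<noteq> 0" "line_of p = span {v}" by (rule line_of_spanned)
  have "inner a v \<noteq> 0"
    using assms v unfolding plane_at_def by (auto simp: span_singleton)
  have "(THE x. x \<in> line_of p \<and> inner a x = 1) = (1 / inner a v) *\<^sub>R v"
    by (rule the_equality) (use \<open>inner a v \<noteq> 0\<close> in \<open>auto simp: v span_singleton field_simps\<close>)
  then have eq: "chart a p = (1 / inner a v) *\<^sub>R v" by (simp add: chart_def)
  then show "inner a (chart a p) = 1" using \<open>inner a v \<noteq> 0\<close> by simp
  then show "chart a p \<noteq> 0" by auto
  have "span {chart a p} = span {v}"
    using span_image_scale[of "{v}" "\<lambda>_. 1 / inner a v"] \<open>inner a v \<noteq> 0\<close> eq by simp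
  then show "line_of p = span {chart a p}" by (simp add: v)
qed

lemma chart_inj: "inj_on (chart a) (plane_at a)"
  by (rule inj_onI) (metis chart_props(2) line_of_inject)

lemma cross3_nonzero_of_distinct_lines:
  assumes "p \<noteq> q" "line_of p = span {x}" "line_of q = span {y}"
  shows "cross3 x y \<noteq> 0"
proof
  assume "cross3 x y = 0"
  have nz: "x \<noteq> 0" "y \<noteq> 0"
    using assms(2,3) line_of[of p] line_of[of q] by auto
  then obtain c where c: "y = c *\<^sub>R x"
    using \<open>cross3 x y = 0\<close> by (auto simp: cross_eq_0 collinear_lemma)
  then have "c \<noteq> 0" using nz by auto
  then have "span {y} = span {x}"
    using span_image_scale[of "{x}" "\<lambda>_. c"] c by simp
  then show False using assms by (metis line_of_inject)
qed

lemma orient_eq_0_if_plane: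
  assumes "a \<noteq> 0" "inner a x = 0" "inner a y = 0" "inner a z = 0" shows "orient x y z = 0"
  using cramer_dual[of x y z a] assms by simp

lemma general_position_iff_orient:
  assumes v: "\<And>p. p \<in> S \<Longrightarrow> line_of p = span {v p}"
  shows "general_position S \<longleftrightarrow>
    (\<forall>p\<in>S. \<forall>q\<in>S. \<forall>r\<in>S. distinct [p, q, r] \<longrightarrow> orient (v p) (v q) (v r) \<noteq> 0)"
    (is "_ = ?R")
proof
  assume gp: "general_position S"
  show ?R
  proof (intro ballI impI notI)
    fix p q r assume pqr: "p \<in> S" "q \<in> S" "r \<in> S" "distinct [p, q, r]" "orient (v p) (v q) (v r) = 0"
    define a where "a = cross3 (v p) (v q)"
    have a: "a \<noteq> 0" "inner a (v p) = 0" "inner a (v q) = 0" "inner a (v r) = 0"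
      using cross3_nonzero_of_distinct_lines[of p q "v p" "v q"] pqr v orient_rotate[of "v p" "v q" "v r"]
      by (auto simp: a_def dot_cross_self orient_def inner_commute)
    have "span {w} \<subseteq> {x. inner a x = 0}" if "inner a w = 0" for w
      using that by (intro span_minimal) (auto simp: subspace_hyperplane)
    then have "{p, q, r} \<subseteq> {p. line_of p \<subseteq> {x. inner a x = 0}}" using a v pqr by auto
    moreover have "proj_line {p. line_of p \<subseteq> {x. inner a x = 0}}"
      unfolding proj_line_def using dim_plane[OF a(1)] subspace_hyperplane by blast
    moreover have "card {p, q, r} = 3" using pqr(4) by simp
    ultimately show False using gp pqr unfolding general_position_def by (metis empty_subsetI insert_subset)
  qed
next
  assume R: ?R
  show "general_position S"
    unfolding general_position_def
  proof (intro allI impI notI)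
    fix T assume T: "T \<subseteq> S" "card T = 3" and "\<exists>l. proj_line l \<and> T \<subseteq> l"
    then obtain W where W: "subspace W" "dim W = 2" "\<And>p. p \<in> T \<Longrightarrow> line_of p \<subseteq> W"
      unfolding proj_line_def by blast
    obtain a where a: "a \<noteq> 0" "\<And>y. y \<in> span W \<Longrightarrow> orthogonal a y"
      using orthogonal_to_subspace_exists[of W] W(2) by auto
    obtain p q r where pqr: "T = {p, q, r}" "p \<noteq> q" "q \<noteq> r" "p \<noteq> r" using T(2) by (auto simp: card_3_iff)
    have "inner a (v s) = 0" if "s \<in> T" for s
    proof -
      have "v s \<in> W" using W(3)[OF that] v[of s] that T(1) span_base[of "v s" "{v s}"] by auto
      then show ?thesis using a(2) span_base by (auto simp: orthogonal_def)
    qed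
    then have "orient (v p) (v q) (v r) = 0" using orient_eq_0_if_plane[OF a(1)] pqr by simp
    then show False using R T(1) pqr by auto
  qed
qed

section \<open>Lists all of whose triples satisfy a relation\<close>

text \<open>The analogue of \<^const>\<open>sorted_wrt\<close> for ternary relations.\<close>

fun triplewise :: "('a \<Rightarrow> 'a \<Rightarrow> 'a \<Rightarrow> bool) \<Rightarrow> 'a list \<Rightarrow> bool" where
  "triplewise P [] \<longleftrightarrow> True"
| "triplewise P (x # xs) \<longleftrightarrow> sorted_wrt (P x) xs \<and> triplewise P xs"

lemma triplewise_append:
  "triplewise P (xs @ ys) \<longleftrightarrow> triplewise P xs \<and> triplewise P ys \<and>
     (\<forall>z\<in>set ys. sorted_wrt (\<lambda>x y. P x y z) xs) \<and> (\<forall>x\<in>set xs. sorted_wrt (P x) ys)"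
  by (induction xs) (auto simp: sorted_wrt_append)

lemma triplewise_rev: "triplewise P (rev xs) \<longleftrightarrow> triplewise (\<lambda>x y z. P z y x) xs"
  by (induction xs) (auto simp: triplewise_append sorted_wrt_rev)

lemma triplewise_nth:
  "triplewise P xs \<Longrightarrow> i < j \<Longrightarrow> j < k \<Longrightarrow> k < length xs \<Longrightarrow> P (xs ! i) (xs ! j) (xs ! k)"
proof (induction xs arbitrary: i j k)
  case (Cons x xs)
  then obtain j' k' where jk: "j = Suc j'" "k = Suc k'" by (metis less_imp_Suc_add)
  show ?case
  proof (cases i)
    case 0 then show ?thesis using Cons.prems jk by (auto simp: sorted_wrt_iff_nth_less)
  next
    case (Suc i') then show ?thesis using Cons jk by auto
  qed
qed simp

lemma sorted_wrt_conj:
  "sorted_wrt R xs \<Longrightarrow> sorted_wrt P xs \<Longrightarrow> sorted_wrt (\<lambda>a b. R a b \<and> P a b) xs"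
  by (simp add: sorted_wrt_iff_nth_less)

lemma triplewise_mono:
  assumes "sorted_wrt R xs" "triplewise P xs"
    and "\<And>a b c. {a, b, c} \<subseteq> set xs \<Longrightarrow> R a b \<Longrightarrow> R a c \<Longrightarrow> R b c \<Longrightarrow> P a b c \<Longrightarrow> Q a b c"
  shows "triplewise Q xs"
  using assms
proof (induction xs)
  case (Cons x xs)
  have "sorted_wrt (\<lambda>b c. R b c \<and> P x b c) xs"
    using Cons.prems(1,2) by (intro sorted_wrt_conj) auto
  then have "sorted_wrt (Q x) xs"
    by (rule sorted_wrt_mono_rel[rotated]) (use Cons.prems(1,3) in auto)
  moreover have "triplewise Q xs" using Cons by simp
  ultimately show ?case by simp
qed simp

lemma triplewise_if_all:
  assumes "sorted_wrt R xs"
    and "\<And>a b c. a \<in> set xs \<Longrightarrow> b \<in> set xs \<Longrightarrow> c \<in> set xs \<Longrightarrow> R a b \<Longrightarrow> R b c \<Longrightarrow> P a b c"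
  shows "triplewise P xs"
  using assms
proof (induction xs)
  case (Cons x xs)
  have "sorted_wrt (P x) xs"
    by (rule sorted_wrt_mono_rel[of _ R]) (use Cons.prems in auto)
  then show ?case using Cons by auto
qed simp

text \<open>Transitivity of a relation of triples makes a list which is consistent at its last three elements
consistent throughout.\<close>

lemma triplewise_extend_right:
  assumes S: "set xs \<union> {a, b, c} \<subseteq> S" and sorted: "sorted_wrt R (xs @ [a, b, c])"
    and trip: "triplewise P (xs @ [a, b])" "P a b c"
    and trans: "\<And>u v w z. {u, v, w, z} \<subseteq> S \<Longrightarrow> R u v \<Longrightarrow> R v w \<Longrightarrow> R w z \<Longrightarrow>
      P u v w \<Longrightarrow> P v w z \<Longrightarrow> P u v z \<and> P u w z"
  shows "triplewise P (xs @ [a, b, c])"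
proof -
  have R: "R u a" "R u b" "R u c" "R a b" "R a c" "R b c" if "u \<in> set xs" for u
    using sorted that by (auto simp: sorted_wrt_append)
  have R': "R a b" "R b c" using sorted by (auto simp: sorted_wrt_append)
  have *: "P u b c" if "u \<in> set xs" for u
  proof -
    have "P u a b" using trip(1) that by (auto simp: triplewise_append)
    then show ?thesis using trans[of u a b c] R[OF that] that S trip(2) by auto
  qed
  have **: "P u a c" if "u \<in> set xs" for u
  proof -
    have "P u a b" using trip(1) that by (auto simp: triplewise_append)
    then show ?thesis using trans[of u a b c] R[OF that] that S trip(2) by auto
  qed
  moreover have "sorted_wrt (\<lambda>u v. R u v \<and> P u v b) xs"
    using trip(1) sorted by (intro sorted_wrt_conj) (auto simp: triplewise_append sorted_wrt_append)
  moreover have "P u v c" if "u \<in> set xs" "v \<in> set xs" "R u v \<and> P u v b" for u v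
    using trans[of u v b c] R(2)[OF that(2)] R'(2) *[OF that(2)] that S by auto
  ultimately have "sorted_wrt (\<lambda>u v. P u v c) xs"
    using sorted_wrt_mono_rel[of xs "\<lambda>u v. R u v \<and> P u v b" "\<lambda>u v. P u v c"] by blast
  then show ?thesis
    using trip * ** by (auto simp: triplewise_append sorted_wrt_append)
qed

lemma triplewise_extend_left:
  assumes S: "set xs \<union> {a, b, c} \<subseteq> S" and sorted: "sorted_wrt R (a # b # c # xs)"
    and trip: "triplewise P (b # c # xs)" "P a b c"
    and trans: "\<And>u v w z. {u, v, w, z} \<subseteq> S \<Longrightarrow> R u v \<Longrightarrow> R v w \<Longrightarrow> R w z \<Longrightarrow>
      P u v w \<Longrightarrow> P v w z \<Longrightarrow> P u v z \<and> P u w z"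
  shows "triplewise P (a # b # c # xs)"
proof -
  have "triplewise (\<lambda>x y z. P z y x) (rev xs @ [c, b, a])"
  proof (rule triplewise_extend_right[of _ _ _ _ S "\<lambda>x y. R y x"])
    show "sorted_wrt (\<lambda>x y. R y x) (rev xs @ [c, b, a])"
      using sorted sorted_wrt_rev[of "\<lambda>x y. R y x" "a # b # c # xs"] by simp
    show "triplewise (\<lambda>x y z. P z y x) (rev xs @ [c, b])"
      using trip triplewise_rev[of "\<lambda>x y z. P z y x" "b # c # xs"] by simp
    show "P z v u \<and> P z w u"
      if "{u, v, w, z} \<subseteq> S" "R v u" "R w v" "R z w" "P w v u" "P z w v" for u v w z
      using trans[of z w v u] that by blast
  qed (use S trip in auto)
  then show ?thesis using triplewise_rev[of "\<lambda>x y z. P z y x" "a # b # c # xs"] by simp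
qed


lemma exists_sorted_list:
  fixes f :: "'a \<Rightarrow> 'b::linorder"
  assumes "finite T" "inj_on f T"
  obtains xs where "set xs = T" "distinct xs" "sorted_wrt (\<lambda>a b. f a < f b) xs"
proof -
  define xs where "xs = map (the_inv_into T f) (sorted_list_of_set (f ` T))"
  have f_inv: "f (the_inv_into T f y) = y" if "y \<in> f ` T" for y
    using f_the_inv_into_f[OF assms(2) that] .
  have "set xs = T"
    using assms by (simp add: xs_def image_image the_inv_into_f_f)
  moreover have sorted: "sorted_wrt (\<lambda>a b. f a < f b) xs"
    unfolding xs_def sorted_wrt_map
    by (rule sorted_wrt_mono_rel[OF _ strict_sorted_list_of_set]) (use assms f_inv in auto)
  moreover have "distinct xs"
    using assms inj_on_the_inv_into[OF assms(2)] by (simp add: xs_def distinct_map)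
  ultimately show ?thesis using that by blast
qed

text \<open>Adjacent transpositions generate all permutations, so that a symmetric relation of four indices
need only be checked on increasing ones.\<close>

lemma all_orders_if_sorted:
  fixes P :: "nat \<Rightarrow> nat \<Rightarrow> nat \<Rightarrow> nat \<Rightarrow> bool"
  assumes sw: "\<And>i j k l. P i j k l \<Longrightarrow> P j i k l" "\<And>i j k l. P i j k l \<Longrightarrow> P i k j l"
      "\<And>i j k l. P i j k l \<Longrightarrow> P i j l k"
    and sorted: "\<And>i j k l. i < j \<Longrightarrow> j < k \<Longrightarrow> k < l \<Longrightarrow> l < n \<Longrightarrow> P i j k l"
    and ijkl: "i < n" "j < n" "k < n" "l < n" "distinct [i, j, k, l]"
  shows "P i j k l"
proof -
  have first: "P i j k l" if asm: "j < k" "k < l" "l < n" "i < n" "i \<noteq> j" "i \<noteq> k" "i \<noteq> l" for i j k l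
  proof -
    consider "i < j" | "j < i" "i < k" | "k < i" "i < l" | "l < i" using asm by (metis linorder_neqE_nat)
    then show ?thesis
    proof cases
      case 1 then show ?thesis using sorted asm by blast
    next
      case 2 then show ?thesis using sw(1)[of j i k l] sorted[of j i k l] asm by blast
    next
      case 3 then show ?thesis
        using sw(1)[of j i k l] sw(2)[of j k i l] sorted[of j k i l] asm by blast
    next
      case 4 then show ?thesis
        using sw(1)[of j i k l] sw(2)[of j k i l] sw(3)[of j k l i] sorted[of j k l i] asm by blast
    qed
  qed
  have 2: "P i j k l" if asm: "k < l" "l < n" "i < n" "j < n" "distinct [i, j, k, l]" for i j k l
  proof -
    consider "j < k" | "k < j" "j < l" | "l < j" using asm by (auto simp: linorder_neq_iff)
    then show ?thesis
    proof cases
      case 1 then show ?thesis using first[of j k l i] asm by auto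
    next
      case 2 then show ?thesis using sw(2)[of i k j l] first[of k j l i] asm by auto
    next
      case 3 then show ?thesis
        using sw(2)[of i k j l] sw(3)[of i k l j] first[of k l j i] asm by auto
    qed
  qed
  show ?thesis
  proof (cases "k < l")
    case True then show ?thesis using 2 ijkl by blast
  next
    case False then show ?thesis using 2[of l k i j] sw(3)[of i j l k] ijkl by auto
  qed
qed

section \<open>Cups and caps, chains and antichains\<close>

definition mono_chain ::
  "('a \<Rightarrow> 'a \<Rightarrow> bool) \<Rightarrow> ('a \<Rightarrow> 'a \<Rightarrow> 'a \<Rightarrow> bool) \<Rightarrow> 'a set \<Rightarrow> 'a list \<Rightarrow> bool" where
  "mono_chain R P S xs \<longleftrightarrow> set xs \<subseteq> S \<and> sorted_wrt R xs \<and> triplewise P xs"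

text \<open>The theorem of Erdos and Szekeres on cups and caps, for any colouring of the triples of a linear
order such that both colours are transitive. If no monochromatic list of the required length
exists, let \<open>A\<close> be the set of last elements of \<open>P\<close>-lists that are one shorter. The
complement of \<open>A\<close> contains no shorter \<open>P\<close>-list; and a shorter list of the other colour
inside \<open>A\<close> starts where some \<open>P\<close>-list ends, so that one of the two lists can be extended by an
element of the other. Pascal's rule adds up the two bounds.\<close>

lemma cups_caps:
  assumes fin: "finite S"
    and R_trans: "\<And>a b c. {a, b, c} \<subseteq> S \<Longrightarrow> R a b \<Longrightarrow> R b c \<Longrightarrow> R a c"
    and R_total: "\<And>a b. {a, b} \<subseteq> S \<Longrightarrow> a \<noteq> b \<Longrightarrow> R a b \<or> R b a"
    and pos: "\<And>a b c d. {a, b, c, d} \<subseteq> S \<Longrightarrow> R a b \<Longrightarrow> R b c \<Longrightarrow> R c d \<Longrightarrow>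
      P a b c \<Longrightarrow> P b c d \<Longrightarrow> P a b d \<and> P a c d"
    and neg: "\<And>a b c d. {a, b, c, d} \<subseteq> S \<Longrightarrow> R a b \<Longrightarrow> R b c \<Longrightarrow> R c d \<Longrightarrow>
      \<not> P a b c \<Longrightarrow> \<not> P b c d \<Longrightarrow> \<not> P a b d \<and> \<not> P a c d"
    and card: "card S > (k + l) choose k"
  shows "(\<exists>xs. mono_chain R P S xs \<and> length xs = k + 2) \<or>
    (\<exists>xs. mono_chain R (\<lambda>a b c. \<not> P a b c) S xs \<and> length xs = l + 2)"
  using assms
proof (induction "k + l" arbitrary: k l S)
  case 0
  note R_total = 0(4) and card = 0(7)
  have "card S \<ge> 2" using card 0(1) by simp
  then obtain a b where ab: "a \<in> S" "b \<in> S" "a \<noteq> b"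
    by (metis card_le_Suc0_iff_eq 0(2) not_less_eq_eq numeral_2_eq_2)
  then have "mono_chain R P S [a, b] \<or> mono_chain R P S [b, a]"
    using R_total[of a b] by (auto simp: mono_chain_def)
  then show ?case using 0(1) by force
next
  case (Suc m)
  note fin = Suc(3) and R_trans = Suc(4) and R_total = Suc(5) and pos = Suc(6) and neg = Suc(7) and card = Suc(8)
  let ?N = "\<lambda>a b c. \<not> P a b c"
  show ?case
  proof (cases "k = 0 \<or> l = 0")
    case True
    have "card S \<ge> 2" using card True by auto
    then obtain a b where ab: "a \<in> S" "b \<in> S" "a \<noteq> b"
      by (metis card_le_Suc0_iff_eq fin not_less_eq_eq numeral_2_eq_2)
    then obtain xs where "set xs \<subseteq> S" "sorted_wrt R xs" "length xs = 2" "triplewise P xs" "triplewise ?N xs"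
      using R_total[of a b] that[of "[a, b]"] that[of "[b, a]"] by auto
    then show ?thesis using True unfolding mono_chain_def by force
  next
    case False
    then obtain k' l' where kl: "k = Suc k'" "l = Suc l'" by (auto simp: gr0_conv_Suc)
    \<comment> \<open>Lists with \<open>k + 1\<close> elements have at least two, as \<open>k > 0\<close>; the last two of them are named.\<close>
    define A where "A = {p \<in> S. \<exists>ys a. mono_chain R P S (ys @ [a, p]) \<and> length ys = k'}"
    have "A \<subseteq> S" by (auto simp: A_def)
    have "card S = card A + card (S - A)"
      using fin \<open>A \<subseteq> S\<close> by (metis card_Diff_subset card_mono finite_subset le_add_diff_inverse)
    moreover have "(k + l) choose k = ((k' + l) choose k') + ((k + l') choose k)"
      by (simp add: kl)
    ultimately have "\<not> (card (S - A) \<le> (k' + l) choose k' \<and> card A \<le> (k + l') choose k)"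
      using card add_mono[of "card A" "(k + l') choose k" "card (S - A)" "(k' + l) choose k'"]
      by (metis add.commute not_less)
    then consider "card (S - A) > (k' + l) choose k'" | "card A > (k + l') choose k"
      unfolding not_less[symmetric] by blast
    then show ?thesis
    proof cases
      case 1
      have "(\<exists>xs. mono_chain R P (S - A) xs \<and> length xs = k' + 2) \<or>
        (\<exists>xs. mono_chain R ?N (S - A) xs \<and> length xs = l + 2)"
      proof (rule Suc(1))
        show "m = k' + l" using Suc(2) kl by simp
        show "finite (S - A)" using fin \<open>A \<subseteq> S\<close> finite_subset by auto
        have sub: "X \<subseteq> S" if "X \<subseteq> S - A" for X using that \<open>A \<subseteq> S\<close> by blast
        show "R a c" if "{a, b, c} \<subseteq> S - A" "R a b" "R b c" for a b c
          using R_trans[OF sub[OF that(1)]] that by blast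
        show "R a b \<or> R b a" if "{a, b} \<subseteq> S - A" "a \<noteq> b" for a b
          using R_total[OF sub[OF that(1)]] that by blast
        show "P a b d \<and> P a c d" if "{a, b, c, d} \<subseteq> S - A" "R a b" "R b c" "R c d" "P a b c" "P b c d" for a b c d
          using pos[OF sub[OF that(1)]] that by blast
        show "\<not> P a b d \<and> \<not> P a c d"
          if "{a, b, c, d} \<subseteq> S - A" "R a b" "R b c" "R c d" "\<not> P a b c" "\<not> P b c d" for a b c d
          using neg[OF sub[OF that(1)]] that by blast
      qed (rule 1)
      moreover have False if xs: "mono_chain R P (S - A) xs" "length xs = k' + 2" for xs
      proof -
        obtain ys a p where ys: "xs = ys @ [a, p]" "length ys = k'"
        proof -
          obtain zs p where "xs = zs @ [p]" "length zs = Suc k'"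
            using xs(2) by (metis One_nat_def Suc_1 add_Suc_right length_Suc_conv_rev add.right_neutral)
          moreover then obtain ys a where "zs = ys @ [a]" "length ys = k'"
            by (metis length_Suc_conv_rev)
          ultimately show ?thesis using that[of ys a p] by simp
        qed
        then have "mono_chain R P S (ys @ [a, p])" using xs unfolding mono_chain_def by blast
        moreover then have "p \<in> S" by (simp add: mono_chain_def)
        ultimately have "p \<in> A" using ys(2) unfolding A_def by blast
        then show False using xs ys unfolding mono_chain_def by auto
      qed
      ultimately show ?thesis unfolding mono_chain_def by blast
    next
      case 2
      have "(\<exists>xs. mono_chain R P A xs \<and> length xs = k + 2) \<or>
        (\<exists>xs. mono_chain R ?N A xs \<and> length xs = l' + 2)"
      proof (rule Suc(1))
        show "m = k + l'" using Suc(2) kl by simp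
        show "finite (A)" using fin \<open>A \<subseteq> S\<close> finite_subset by auto
        have sub: "X \<subseteq> S" if "X \<subseteq> A" for X using that \<open>A \<subseteq> S\<close> by blast
        show "R a c" if "{a, b, c} \<subseteq> A" "R a b" "R b c" for a b c
          using R_trans[OF sub[OF that(1)]] that by blast
        show "R a b \<or> R b a" if "{a, b} \<subseteq> A" "a \<noteq> b" for a b
          using R_total[OF sub[OF that(1)]] that by blast
        show "P a b d \<and> P a c d" if "{a, b, c, d} \<subseteq> A" "R a b" "R b c" "R c d" "P a b c" "P b c d" for a b c d
          using pos[OF sub[OF that(1)]] that by blast
        show "\<not> P a b d \<and> \<not> P a c d"
          if "{a, b, c, d} \<subseteq> A" "R a b" "R b c" "R c d" "\<not> P a b c" "\<not> P b c d" for a b c d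
          using neg[OF sub[OF that(1)]] that by blast
      qed (rule 2)
      then consider (P) xs where "mono_chain R P A xs" "length xs = k + 2"
        | (N) xs where "mono_chain R ?N A xs" "length xs = l' + 2" by blast
      then show ?thesis
      proof cases
        case P then show ?thesis using \<open>A \<subseteq> S\<close> unfolding mono_chain_def by blast
      next
        case (N xs)
        then obtain p q zs where xs: "xs = p # q # zs" "length zs = l'"
          by (metis add_2_eq_Suc' length_Suc_conv)
        then have "p \<in> A" using N unfolding mono_chain_def by auto
        then obtain ys a where ys: "mono_chain R P S (ys @ [a, p])" "length ys = k'"
          unfolding A_def by blast
        have mem: "set ys \<union> {a, p, q} \<subseteq> S" "set zs \<union> {a, p, q} \<subseteq> S"
          using ys xs N \<open>A \<subseteq> S\<close> unfolding mono_chain_def by auto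
        have Rs: "R a p" "R p q" "\<forall>y\<in>set ys. R y a \<and> R y p" "\<forall>z\<in>set zs. R p z \<and> R q z"
          using ys N xs unfolding mono_chain_def by (auto simp: sorted_wrt_append)
        have Rq: "R y q" if "y \<in> set ys \<union> {a}" for y
          using R_trans[of y p q] Rs mem that by auto
        have Ra: "R a z" if "z \<in> set zs \<union> {q}" for z
          using R_trans[of a p z] Rs mem that by auto
        show ?thesis
        proof (cases "P a p q")
          case True
          have sorted: "sorted_wrt R (ys @ [a, p, q])"
            using ys(1) Rs Rq unfolding mono_chain_def by (auto simp: sorted_wrt_append)
          have "triplewise P (ys @ [a, p, q])"
            using triplewise_extend_right[of ys a p q S R P] mem(1) sorted True pos ys(1)
            unfolding mono_chain_def by blast
          then have "mono_chain R P S (ys @ [a, p, q])"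
            using sorted mem by (auto simp: mono_chain_def)
          moreover have "length (ys @ [a, p, q]) = k + 2" using ys(2) kl by simp
          ultimately show ?thesis by blast
        next
          case False
          have sorted: "sorted_wrt R (a # p # q # zs)"
            using N(1) Rs Ra xs unfolding mono_chain_def by auto
          have "triplewise ?N (a # p # q # zs)"
            using triplewise_extend_left[of zs a p q S R ?N] mem(2) sorted False neg N(1)
            unfolding mono_chain_def xs(1) by blast
          then have "mono_chain R ?N S (a # p # q # zs)"
            using sorted mem by (auto simp: mono_chain_def)
          moreover have "length (a # p # q # zs) = l + 2" using xs(2) kl by simp
          ultimately show ?thesis by blast
        qed
      qed
    qed
  qed
qed

text \<open>Mirsky's theorem: removing the minimal elements, which form an antichain, shortens all chains.\<close>

lemma card_le_chain_times_antichain: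
  assumes "finite Q"
    and trans: "\<And>a b c. {a, b, c} \<subseteq> Q \<Longrightarrow> R a b \<Longrightarrow> R b c \<Longrightarrow> R a c"
    and chain: "\<And>xs. set xs \<subseteq> Q \<Longrightarrow> sorted_wrt R xs \<Longrightarrow> length xs \<le> H"
    and antichain: "\<And>Y. Y \<subseteq> Q \<Longrightarrow> (\<And>a b. a \<in> Y \<Longrightarrow> b \<in> Y \<Longrightarrow> \<not> R a b) \<Longrightarrow> card Y \<le> A"
  shows "card Q \<le> H * A"
  using assms
proof (induction H arbitrary: Q)
  case 0
  have "Q = {}"
  proof (rule ccontr)
    assume "Q \<noteq> {}"
    then obtain q where "q \<in> Q" by blast
    then show False using 0(3)[of "[q]"] by simp
  qed
  then show ?case by simp
next
  case (Suc H)
  note trans = Suc(3) and chain = Suc(4) and antichain = Suc(5)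
  define M where "M = {q \<in> Q. \<forall>p\<in>Q. \<not> R p q}"
  have "card (Q - M) \<le> H * A"
  proof (rule Suc(1))
    fix xs assume xs: "set xs \<subseteq> Q - M" "sorted_wrt R xs"
    show "length xs \<le> H"
    proof (cases xs)
      case (Cons x ys)
      then obtain p where p: "p \<in> Q" "R p x" using xs(1) unfolding M_def by auto
      then have "sorted_wrt R (p # xs)" using xs Cons trans[of p x] by auto
      then show ?thesis using chain[of "p # xs"] xs p by auto
    qed simp
  next
    show "finite (Q - M)" using Suc(2) by simp
    show "R a c" if "{a, b, c} \<subseteq> Q - M" "R a b" "R b c" for a b c
      using trans[of a b c] that by blast
    show "card Y \<le> A" if "Y \<subseteq> Q - M" "\<And>a b. a \<in> Y \<Longrightarrow> b \<in> Y \<Longrightarrow> \<not> R a b" for Y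
      using antichain[of Y] that by blast
  qed
  moreover have "card M \<le> A" by (rule antichain) (auto simp: M_def)
  moreover have "card Q = card M + card (Q - M)"
    using Suc(2) by (metis (no_types, lifting) M_def card_Diff_subset card_mono finite_subset
        le_add_diff_inverse mem_Collect_eq subsetI)
  ultimately show ?case by simp
qed


section \<open>Planar configurations\<close>

text \<open>Grassmann-Pluecker relations, written so that all factors containing \<open>u\<close> are positive if \<open>u\<close> sees the
points in the order \<open>a\<close>, \<open>b\<close>, \<open>c\<close>, \<open>d\<close>.\<close>

lemma pencil_identities:
  "orient u b c * orient a b d = orient u a b * orient b c d + orient u b d * orient a b c"
  "orient u b c * orient a c d = orient u a c * orient b c d + orient u c d * orient a b c"
  "orient u a c * orient a b d = orient u a b * orient a c d + orient u a d * orient a b c"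
  "orient u b d * orient a c d = orient u a d * orient b c d + orient u c d * orient a b d"
  unfolding orient_expand by algebra+

text \<open>The transitivity required by \<open>cups_caps\<close>, for the order in which \<open>u\<close> sees the points. With the point at
infinity of the vertical lines for \<open>u\<close> this is the order by abscissa; with a vertex of a cap for
\<open>u\<close> it is the order of the chains of a cell.\<close>

lemma pencil_transitive:
  assumes "orient u a b > 0" "orient u a c > 0" "orient u b c > 0" "orient u b d > 0" "orient u c d > 0"
  shows "orient a b c > 0 \<Longrightarrow> orient b c d > 0 \<Longrightarrow> orient a b d > 0 \<and> orient a c d > 0"
    and "orient a b c < 0 \<Longrightarrow> orient b c d < 0 \<Longrightarrow> orient a b d < 0 \<and> orient a c d < 0"
proof -
  assume "orient a b c > 0" "orient b c d > 0"
  then have "orient u a b * orient b c d + orient u b d * orient a b c > 0"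
    "orient u a c * orient b c d + orient u c d * orient a b c > 0"
    using assms by (auto intro!: add_pos_pos)
  then show "orient a b d > 0 \<and> orient a c d > 0"
    using assms(3) by (simp flip: pencil_identities(1,2) add: zero_less_mult_iff)
next
  assume "orient a b c < 0" "orient b c d < 0"
  then have "orient u a b * orient b c d + orient u b d * orient a b c < 0"
    "orient u a c * orient b c d + orient u c d * orient a b c < 0"
    using assms by (auto intro!: add_neg_neg mult_pos_neg)
  then show "orient a b d < 0 \<and> orient a c d < 0"
    using assms(3) by (simp flip: pencil_identities(1,2) add: mult_less_0_iff)
qed

text \<open>The abscissa is given by a functional \<open>g\<close> instead of a coordinate, so that replacing \<open>g\<close> by \<open>- g\<close> exchanges
cups and caps.\<close>

locale planar =
  fixes f g :: "real^3" and V :: "(real^3) set"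
  assumes finite_V: "finite V"
    and on_plane: "v \<in> V \<Longrightarrow> inner f v = 1"
    and inj_g: "inj_on (inner g) V"
    and generic: "a \<in> V \<Longrightarrow> b \<in> V \<Longrightarrow> c \<in> V \<Longrightarrow> distinct [a, b, c] \<Longrightarrow> orient a b c \<noteq> 0"
begin

definition lt :: "real^3 \<Rightarrow> real^3 \<Rightarrow> bool" (infix \<open>\<lhd>\<close> 50) where
  "a \<lhd> b \<longleftrightarrow> inner g a < inner g b"

definition cap :: "real^3 \<Rightarrow> real^3 \<Rightarrow> real^3 \<Rightarrow> bool" where
  "cap a b c \<longleftrightarrow> a \<in> V \<and> b \<in> V \<and> c \<in> V \<and> a \<lhd> b \<and> b \<lhd> c \<and> orient a b c < 0"

lemma lt_trans [trans]: "a \<lhd> b \<Longrightarrow> b \<lhd> c \<Longrightarrow> a \<lhd> c"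
  and lt_irrefl [simp]: "\<not> a \<lhd> a"
  and lt_asym: "a \<lhd> b \<Longrightarrow> \<not> b \<lhd> a"
  by (auto simp: lt_def)

lemma lt_total: "a \<in> V \<Longrightarrow> b \<in> V \<Longrightarrow> a \<noteq> b \<Longrightarrow> a \<lhd> b \<or> b \<lhd> a"
  unfolding lt_def using inj_onD[OF inj_g, of a b] by (metis linorder_neqE)

lemma generic_lt: "a \<in> V \<Longrightarrow> b \<in> V \<Longrightarrow> c \<in> V \<Longrightarrow> a \<lhd> b \<Longrightarrow> b \<lhd> c \<Longrightarrow> orient a b c \<noteq> 0"
  by (rule generic) (auto simp: lt_def)

lemma orient_infinity:
  "a \<in> V \<Longrightarrow> b \<in> V \<Longrightarrow> orient (cross3 f g) a b = inner g b - inner g a"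
  by (simp add: orient_cross on_plane)

lemma orient_infinity_pos: "a \<in> V \<Longrightarrow> b \<in> V \<Longrightarrow> a \<lhd> b \<Longrightarrow> orient (cross3 f g) a b > 0"
  by (simp add: orient_infinity lt_def)

context
  fixes a b c d
  assumes V: "a \<in> V" "b \<in> V" "c \<in> V" "d \<in> V" and lt: "a \<lhd> b" "b \<lhd> c" "c \<lhd> d"
begin

lemma up: "orient (cross3 f g) a b > 0" "orient (cross3 f g) a c > 0" "orient (cross3 f g) a d > 0"
  "orient (cross3 f g) b c > 0" "orient (cross3 f g) b d > 0" "orient (cross3 f g) c d > 0"
  using V lt by (auto intro!: orient_infinity_pos intro: lt_trans)

lemma four_trans_neg:
  assumes "orient a b c < 0" "orient b c d < 0"
  shows "orient a b d < 0" "orient a c d < 0"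
  using pencil_transitive(2)[of "cross3 f g" a b c d] up assms by auto

lemma four_trans_pos:
  assumes "orient a b c > 0" "orient b c d > 0"
  shows "orient a b d > 0" "orient a c d > 0"
  using pencil_transitive(1)[of "cross3 f g" a b c d] up assms by auto

lemma four_left: "orient a b c < 0 \<Longrightarrow> orient a c d < 0 \<Longrightarrow> orient a b d < 0"
  using pencil_identities(3)[of "cross3 f g" a c b d] up
  by (smt (verit, best) mult_pos_neg mult_less_0_iff zero_less_mult_iff)

lemma four_right: "orient a b d < 0 \<Longrightarrow> orient b c d < 0 \<Longrightarrow> orient a c d < 0"
  using pencil_identities(4)[of "cross3 f g" b d a c] up
  by (smt (verit, best) mult_pos_neg mult_less_0_iff zero_less_mult_iff)

lemma four_first: "orient a b d > 0 \<Longrightarrow> orient b c d < 0 \<Longrightarrow> orient a b c > 0"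
  using pencil_identities(1)[of "cross3 f g" b c a d] up
  by (smt (verit, best) mult_pos_neg mult_less_0_iff zero_less_mult_iff)

lemma four_last: "orient a b c < 0 \<Longrightarrow> orient a c d > 0 \<Longrightarrow> orient b c d > 0"
  using pencil_identities(2)[of "cross3 f g" b c a d] up
  by (smt (verit, best) mult_pos_neg mult_less_0_iff zero_less_mult_iff)

end

lemma cap_trans:
  assumes "cap a b c" "cap b c d"
  shows "cap a b d" "cap a c d"
  using four_trans_neg[of a b c d] assms unfolding cap_def by (auto intro: lt_trans)

lemma cap_left: "cap a b c \<Longrightarrow> cap a c d \<Longrightarrow> cap a b d"
  using four_left[of a b c d] unfolding cap_def by (auto intro: lt_trans)

lemma cap_right: "cap a b d \<Longrightarrow> cap b c d \<Longrightarrow> cap a c d"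
  using four_right[of a b c d] unfolding cap_def by (auto intro: lt_trans)

end


section \<open>Points beyond the edges of a cap\<close>

locale frame = planar +
  fixes X :: "nat \<Rightarrow> real^3" and t :: nat
  assumes X_cap: "i < j \<Longrightarrow> j < l \<Longrightarrow> l \<le> t \<Longrightarrow> cap (X i) (X j) (X l)"
    and t_ge: "t \<ge> 3"
begin

text \<open>The points of \<open>V\<close> beyond the edge from \<open>X (j - 1)\<close> to \<open>X j\<close> that can be inserted into the cap \<open>X\<close>: for an
inner edge, the triangle bounded by this edge and the extensions of the two neighbouring edges.\<close>

definition cell :: "nat \<Rightarrow> (real^3) set" where
  "cell j = {p. cap (X (j - 1)) p (X j) \<and> (2 \<le> j \<longrightarrow> cap (X (j - 2)) (X (j - 1)) p) \<and>
     (j < t \<longrightarrow> cap p (X j) (X (j + 1)))}"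

lemma X_V: "i \<le> t \<Longrightarrow> X i \<in> V"
proof -
  assume "i \<le> t"
  then consider "i = 0" | "0 < i" "i < t" | "i = t" "i \<ge> 2" using t_ge by linarith
  then show ?thesis
  proof cases
    case 1 then show ?thesis using X_cap[of 0 1 2] t_ge by (auto simp: cap_def)
  next
    case 2 then show ?thesis using X_cap[of 0 i t] by (auto simp: cap_def)
  next
    case 3 then show ?thesis using X_cap[of 0 1 t] t_ge by (auto simp: cap_def)
  qed
qed

lemma X_lt: assumes "i < j" "j \<le> t" shows "X i \<lhd> X j"
proof (cases "j < t")
  case True then show ?thesis using X_cap[of i j t] assms by (auto simp: cap_def)
next
  case False
  then have "j = t" using assms by simp
  then consider "i + 1 < t" | "0 < i" "i < t" using assms t_ge by linarith
  then show ?thesis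
  proof cases
    case 1 then show ?thesis using X_cap[of i "i + 1" t] \<open>j = t\<close> by (auto simp: cap_def intro: lt_trans)
  next
    case 2 then show ?thesis using X_cap[of 0 i t] \<open>j = t\<close> by (auto simp: cap_def)
  qed
qed

lemma cell_V: "cell j \<subseteq> V" by (auto simp: cell_def cap_def)

lemma finite_cell: "finite (cell j)" using cell_V finite_V by (rule finite_subset)

lemma cellD:
  assumes "p \<in> cell j" "2 \<le> j" "j < t"
  shows "cap (X (j - 1)) p (X j)" "cap (X (j - 2)) (X (j - 1)) p" "cap p (X j) (X (j + 1))"
    "cap (X (j - 2)) p (X j)" "cap (X (j - 2)) p (X (j + 1))"
proof -
  show 1: "cap (X (j - 1)) p (X j)" and 2: "cap (X (j - 2)) (X (j - 1)) p"
    and 3: "cap p (X j) (X (j + 1))"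
    using assms by (auto simp: cell_def)
  show 4: "cap (X (j - 2)) p (X j)" by (rule cap_trans(2)[OF 2 1])
  show "cap (X (j - 2)) p (X (j + 1))" by (rule cap_trans(1)[OF 4 3])
qed

lemma cell_order:
  assumes "p \<in> cell i" "q \<in> cell j" "i < j" "j \<le> t"
  shows "p \<lhd> q"
proof -
  have "p \<lhd> X i" "X (j - 1) \<lhd> q" using assms by (auto simp: cell_def cap_def)
  moreover have "X i = X (j - 1) \<or> X i \<lhd> X (j - 1)" using X_lt[of i "j - 1"] assms by (cases "i = j - 1") auto
  ultimately show ?thesis by (auto intro: lt_trans)
qed

text \<open>A point in each of two adjacent cells need not form a cap with the vertex between them, but
it does with the other vertices next to them.\<close>

lemma adjacent_cells:
  assumes p: "p \<in> cell i" and q: "q \<in> cell (i + 1)" and i: "2 \<le> i" "i + 1 < t"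
  shows "cap (X (i - 1)) p q" "cap (X (i - 2)) p q" "cap p q (X (i + 1))" "cap p q (X (i + 2))"
proof -
  have i': "i < t" "2 \<le> i + 1" using i by auto
  note P = cellD[OF p i(1) i'(1)] and Q = cellD[OF q i'(2) i(2), simplified]
  show 1: "cap (X (i - 1)) p q" by (rule cap_left[OF P(1)]) (use Q(2) in simp)
  show "cap (X (i - 2)) p q" by (rule cap_trans(2)[OF P(2) 1])
  show 3: "cap p q (X (i + 1))" by (rule cap_right[OF P(3)]) (use Q(1) in simp)
  show "cap p q (X (i + 2))" by (rule cap_trans(1)[OF 3]) (use Q(3) in simp)
qed

lemma distant_cells:
  assumes p: "p \<in> cell i" and q: "q \<in> cell j" and i: "2 \<le> i" "i + 2 \<le> j" "j < t"
  shows "cap p (X (i + 1)) q" "cap p (X (j - 2)) q"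
proof -
  have ij: "i < t" "2 \<le> j" using i by auto
  note P = cellD[OF p i(1) ij(1)] and Q = cellD[OF q ij(2) i(3)]
  have 1: "cap (X i) (X (i + 1)) q"
  proof (cases "j = i + 2")
    case True then show ?thesis using Q(2) by simp
  next
    case False
    then have "i + 1 < j - 1" using i by simp
    then have Xq: "cap (X (i + 1)) (X (j - 1)) q"
    proof (cases "i + 1 = j - 2")
      case True then show ?thesis using Q(2) by simp
    next
      case False
      then show ?thesis using cap_trans(2)[OF X_cap[of "i + 1" "j - 2" "j - 1"] Q(2)] i \<open>i + 1 < j - 1\<close> by auto
    qed
    have "cap (X i) (X (i + 1)) (X (j - 1))" using X_cap \<open>i + 1 < j - 1\<close> i by auto
    then show ?thesis using cap_trans(1)[OF _ Xq] by blast
  qed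
  show "cap p (X (i + 1)) q" by (rule cap_trans(2)[OF P(3) 1])
  have 2: "cap p (X (j - 2)) (X (j - 1))"
  proof (cases "j = i + 2")
    case True then show ?thesis using P(3) by simp
  next
    case False
    then have *: "i < j - 2" "j - 2 < j - 1" "j - 1 \<le> t" using i by auto
    then have "cap (X i) (X (j - 2)) (X (j - 1))" using X_cap by blast
    moreover have "cap p (X i) (X (j - 2))"
    proof (cases "j - 2 = i + 1")
      case True then show ?thesis using P(3) by simp
    next
      case False
      then have "cap (X i) (X (i + 1)) (X (j - 2))" using X_cap[of i "i + 1" "j - 2"] * by auto
      then show ?thesis by (rule cap_trans(1)[OF P(3)])
    qed
    ultimately show ?thesis using cap_trans(2) by blast
  qed
  show "cap p (X (j - 2)) q" by (rule cap_trans(1)[OF 2 Q(2)])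
qed

end

section \<open>Chains and antichains of a cell\<close>

lemma binomial_le_power: "(a + b) choose a \<le> (b + 1) ^ a"
proof (induction a)
  case (Suc a)
  have "Suc a * (Suc (a + b) choose Suc a) = Suc (a + b) * ((a + b) choose a)"
    by (rule Suc_times_binomial)
  also have "\<dots> \<le> (Suc a * (b + 1)) * ((a + b) choose a)" by (rule mult_right_mono) auto
  also have "\<dots> \<le> (Suc a * (b + 1)) * (b + 1) ^ a" by (rule mult_left_mono[OF Suc]) simp
  also have "\<dots> = Suc a * (b + 1) ^ Suc a" by (simp only: power_Suc mult.assoc)
  finally show ?case by (metis Suc_mult_le_cancel1 add_Suc)
qed simp

lemma distinct_if_sorted_wrt_irrefl: "sorted_wrt R xs \<Longrightarrow> (\<And>x. \<not> R x x) \<Longrightarrow> distinct xs"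
  by (induction xs) auto

lemma sum_le_interleaved:
  fixes r l :: "nat \<Rightarrow> nat"
  assumes "\<And>i. 2 \<le> i \<Longrightarrow> i \<le> n + 1 \<Longrightarrow> r i + l (i + 1) \<le> k"
  shows "(\<Sum>j=2..n+2. r j + l j) \<le> n * k + r (n + 2) + l 2"
  using assms
proof (induction n)
  case (Suc n)
  have "(\<Sum>j=2..Suc n+2. r j + l j) = (\<Sum>j=2..n+2. r j + l j) + (r (Suc n + 2) + l (Suc n + 2))"
    by simp
  moreover have "(\<Sum>j=2..n+2. r j + l j) \<le> n * k + r (n + 2) + l 2" using Suc by auto
  moreover have "r (n + 2) + l (Suc n + 2) \<le> k" using Suc(2)[of "n + 2"] by simp
  ultimately show ?case by simp
qed (simp add: numeral_2_eq_2)

context frame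
begin

abbreviation "neg_turn a b c \<equiv> orient a b c < 0"
abbreviation "pos_turn a b c \<equiv> orient a b c > 0"

text \<open>In a cell, \<open>p\<close> precedes \<open>q\<close> iff \<open>p\<close> lies in the triangle with vertices \<open>X (j - 2)\<close>, \<open>X (j + 1)\<close> and \<open>q\<close>:
seen from both of these vertices of the cap, \<open>p\<close> is below \<open>q\<close>. The base of the triangle includes the
two neighbouring edges. This makes the line through two comparable points leave each adjacent cell
on one side; and the line through two incomparable points passes above both ends of the base, and so
above all cells that are not adjacent.\<close>

definition prec :: "nat \<Rightarrow> real^3 \<Rightarrow> real^3 \<Rightarrow> bool" where
  "prec j p q \<longleftrightarrow> orient (X (j - 2)) p q > 0 \<and> orient (X (j + 1)) p q < 0"

lemma prec_irrefl: "\<not> prec j p p" by (simp add: prec_def)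

lemma prec_trans:
  assumes j: "2 \<le> j" "j < t" and cell: "p \<in> cell j" "q \<in> cell j" "r \<in> cell j"
    and pq: "prec j p q" and qr: "prec j q r"
  shows "prec j p r"
proof -
  let ?u = "X (j - 2)" and ?w = "X (j + 1)"
  \<comment> \<open>The whole cell lies above the base segment, so that both of its ends see the cell within a half-plane.\<close>
  have neg: "orient ?w ?u v < 0" if "v \<in> cell j" for v
    using cellD(5)[OF that j] orient_rotate[of ?w ?u v] orient_rotate[of v ?w ?u] by (simp add: cap_def)
  then have pos: "orient ?u ?w v > 0" if "v \<in> cell j" for v
    using that orient_swap(1)[of ?u ?w v] by simp
  have "orient ?u ?w q * orient ?u p r = orient ?u ?w p * orient ?u q r + orient ?u ?w r * orient ?u p q"
    using grassmann_pluecker[of ?u ?w p q r] by linarith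
  also have "\<dots> > 0" using pos cell pq qr by (auto simp: prec_def intro!: add_pos_pos)
  finally have "orient ?u p r > 0" using pos[OF cell(2)] by (simp add: zero_less_mult_iff)
  have "orient ?w ?u q * orient ?w p r = orient ?w ?u p * orient ?w q r + orient ?w ?u r * orient ?w p q"
    using grassmann_pluecker[of ?w ?u p q r] by linarith
  moreover have "\<dots> > 0" using neg cell pq qr by (auto simp: prec_def intro!: add_pos_pos mult_neg_neg)
  ultimately have "orient ?w ?u q * orient ?w p r > 0" by linarith
  then show ?thesis using neg[OF cell(2)] \<open>orient ?u p r > 0\<close> by (simp add: prec_def zero_less_mult_iff)
qed

text \<open>The two ways in which the line through comparable points can hit the base segment.\<close>

lemma prec_cases:
  assumes "p \<in> cell j" "q \<in> cell j" "prec j p q"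
  obtains (rising) "p \<lhd> q" "orient (X (j - 2)) p q > 0"
  | (falling) "q \<lhd> p" "orient q p (X (j + 1)) > 0"
proof -
  have "p \<noteq> q" using assms(3) prec_irrefl by blast
  then have "p \<lhd> q \<or> q \<lhd> p" using lt_total assms cell_V by blast
  moreover have "orient q p (X (j + 1)) > 0"
    using assms(3) orient_rotate[of "X (j + 1)" q p] orient_rotate[of q p "X (j + 1)"]
      orient_swap(2)[of "X (j + 1)" q p] by (simp add: prec_def)
  ultimately show ?thesis using that assms(3) unfolding prec_def by blast
qed

text \<open>If only one of the two triples were a cap, the points would be comparable; if neither were, then
by transitivity \<open>p\<close> would lie below the base segment.\<close>

lemma flat_if_incomparable:
  assumes j: "2 \<le> j" "j < t" and cell: "p \<in> cell j" "q \<in> cell j" and lt: "p \<lhd> q"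
    and incomparable: "\<not> prec j p q" "\<not> prec j q p"
  shows "cap (X (j - 2)) p q" "cap p q (X (j + 1))"
proof -
  let ?u = "X (j - 2)" and ?w = "X (j + 1)"
  have V: "?u \<in> V" "p \<in> V" "q \<in> V" "?w \<in> V" using X_V cell_V cell j by auto
  have p: "cap ?u p ?w" and q: "cap ?u q ?w" using cellD(5) cell j by auto
  then have order: "?u \<lhd> p" "q \<lhd> ?w" by (auto simp: cap_def)
  have rot: "orient ?w p q = orient p q ?w" using orient_rotate[of ?w p q] orient_rotate[of p q ?w] by simp
  have u: "orient ?u p q < 0"
  proof (rule ccontr)
    assume "\<not> orient ?u p q < 0"
    then have 1: "orient ?u p q > 0" using generic_lt[of ?u p q] V order lt by linarith
    then have "orient p q ?w > 0"
      using generic_lt[of p q ?w] incomparable(1) rot V order lt unfolding prec_def by linarith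
    then have "orient ?u p ?w > 0" using four_trans_pos(1)[of ?u p q ?w] 1 V order lt by blast
    then show False using p by (simp add: cap_def)
  qed
  have "\<not> orient p q ?w > 0"
    using incomparable(2) u rot orient_swap(2)[of ?u q p] orient_swap(2)[of ?w q p] by (simp add: prec_def)
  then have "orient p q ?w < 0" using generic_lt[of p q ?w] V order lt by linarith
  then show "cap ?u p q" "cap p q ?w" using u V order lt by (auto simp: cap_def)
qed

text \<open>The line through two comparable points passes below one end of the base. A point of the next cell
on the wrong side of the line would form a cup with this end and the lower one of the two points,
whereas such triples are caps.\<close>

lemma turn_before:
  assumes i: "2 \<le> i" "i + 1 < t" and p: "p \<in> cell i" "p' \<in> cell i" "prec i p p'" and q: "q \<in> cell (i + 1)"
  shows "orient p' p q > 0"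
proof -
  have V: "p \<in> V" "p' \<in> V" "q \<in> V" "X (i - 2) \<in> V" "X (i + 1) \<in> V" using p q cell_V X_V i by auto
  note adj = adjacent_cells[OF p(1) q i]
  have "p' \<lhd> q" "p \<lhd> q" using cell_order[of _ i q "i + 1"] p q i by auto
  from p show ?thesis
  proof (cases rule: prec_cases)
    case rising
    have "\<not> orient p p' q > 0"
      using four_trans_pos(1)[of "X (i - 2)" p p' q] adj(2) rising V \<open>p' \<lhd> q\<close> by (auto simp: cap_def)
    then show ?thesis
      using generic_lt[of p p' q] V rising(1) \<open>p' \<lhd> q\<close> orient_swap(1)[of p' p q] by linarith
  next
    case falling
    then show ?thesis
      using four_first[of p' p q "X (i + 1)"] adj(3) V by (auto simp: cap_def)
  qed
qed

text \<open>The mirror image of \<open>turn_before\<close>.\<close>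

lemma turn_after:
  assumes i: "2 \<le> i" "i + 1 < t" and p: "p \<in> cell i"
    and q: "q \<in> cell (i + 1)" "q' \<in> cell (i + 1)" "prec (i + 1) q q'"
  shows "orient p q q' > 0"
proof -
  have V: "p \<in> V" "q \<in> V" "q' \<in> V" "X (i - 1) \<in> V" "X (i + 2) \<in> V" using p q cell_V X_V i by auto
  note adj = adjacent_cells[OF p q(1) i] and adj' = adjacent_cells[OF p q(2) i]
  have idx: "i + 1 - 2 = i - 1" "i + 1 + 1 = i + 2" by auto
  from q show ?thesis
  proof (cases rule: prec_cases)
    case rising
    then show ?thesis
      using four_last[of "X (i - 1)" p q q'] adj(1) V unfolding idx by (auto simp: cap_def)
  next
    case falling
    have "p \<lhd> q'" using cell_order[of p i q' "i + 1"] p q i by auto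
    have "\<not> orient p q' q > 0"
      using four_trans_pos(1)[of p q' q "X (i + 2)"] adj(4) adj'(4) falling V \<open>p \<lhd> q'\<close>
      unfolding idx by (auto simp: cap_def)
    then show ?thesis
      using generic_lt[of p q' q] V falling(1) \<open>p \<lhd> q'\<close> orient_swap(2)[of p q q'] by linarith
  qed
qed

text \<open>The caps within an antichain of a cell. The lines through their points pass above the vertices
\<open>X (j - 2)\<close> and \<open>X (j + 1)\<close>, and hence above all cells but the adjacent ones.\<close>

definition flat_cap :: "nat \<Rightarrow> (real^3) set \<Rightarrow> bool" where
  "flat_cap j Y \<longleftrightarrow> Y \<subseteq> cell j \<and>
     (\<forall>p\<in>Y. \<forall>q\<in>Y. p \<lhd> q \<longrightarrow> cap (X (j - 2)) p q \<and> cap p q (X (j + 1))) \<and>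
     (\<forall>p\<in>Y. \<forall>q\<in>Y. \<forall>r\<in>Y. p \<lhd> q \<longrightarrow> q \<lhd> r \<longrightarrow> cap p q r)"

definition cap_size :: "nat \<Rightarrow> nat" where
  "cap_size j = Max (card ` {Y. flat_cap j Y})"

definition neg_size :: "nat \<Rightarrow> nat" where
  "neg_size j = Max (length ` {xs. mono_chain (prec j) neg_turn (cell j) xs})"

definition pos_size :: "nat \<Rightarrow> nat" where
  "pos_size j = Max (length ` {xs. mono_chain (prec j) pos_turn (cell j) xs})"

lemma distinct_chain: "sorted_wrt (prec j) xs \<Longrightarrow> distinct xs"
  by (erule distinct_if_sorted_wrt_irrefl) (rule prec_irrefl)

lemma finite_flat_caps: "finite {Y. flat_cap j Y}"
  by (rule finite_subset[of _ "Pow (cell j)"]) (auto simp: flat_cap_def finite_cell)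

lemma finite_chains: "finite {xs. mono_chain (prec j) P (cell j) xs}"
  by (rule finite_subset[OF _ finite_subset_distinct[OF finite_cell[of j]]])
    (auto simp: mono_chain_def intro: distinct_chain)

lemma flat_cap_le: "flat_cap j Y \<Longrightarrow> card Y \<le> cap_size j"
  unfolding cap_size_def using finite_flat_caps by (intro Max_ge) auto

lemma obtain_flat_cap: obtains Y where "flat_cap j Y" "card Y = cap_size j"
proof -
  have "flat_cap j {}" by (simp add: flat_cap_def)
  then have "cap_size j \<in> card ` {Y. flat_cap j Y}"
    unfolding cap_size_def using finite_flat_caps by (intro Max_in) auto
  then show ?thesis using that by auto
qed

lemma chain_le:
  "mono_chain (prec j) neg_turn (cell j) xs \<Longrightarrow> length xs \<le> neg_size j"
  "mono_chain (prec j) pos_turn (cell j) xs \<Longrightarrow> length xs \<le> pos_size j"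
  unfolding neg_size_def pos_size_def using finite_chains by (auto intro!: Max_ge)

lemma obtain_neg_chain:
  obtains xs where "mono_chain (prec j) neg_turn (cell j) xs" "length xs = neg_size j"
proof -
  have "mono_chain (prec j) neg_turn (cell j) []" by (simp add: mono_chain_def)
  then have "neg_size j \<in> length ` {xs. mono_chain (prec j) neg_turn (cell j) xs}"
    unfolding neg_size_def using finite_chains by (intro Max_in) auto
  then show ?thesis using that by auto
qed

lemma obtain_pos_chain:
  obtains xs where "mono_chain (prec j) pos_turn (cell j) xs" "length xs = pos_size j"
proof -
  have "mono_chain (prec j) pos_turn (cell j) []" by (simp add: mono_chain_def)
  then have "pos_size j \<in> length ` {xs. mono_chain (prec j) pos_turn (cell j) xs}"
    unfolding pos_size_def using finite_chains by (intro Max_in) auto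
  then show ?thesis using that by auto
qed

text \<open>The polygon descends along the first chain, crosses over to the next cell near the cap \<open>X\<close>, and
ascends along the second chain. This is why the first chain is reversed.\<close>

lemma union_of_chains:
  assumes i: "2 \<le> i" "i + 1 < t"
    and xs: "mono_chain (prec i) neg_turn (cell i) xs"
    and ys: "mono_chain (prec (i + 1)) pos_turn (cell (i + 1)) ys"
  shows "triplewise pos_turn (rev xs @ ys)" "distinct (rev xs @ ys)" "set (rev xs @ ys) \<subseteq> V"
proof -
  have x: "set xs \<subseteq> cell i" "sorted_wrt (prec i) xs" "triplewise neg_turn xs"
    and y: "set ys \<subseteq> cell (i + 1)" "sorted_wrt (prec (i + 1)) ys" "triplewise pos_turn ys"
    using xs ys by (auto simp: mono_chain_def)
  have rev: "(\<lambda>a b c. pos_turn c b a) = neg_turn"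
    using orient_swap(3) by (intro ext) (metis neg_0_less_iff_less)
  have "triplewise pos_turn (rev xs)" unfolding triplewise_rev rev by (rule x(3))
  moreover have "sorted_wrt (\<lambda>a b. pos_turn a b z) (rev xs)" if "z \<in> set ys" for z
    unfolding sorted_wrt_rev using x(2)
    by (rule sorted_wrt_mono_rel[rotated]) (use turn_before[OF i] x(1) y(1) that in blast)
  moreover have "sorted_wrt (pos_turn z) ys" if "z \<in> set xs" for z
    using y(2)
    by (rule sorted_wrt_mono_rel[rotated]) (use turn_after[OF i] x(1) y(1) that in blast)
  ultimately show "triplewise pos_turn (rev xs @ ys)" using y(3) by (simp add: triplewise_append)
  have "distinct xs" "distinct ys"
    using x(2) y(2) by (auto intro: distinct_chain)
  moreover have "cell i \<inter> cell (i + 1) = {}" using cell_order[of _ i _ "i + 1"] i lt_irrefl by fastforce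
  ultimately show "distinct (rev xs @ ys)" using x(1) y(1) by auto
  show "set (rev xs @ ys) \<subseteq> V" using x(1) y(1) cell_V by auto
qed

text \<open>Two points of one cell and a point of another one form a cap by transitivity through the vertex
\<open>X (j + 1)\<close> or \<open>X (j - 2)\<close>, which lies between the cells as these are not adjacent.\<close>

lemma union_of_flat_caps:
  assumes Y: "\<And>j. j \<in> J \<Longrightarrow> flat_cap j (Y j)"
    and J: "J \<subseteq> {2..<t}" and gap: "\<And>i j. i \<in> J \<Longrightarrow> j \<in> J \<Longrightarrow> i < j \<Longrightarrow> i + 2 \<le> j"
    and abc: "a \<in> (\<Union>j\<in>J. Y j)" "b \<in> (\<Union>j\<in>J. Y j)" "c \<in> (\<Union>j\<in>J. Y j)" "a \<lhd> b" "b \<lhd> c"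
  shows "cap a b c"
proof -
  obtain i j l where ijl: "i \<in> J" "a \<in> Y i" "j \<in> J" "b \<in> Y j" "l \<in> J" "c \<in> Y l" using abc by auto
  have "Y j \<subseteq> cell j" if "j \<in> J" for j using Y[OF that] by (simp add: flat_cap_def)
  then have cells: "a \<in> cell i" "b \<in> cell j" "c \<in> cell l" using ijl by auto
  have idx: "2 \<le> i" "i < t" "2 \<le> j" "j < t" "2 \<le> l" "l < t" using ijl J by auto
  have "i \<le> j" using cell_order[of b j a i] cells abc(4) idx lt_asym by (meson less_imp_le not_less)
  moreover have "j \<le> l" using cell_order[of c l b j] cells abc(5) idx lt_asym by (meson less_imp_le not_less)
  ultimately consider "i = j" "j = l" | "i = j" "j + 2 \<le> l" | "i + 2 \<le> j" "j = l" | "i + 2 \<le> j" "j + 2 \<le> l"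
    using gap ijl by (metis le_neq_implies_less)
  then show ?thesis
  proof cases
    case 1 then show ?thesis using Y[of i] ijl abc unfolding flat_cap_def by blast
  next
    case 2
    then have "cap a b (X (j + 1))" using Y[of j] ijl abc unfolding flat_cap_def by blast
    then show ?thesis using cap_trans(1) distant_cells(1)[OF cells(2,3)] 2 idx by blast
  next
    case 3
    then have "cap (X (j - 2)) b c" using Y[of j] ijl abc unfolding flat_cap_def by blast
    then show ?thesis using cap_trans(2) distant_cells(2)[OF cells(1,2)] 3 idx by blast
  next
    case 4
    have "cap a (X (j - 2)) b" using distant_cells(2)[OF cells(1,2)] 4 idx by blast
    moreover have "cap (X (j - 2)) b (X (j + 1))" using cellD(5)[OF cells(2)] idx by blast
    ultimately have "cap a b (X (j + 1))" by (rule cap_trans(2))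
    moreover have "cap b (X (j + 1)) c" using distant_cells(1)[OF cells(2,3)] 4 idx by blast
    ultimately show ?thesis by (rule cap_trans(1))
  qed
qed

end


section \<open>The product of the sizes of the cells\<close>

locale frame_without_polygon = frame +
  fixes k :: nat
  assumes no_polygon: "distinct xs \<Longrightarrow> set xs \<subseteq> V \<Longrightarrow> triplewise (\<lambda>a b c. orient a b c > 0) xs \<Longrightarrow> length xs < k"
begin

text \<open>Lists of two points are polygons in this sense, vacuously.\<close>

lemma k_ge: "k \<ge> 3"
proof -
  have "triplewise pos_turn [X 0, X 1]" by simp
  moreover have "distinct [X 0, X 1]" using X_lt[of 0 1] t_ge by (auto simp: lt_def)
  moreover have "set [X 0, X 1] \<subseteq> V" using X_V t_ge by auto
  ultimately show ?thesis using no_polygon[of "[X 0, X 1]"] by simp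
qed

lemma sum_cap_size_parity:
  assumes J: "J \<subseteq> {2..<t}" and gap: "\<And>i j. i \<in> J \<Longrightarrow> j \<in> J \<Longrightarrow> i < j \<Longrightarrow> i + 2 \<le> j"
  shows "(\<Sum>j\<in>J. cap_size j) \<le> k"
proof -
  have "\<exists>Y. flat_cap j Y \<and> card Y = cap_size j" for j
    by (rule obtain_flat_cap) blast
  then obtain Y where Y: "\<And>j. flat_cap j (Y j)" "\<And>j. card (Y j) = cap_size j" by metis
  define U where "U = (\<Union>j\<in>J. Y j)"
  have fin: "finite J" using J finite_subset by blast
  have YV: "Y j \<subseteq> cell j" for j using Y(1) by (simp add: flat_cap_def)
  have UV: "U \<subseteq> V" using YV cell_V by (auto simp: U_def)
  have "cell i \<inter> cell j = {}" if "i \<in> J" "j \<in> J" "i < j" for i j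
    using cell_order[of _ i _ j] that J lt_irrefl by fastforce
  then have disj: "cell i \<inter> cell j = {}" if "i \<in> J" "j \<in> J" "i \<noteq> j" for i j
    using that by (metis Int_commute linorder_neqE_nat)
  have "card U = (\<Sum>j\<in>J. card (Y j))"
    unfolding U_def using fin YV finite_cell disj
    by (intro card_UN_disjoint) (auto intro: finite_subset, blast)
  then have cU: "card U = (\<Sum>j\<in>J. cap_size j)" using Y(2) by simp
  obtain xs where xs: "set xs = U" "distinct xs" "sorted_wrt (\<lambda>a b. inner g a < inner g b) xs"
    using exists_sorted_list[of U "inner g"] UV finite_V inj_g by (metis finite_subset inj_on_subset)
  have "triplewise (\<lambda>a b c. orient c b a > 0) xs"
  proof (rule triplewise_if_all[OF xs(3)])
    fix a b c assume "a \<in> set xs" "b \<in> set xs" "c \<in> set xs" "inner g a < inner g b" "inner g b < inner g c"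
    then have "cap a b c" using union_of_flat_caps[of J Y a b c] Y(1) J gap xs(1) by (auto simp: U_def lt_def)
    then show "orient c b a > 0" using orient_swap(3)[of c b a] by (simp add: cap_def)
  qed
  then have "triplewise pos_turn (rev xs)" by (simp add: triplewise_rev)
  then have "length (rev xs) < k" using no_polygon[of "rev xs"] xs UV by simp
  then show ?thesis using distinct_card[OF xs(2)] xs(1) cU by simp
qed

lemma sum_cap_size: "(\<Sum>j\<in>{2..<t}. cap_size j) \<le> 2 * k"
proof -
  let ?E = "{j\<in>{2..<t}. even j}" and ?O = "{j\<in>{2..<t}. odd j}"
  have "(\<Sum>j\<in>?E \<union> ?O. cap_size j) = (\<Sum>j\<in>?E. cap_size j) + (\<Sum>j\<in>?O. cap_size j)"
    by (rule sum.union_disjoint) auto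
  moreover have "?E \<union> ?O = {2..<t}" by auto
  moreover have "(\<Sum>j\<in>?E. cap_size j) \<le> k"
    by (rule sum_cap_size_parity) (auto, presburger)
  moreover have "(\<Sum>j\<in>?O. cap_size j) \<le> k"
    by (rule sum_cap_size_parity) (auto, presburger)
  ultimately show ?thesis by simp
qed

lemma neg_pos_size: "2 \<le> i \<Longrightarrow> i + 1 < t \<Longrightarrow> neg_size i + pos_size (i + 1) \<le> k"
proof -
  assume i: "2 \<le> i" "i + 1 < t"
  obtain xs where xs: "mono_chain (prec i) neg_turn (cell i) xs" "length xs = neg_size i"
    by (rule obtain_neg_chain)
  obtain ys where ys: "mono_chain (prec (i + 1)) pos_turn (cell (i + 1)) ys" "length ys = pos_size (i + 1)"
    by (rule obtain_pos_chain)
  show ?thesis using no_polygon[OF union_of_chains(2,3,1)[OF i xs(1) ys(1)]] xs(2) ys(2) by simp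
qed

lemma size_le: "neg_size i \<le> k" "pos_size i \<le> k"
proof -
  obtain xs where xs: "mono_chain (prec i) neg_turn (cell i) xs" "length xs = neg_size i"
    by (rule obtain_neg_chain)
  have "(\<lambda>a b c. pos_turn c b a) = neg_turn"
    using orient_swap(3) by (intro ext) (metis neg_0_less_iff_less)
  then have "triplewise pos_turn (rev xs)" using xs(1) by (simp add: triplewise_rev mono_chain_def)
  moreover have "distinct (rev xs)" "set (rev xs) \<subseteq> V"
    using xs(1) cell_V by (auto simp: mono_chain_def intro: distinct_chain)
  ultimately show "neg_size i \<le> k" using no_polygon[of "rev xs"] xs(2) by simp
  obtain ys where ys: "mono_chain (prec i) pos_turn (cell i) ys" "length ys = pos_size i"
    by (rule obtain_pos_chain)
  then have "distinct ys" "set ys \<subseteq> V" "triplewise pos_turn ys"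
    using cell_V by (auto simp: mono_chain_def intro: distinct_chain)
  then show "pos_size i \<le> k" using no_polygon[of ys] ys(2) by simp
qed

text \<open>Each negative chain is paired with the positive chain of the next cell. The sum over all cells is
bounded in this way, although there is no good bound for the two chains of one cell.\<close>

lemma sum_turn_sizes: "(\<Sum>j\<in>{2..<t}. neg_size j + pos_size j) \<le> (t - 1) * k"
proof -
  obtain n where n: "t = n + 3" using t_ge by (metis add.commute le_Suc_ex)
  have "{2..<t} = {2..n+2}" using n by auto
  moreover have "(\<Sum>j=2..n+2. neg_size j + pos_size j) \<le> n * k + neg_size (n + 2) + pos_size 2"
    by (rule sum_le_interleaved) (use neg_pos_size n in auto)
  ultimately show ?thesis using size_le[of "n + 2"] size_le[of 2] n by (simp add: algebra_simps)
qed

text \<open>An antichain is ordered by abscissa. A cup of \<open>k\<close> points in it would be a polygon, so that only its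
caps can be long, and these are flat.\<close>

lemma card_antichain:
  assumes j: "2 \<le> j" "j < t" and Y: "Y \<subseteq> cell j" "\<And>a b. a \<in> Y \<Longrightarrow> b \<in> Y \<Longrightarrow> \<not> prec j a b"
  shows "card Y \<le> k ^ cap_size j"
proof (rule ccontr)
  assume "\<not> ?thesis"
  moreover have "(cap_size j + (k - 2)) choose cap_size j \<le> (k - 2 + 1) ^ cap_size j"
    by (rule binomial_le_power)
  moreover have "(k - 2 + 1) ^ cap_size j \<le> k ^ cap_size j" by (rule power_mono) (use k_ge in auto)
  ultimately have big: "card Y > (cap_size j + (k - 2)) choose cap_size j" by linarith
  have YV: "Y \<subseteq> V" "finite Y" using Y(1) cell_V finite_cell finite_subset by blast+
  have "(\<exists>xs. mono_chain (\<lhd>) neg_turn Y xs \<and> length xs = cap_size j + 2) \<or>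
    (\<exists>xs. mono_chain (\<lhd>) (\<lambda>a b c. \<not> neg_turn a b c) Y xs \<and> length xs = (k - 2) + 2)"
  proof (rule cups_caps[OF YV(2) _ _ _ _ big])
    show "a \<lhd> c" if "a \<lhd> b" "b \<lhd> c" for a b c using that by (rule lt_trans)
    show "a \<lhd> b \<or> b \<lhd> a" if "{a, b} \<subseteq> Y" "a \<noteq> b" for a b using lt_total that YV by blast
    show "neg_turn a b d \<and> neg_turn a c d"
      if "{a, b, c, d} \<subseteq> Y" "a \<lhd> b" "b \<lhd> c" "c \<lhd> d" "neg_turn a b c" "neg_turn b c d" for a b c d
      using four_trans_neg[of a b c d] that YV by auto
    show "\<not> neg_turn a b d \<and> \<not> neg_turn a c d"
      if "{a, b, c, d} \<subseteq> Y" "a \<lhd> b" "b \<lhd> c" "c \<lhd> d" "\<not> neg_turn a b c" "\<not> neg_turn b c d" for a b c d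
    proof -
      have V: "a \<in> V" "b \<in> V" "c \<in> V" "d \<in> V" using that YV by auto
      then have "pos_turn a b c" "pos_turn b c d"
        using generic_lt[of a b c] generic_lt[of b c d] that by auto
      then show ?thesis using four_trans_pos[of a b c d] V that by force
    qed
  qed
  then show False
  proof (elim disjE exE conjE)
    fix xs assume xs: "mono_chain (\<lhd>) neg_turn Y xs" "length xs = cap_size j + 2"
    have s: "set xs \<subseteq> Y" "sorted_wrt (\<lhd>) xs" "triplewise neg_turn xs" using xs by (auto simp: mono_chain_def)
    have caps: "cap p q r" if pqr: "p \<in> set xs" "q \<in> set xs" "r \<in> set xs" "p \<lhd> q" "q \<lhd> r" for p q r
    proof -
      obtain i1 where i1: "i1 < length xs" "xs ! i1 = p" using pqr(1) unfolding in_set_conv_nth by blast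
      obtain i2 where i2: "i2 < length xs" "xs ! i2 = q" using pqr(2) unfolding in_set_conv_nth by blast
      obtain i3 where i3: "i3 < length xs" "xs ! i3 = r" using pqr(3) unfolding in_set_conv_nth by blast
      note idx = i1 i2 i3
      have less: "m < n" if "m < length xs" "n < length xs" "xs ! m \<lhd> xs ! n" for m n
        using that s(2) lt_asym lt_irrefl unfolding sorted_wrt_iff_nth_less by (metis linorder_neqE_nat)
      have "i1 < i2" "i2 < i3"
        using idx pqr less by auto
      then have "neg_turn p q r" using triplewise_nth[OF s(3)] idx by auto
      then show ?thesis using pqr s(1) YV by (auto simp: cap_def)
    qed
    have "flat_cap j (set xs)"
      unfolding flat_cap_def
    proof (intro conjI ballI impI)
      show "set xs \<subseteq> cell j" using s(1) Y(1) by blast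
      fix p q assume "p \<in> set xs" "q \<in> set xs" "p \<lhd> q"
      moreover then have "p \<in> Y" "q \<in> Y" using s(1) by blast+
      ultimately show "cap (X (j - 2)) p q" "cap p q (X (j + 1))"
        using flat_if_incomparable[OF j, of p q] Y(2)[of p q] Y(2)[of q p] Y(1) by blast+
    qed (rule caps)
    moreover have "card (set xs) = length xs"
      using distinct_if_sorted_wrt_irrefl[OF s(2)] distinct_card by auto
    ultimately show False using flat_cap_le[of j "set xs"] xs(2) by simp
  next
    fix xs assume xs: "mono_chain (\<lhd>) (\<lambda>a b c. \<not> neg_turn a b c) Y xs" "length xs = (k - 2) + 2"
    have s: "set xs \<subseteq> Y" "sorted_wrt (\<lhd>) xs" "triplewise (\<lambda>a b c. \<not> neg_turn a b c) xs" using xs by (auto simp: mono_chain_def)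
    have d: "distinct xs" using distinct_if_sorted_wrt_irrefl[OF s(2)] by auto
    have "triplewise pos_turn xs"
      by (rule triplewise_mono[OF s(2,3)]) (use s(1) YV generic_lt in force)
    moreover have "set xs \<subseteq> V" using s(1) YV(1) by blast
    ultimately show False using no_polygon[OF d] xs(2) k_ge by auto
  qed
qed

text \<open>A chain is ordered by the angle at the vertex \<open>X (j - 2)\<close>, in which orientations are transitive.\<close>

lemma card_chain:
  assumes j: "2 \<le> j" "j < t" and zs: "set zs \<subseteq> cell j" "sorted_wrt (prec j) zs"
  shows "length zs \<le> 2 ^ (neg_size j + pos_size j)"
proof (rule ccontr)
  assume "\<not> ?thesis"
  moreover have "card (set zs) = length zs"
    using distinct_chain[OF zs(2)] distinct_card by auto
  ultimately have big: "card (set zs) > (neg_size j + pos_size j) choose neg_size j"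
    using binomial_le_pow2[of "neg_size j + pos_size j" "neg_size j"] by linarith
  have V: "set zs \<subseteq> V" using zs(1) cell_V by auto
  have nz: "orient a b c \<noteq> 0" if "{a, b, c} \<subseteq> cell j" "prec j a b" "prec j b c" for a b c
  proof -
    have "prec j a c" using prec_trans[OF j] that by blast
    then have "distinct [a, b, c]" using that prec_irrefl by auto
    then show ?thesis using generic that cell_V by blast
  qed
  have "(\<exists>xs. mono_chain (prec j) neg_turn (set zs) xs \<and> length xs = neg_size j + 2) \<or>
    (\<exists>xs. mono_chain (prec j) (\<lambda>a b c. \<not> neg_turn a b c) (set zs) xs \<and> length xs = pos_size j + 2)"
  proof (rule cups_caps[OF _ _ _ _ _ big])
    show "prec j a c" if "{a, b, c} \<subseteq> set zs" "prec j a b" "prec j b c" for a b c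
      using prec_trans[OF j, of a b c] that zs(1) by auto
    show "prec j a b \<or> prec j b a" if "{a, b} \<subseteq> set zs" "a \<noteq> b" for a b
      using zs(2) that unfolding sorted_wrt_iff_nth_less
      by (metis (no_types, opaque_lifting) in_set_conv_nth insert_subset linorder_neqE_nat)
    have pencil: "orient (X (j - 2)) a b > 0" "orient (X (j - 2)) a c > 0" "orient (X (j - 2)) b c > 0"
        "orient (X (j - 2)) b d > 0" "orient (X (j - 2)) c d > 0"
      if "{a, b, c, d} \<subseteq> set zs" "prec j a b" "prec j b c" "prec j c d" for a b c d
      using prec_trans[OF j, of a b c] prec_trans[OF j, of b c d] that zs(1) by (auto simp: prec_def)
    show "neg_turn a b d \<and> neg_turn a c d"
      if "{a, b, c, d} \<subseteq> set zs" "prec j a b" "prec j b c" "prec j c d" "neg_turn a b c" "neg_turn b c d"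
      for a b c d
      using pencil_transitive(2)[OF pencil[OF that(1-4)]] that by blast
    show "\<not> neg_turn a b d \<and> \<not> neg_turn a c d"
      if "{a, b, c, d} \<subseteq> set zs" "prec j a b" "prec j b c" "prec j c d" "\<not> neg_turn a b c" "\<not> neg_turn b c d"
      for a b c d
    proof -
      have "{a, b, c} \<subseteq> cell j" "{b, c, d} \<subseteq> cell j" using that(1) zs(1) by auto
      then have "pos_turn a b c" "pos_turn b c d"
        using nz[of a b c] nz[of b c d] that(2-6) by linarith+
      then show ?thesis using pencil_transitive(1)[OF pencil[OF that(1-4)]] by force
    qed
  qed simp
  then show False
  proof (elim disjE exE conjE)
    fix xs assume xs: "mono_chain (prec j) neg_turn (set zs) xs" "length xs = neg_size j + 2"
    then show False using chain_le(1)[of j xs] zs(1) by (auto simp: mono_chain_def)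
  next
    fix xs assume xs: "mono_chain (prec j) (\<lambda>a b c. \<not> neg_turn a b c) (set zs) xs" "length xs = pos_size j + 2"
    then have s: "set xs \<subseteq> cell j" "sorted_wrt (prec j) xs" "triplewise (\<lambda>a b c. \<not> neg_turn a b c) xs"
      using zs(1) by (auto simp: mono_chain_def)
    have "triplewise pos_turn xs"
    proof (rule triplewise_mono[OF s(2,3)])
      fix a b c assume abc: "{a, b, c} \<subseteq> set xs" "prec j a b" "prec j b c" "\<not> neg_turn a b c"
      have "{a, b, c} \<subseteq> cell j" using abc(1) s(1) by blast
      then show "pos_turn a b c" using nz[of a b c] abc(2-4) by linarith
    qed
    then show False using chain_le(2)[of j xs] s xs(2) by (auto simp: mono_chain_def)
  qed
qed

lemma card_cell:
  assumes j: "2 \<le> j" "j < t"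
  shows "card (cell j) \<le> 2 ^ (neg_size j + pos_size j) * k ^ cap_size j"
proof (rule card_le_chain_times_antichain[OF finite_cell])
  show "prec j a c" if "{a, b, c} \<subseteq> cell j" "prec j a b" "prec j b c" for a b c
    using prec_trans[OF j] that by blast
  show "length xs \<le> 2 ^ (neg_size j + pos_size j)" if "set xs \<subseteq> cell j" "sorted_wrt (prec j) xs" for xs
    using card_chain[OF j that] .
  show "card Y \<le> k ^ cap_size j" if "Y \<subseteq> cell j" "\<And>a b. a \<in> Y \<Longrightarrow> b \<in> Y \<Longrightarrow> \<not> prec j a b" for Y
    using card_antichain[OF j that] .
qed

lemma prod_card_cells: "(\<Prod>j=1..t. card (cell j)) \<le> card V ^ 2 * (2 ^ ((t - 1) * k) * k ^ (2 * k))"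
proof -
  have "{1..t} = insert 1 (insert t {2..<t})" using t_ge by auto
  then have "(\<Prod>j=1..t. card (cell j)) = card (cell 1) * (card (cell t) * (\<Prod>j\<in>{2..<t}. card (cell j)))"
    using t_ge by simp
  also have "\<dots> \<le> card V * (card V * (\<Prod>j\<in>{2..<t}. card (cell j)))"
    using card_mono[OF finite_V cell_V] by (intro mult_le_mono) auto
  also have "(\<Prod>j\<in>{2..<t}. card (cell j)) \<le> (\<Prod>j\<in>{2..<t}. 2 ^ (neg_size j + pos_size j) * k ^ cap_size j)"
    by (rule prod_mono) (use card_cell in auto)
  also have "\<dots> = 2 ^ (\<Sum>j\<in>{2..<t}. neg_size j + pos_size j) * k ^ (\<Sum>j\<in>{2..<t}. cap_size j)"
    by (simp add: prod.distrib power_sum)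
  also have "\<dots> \<le> 2 ^ ((t - 1) * k) * k ^ (2 * k)"
    using sum_turn_sizes sum_cap_size k_ge by (intro mult_le_mono power_increasing) auto
  finally show ?thesis by (simp add: power2_eq_square mult_ac)
qed

end

section \<open>Counting caps\<close>

text \<open>Count the pairs of a member \<open>A\<close> of \<open>F\<close> and a set \<open>B\<close> of size \<open>m\<close> including \<open>A\<close>.\<close>

lemma supersaturation:
  assumes fin: "finite V" and F: "\<And>A. A \<in> F \<Longrightarrow> A \<subseteq> V \<and> card A = s"
    and hit: "\<And>B. B \<subseteq> V \<Longrightarrow> card B = m \<Longrightarrow> \<exists>A\<in>F. A \<subseteq> B"
    and sm: "s \<le> m" "m \<le> card V"
  shows "(card V choose s) \<le> card F * (m choose s)"
proof -
  let ?N = "card V"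
  have finF: "finite F" by (rule finite_subset[of _ "Pow V"]) (use F fin in auto)
  have ext: "card {B. A \<subseteq> B \<and> B \<subseteq> V \<and> card B = m} \<le> (?N - s) choose (m - s)" if "A \<in> F" for A
  proof -
    have A: "A \<subseteq> V" "card A = s" "finite A" using F[OF that] fin finite_subset by auto
    have "{B. A \<subseteq> B \<and> B \<subseteq> V \<and> card B = m} \<subseteq> (\<lambda>D. A \<union> D) ` {D. D \<subseteq> V - A \<and> card D = m - s}"
    proof
      fix B assume "B \<in> {B. A \<subseteq> B \<and> B \<subseteq> V \<and> card B = m}"
      then have "B = A \<union> (B - A)" "B - A \<subseteq> V - A" "card (B - A) = m - s"
        using A by (auto simp: card_Diff_subset)
      then show "B \<in> (\<lambda>D. A \<union> D) ` {D. D \<subseteq> V - A \<and> card D = m - s}" by blast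
    qed
    then have "card {B. A \<subseteq> B \<and> B \<subseteq> V \<and> card B = m} \<le> card {D. D \<subseteq> V - A \<and> card D = m - s}"
      using fin by (intro surj_card_le) auto
    also have "\<dots> = (?N - s) choose (m - s)"
      using n_subsets[of "V - A" "m - s"] fin A by (simp add: card_Diff_subset)
    finally show ?thesis .
  qed
  have "?N choose m = card {B. B \<subseteq> V \<and> card B = m}" using n_subsets[OF fin] by simp
  also have "\<dots> \<le> card (\<Union>A\<in>F. {B. A \<subseteq> B \<and> B \<subseteq> V \<and> card B = m})"
    by (rule card_mono) (use fin finF hit in \<open>auto intro: finite_subset[of _ "Pow V"]\<close>)
  also have "\<dots> \<le> (\<Sum>A\<in>F. card {B. A \<subseteq> B \<and> B \<subseteq> V \<and> card B = m})"
    by (rule card_UN_le[OF finF])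
  also have "\<dots> \<le> card F * ((?N - s) choose (m - s))"
    using sum_bounded_above[of F _ "(?N - s) choose (m - s)"] ext by simp
  finally have "(?N choose m) * (m choose s) \<le> card F * ((?N - s) choose (m - s)) * (m choose s)"
    by (rule mult_right_mono) simp
  also have "(?N choose m) * (m choose s) = (?N choose s) * ((?N - s) choose (m - s))"
    using choose_mult[of s m ?N] sm by simp
  also have "card F * ((?N - s) choose (m - s)) * (m choose s) = (card F * (m choose s)) * ((?N - s) choose (m - s))"
    by (simp only: mult_ac)
  finally have "?N choose s \<le> card F * (m choose s) \<or> (?N - s) choose (m - s) = 0"
    by (metis mult_le_cancel2 neq0_conv)
  moreover have "m - s \<le> ?N - s" using sm by (intro diff_le_mono)
  ultimately show ?thesis by auto
qed

lemma power_le_choose: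
  assumes "0 < s" "s \<le> n" shows "n ^ s \<le> s ^ s * (n choose s)"
proof -
  have "real n ^ s = (real n / real s) ^ s * real s ^ s"
    using assms(1) by (simp flip: power_mult_distrib)
  also have "\<dots> \<le> real (n choose s) * real s ^ s"
    by (rule mult_right_mono[OF binomial_ge_n_over_k_pow_k[OF assms(2)]]) simp
  finally have "real (n ^ s) \<le> real (s ^ s * (n choose s))" by (simp add: mult.commute)
  then show ?thesis by (simp only: of_nat_le_iff)
qed

context planar
begin

definition caps :: "nat \<Rightarrow> (real^3) set set" where
  "caps s = {A. A \<subseteq> V \<and> card A = s \<and> (\<forall>a\<in>A. \<forall>b\<in>A. \<forall>c\<in>A. a \<lhd> b \<longrightarrow> b \<lhd> c \<longrightarrow> cap a b c)}"

definition frames :: "nat \<Rightarrow> (nat \<Rightarrow> real^3) set" where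
  "frames t = {X \<in> {..t} \<rightarrow>\<^sub>E V. \<forall>i j l. i < j \<longrightarrow> j < l \<longrightarrow> l \<le> t \<longrightarrow> cap (X i) (X j) (X l)}"

lemma frame_if_frames: "X \<in> frames t \<Longrightarrow> t \<ge> 3 \<Longrightarrow> frame f g V X t"
  by unfold_locales (auto simp: frames_def)

lemma finite_frames: "finite (frames t)"
  by (rule finite_subset[of _ "{..t} \<rightarrow>\<^sub>E V"]) (auto simp: frames_def finite_PiE finite_V)

lemma card_frames: "card (frames t) \<le> card V ^ (t + 1)"
proof -
  have "card (frames t) \<le> card ({..t} \<rightarrow>\<^sub>E V)"
    by (rule card_mono) (auto simp: frames_def finite_PiE finite_V)
  then show ?thesis by (simp add: card_PiE)
qed

text \<open>The elements of a cap in even positions form the frame, those in odd positions lie in its cells.\<close>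

lemma caps_from_frames:
  assumes t: "t \<ge> 3"
  shows "caps (2 * t + 1) \<subseteq>
    (\<lambda>(X, Y). X ` {..t} \<union> Y ` {1..t}) ` (SIGMA X:frames t. PiE {1..t} (frame.cell g V X t))"
proof
  fix A assume A: "A \<in> caps (2 * t + 1)"
  then have AV: "A \<subseteq> V" "finite A" using finite_V finite_subset by (auto simp: caps_def)
  obtain xs where xs: "set xs = A" "distinct xs" "sorted_wrt (\<lambda>a b. inner g a < inner g b) xs"
    using exists_sorted_list[of A "inner g"] AV inj_g inj_on_subset by blast
  have len: "length xs = 2 * t + 1" using A xs distinct_card[OF xs(2)] by (simp add: caps_def)
  have cap: "cap (xs ! i) (xs ! j) (xs ! l)" if "i < j" "j < l" "l \<le> 2 * t" for i j l
  proof -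
    have "xs ! i \<lhd> xs ! j" "xs ! j \<lhd> xs ! l" "xs ! i \<in> A" "xs ! j \<in> A" "xs ! l \<in> A"
      using xs that len by (auto simp: sorted_wrt_iff_nth_less lt_def)
    then show ?thesis using A by (auto simp: caps_def)
  qed
  define X where "X = restrict (\<lambda>i. xs ! (2 * i)) {..t}"
  define Y where "Y = restrict (\<lambda>j. xs ! (2 * j - 1)) {1..t}"
  have X: "X \<in> frames t"
    unfolding frames_def X_def using cap xs(1) AV len by (auto intro!: nth_mem)
  interpret frame f g V X t using X t by (rule frame_if_frames)
  have "Y j \<in> cell j" if "j \<in> {1..t}" for j
  proof -
    have idx: "2 * (j - 1) < 2 * j - 1" "2 * j - 1 < 2 * j" "2 * j \<le> 2 * t" using that by auto
    then show ?thesis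
      unfolding cell_def unfolding X_def Y_def using that by (auto intro!: cap)
  qed
  then have "Y \<in> PiE {1..t} cell" by (auto simp: Y_def)
  moreover have "A = X ` {..t} \<union> Y ` {1..t}"
  proof -
    have "A = (!) xs ` {..2 * t}" using xs(1) len by (auto simp: set_conv_nth)
    also have "{..2 * t} = (\<lambda>i. 2 * i) ` {..t} \<union> (\<lambda>j. 2 * j - 1) ` {1..t}"
    proof -
      have "i \<in> (\<lambda>i. 2 * i) ` {..t} \<union> (\<lambda>j. 2 * j - 1) ` {1..t}" if "i \<le> 2 * t" for i
      proof (cases "even i")
        case True then show ?thesis using that by (auto elim!: evenE)
      next
        case False
        then obtain j where "i = 2 * j + 1" by (auto elim: oddE)
        then have "i = 2 * (j + 1) - 1" "j + 1 \<in> {1..t}" using that by auto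
        then show ?thesis by blast
      qed
      then show ?thesis by auto
    qed
    also have "(!) xs ` \<dots> = X ` {..t} \<union> Y ` {1..t}"
      by (simp add: image_Un image_image X_def Y_def)
    finally show ?thesis .
  qed
  ultimately show "A \<in> (\<lambda>(X, Y). X ` {..t} \<union> Y ` {1..t}) ` (SIGMA X:frames t. PiE {1..t} (frame.cell g V X t))"
    using X by (intro image_eqI[of _ _ "(X, Y)"]) auto
qed

lemma card_caps:
  assumes t: "t \<ge> 3"
    and no_polygon: "\<And>xs. distinct xs \<Longrightarrow> set xs \<subseteq> V \<Longrightarrow> triplewise (\<lambda>a b c. orient a b c > 0) xs \<Longrightarrow> length xs < k"
  shows "card (caps (2 * t + 1)) \<le> card V ^ (t + 3) * (2 ^ ((t - 1) * k) * k ^ (2 * k))"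
proof -
  let ?cells = "\<lambda>X. PiE {1..t} (frame.cell g V X t)"
  have fr: "frame_without_polygon f g V X t k" if "X \<in> frames t" for X
    using frame_if_frames[OF that t] no_polygon
    by (simp add: frame_without_polygon_def frame_without_polygon_axioms_def)
  have fin: "finite (?cells X)" if "X \<in> frames t" for X
    using frame.finite_cell[OF frame_if_frames[OF that t]] by (auto intro: finite_PiE)
  have "card (caps (2 * t + 1)) \<le> card (SIGMA X:frames t. ?cells X)"
    by (rule surj_card_le[OF _ caps_from_frames[OF t]]) (use finite_frames fin in auto)
  also have "\<dots> = (\<Sum>X\<in>frames t. card (?cells X))"
    using finite_frames fin by simp
  also have "\<dots> = (\<Sum>X\<in>frames t. \<Prod>j=1..t. card (frame.cell g V X t j))"
    by (simp add: card_PiE)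
  also have "\<dots> \<le> (\<Sum>X\<in>frames t. card V ^ 2 * (2 ^ ((t - 1) * k) * k ^ (2 * k)))"
    by (rule sum_mono) (use frame_without_polygon.prod_card_cells[OF fr] in blast)
  also have "\<dots> = card (frames t) * (card V ^ 2 * (2 ^ ((t - 1) * k) * k ^ (2 * k)))" by simp
  also have "\<dots> \<le> card V ^ (t + 1) * (card V ^ 2 * (2 ^ ((t - 1) * k) * k ^ (2 * k)))"
    by (rule mult_right_mono[OF card_frames]) simp
  also have "\<dots> = card V ^ (t + 3) * (2 ^ ((t - 1) * k) * k ^ (2 * k))"
    by (simp add: power_add power2_eq_square power3_eq_cube mult_ac)
  finally show ?thesis .
qed

lemma reflected: "planar f (- g) V"
  using finite_V on_plane inj_g generic by unfold_locales (auto simp: inj_on_def)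

text \<open>Reversing the abscissa exchanges cups and caps. The bounds for caps thus apply to cups as well.\<close>

lemma cap_reflected: "planar.cap (- g) V a b c \<longleftrightarrow> a \<in> V \<and> b \<in> V \<and> c \<in> V \<and> c \<lhd> b \<and> b \<lhd> a \<and> orient c b a > 0"
  using orient_swap(3)[of c b a]
  by (auto simp: planar.cap_def[OF reflected] planar.lt_def[OF reflected] lt_def)

lemma mono_subset:
  assumes B: "B \<subseteq> V" "card B > (2 * s) choose s"
  shows "\<exists>A \<in> caps (s + 2) \<union> planar.caps (- g) V (s + 2). A \<subseteq> B"
proof -
  have finB: "finite B" using B finite_V finite_subset by blast
  let ?neg = "\<lambda>a b c. orient a b c < 0"
  have "(\<exists>xs. mono_chain (\<lhd>) ?neg B xs \<and> length xs = s + 2) \<or>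
    (\<exists>xs. mono_chain (\<lhd>) (\<lambda>a b c. \<not> ?neg a b c) B xs \<and> length xs = s + 2)"
  proof (rule cups_caps[OF finB])
    show "card B > (s + s) choose s" using B(2) by (simp add: mult_2)
    show "a \<lhd> c" if "a \<lhd> b" "b \<lhd> c" for a b c using that by (rule lt_trans)
    show "a \<lhd> b \<or> b \<lhd> a" if "{a, b} \<subseteq> B" "a \<noteq> b" for a b using lt_total that B by blast
    show "?neg a b d \<and> ?neg a c d"
      if "{a, b, c, d} \<subseteq> B" "a \<lhd> b" "b \<lhd> c" "c \<lhd> d" "?neg a b c" "?neg b c d" for a b c d
      using four_trans_neg[of a b c d] that B by auto
    show "\<not> ?neg a b d \<and> \<not> ?neg a c d"
      if "{a, b, c, d} \<subseteq> B" "a \<lhd> b" "b \<lhd> c" "c \<lhd> d" "\<not> ?neg a b c" "\<not> ?neg b c d" for a b c d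
    proof -
      have V: "a \<in> V" "b \<in> V" "c \<in> V" "d \<in> V" using that B by auto
      then have "orient a b c > 0" "orient b c d > 0"
        using generic_lt[of a b c] generic_lt[of b c d] that by auto
      then show ?thesis using four_trans_pos[of a b c d] V that by force
    qed
  qed
  then obtain P xs where xs: "mono_chain (\<lhd>) P B xs" "length xs = s + 2" and P: "P = ?neg \<or> P = (\<lambda>a b c. \<not> ?neg a b c)"
    by blast
  then have s: "set xs \<subseteq> B" "sorted_wrt (\<lhd>) xs" "triplewise P xs" by (auto simp: mono_chain_def)
  have all: "P a b c" if abc: "a \<in> set xs" "b \<in> set xs" "c \<in> set xs" "a \<lhd> b" "b \<lhd> c" for a b c
  proof -
    obtain i where i: "i < length xs" "xs ! i = a" using abc(1) unfolding in_set_conv_nth by blast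
    obtain j where j: "j < length xs" "xs ! j = b" using abc(2) unfolding in_set_conv_nth by blast
    obtain l where l: "l < length xs" "xs ! l = c" using abc(3) unfolding in_set_conv_nth by blast
    have less: "m < n" if "m < length xs" "n < length xs" "xs ! m \<lhd> xs ! n" for m n
      using that s(2) lt_asym lt_irrefl unfolding sorted_wrt_iff_nth_less by (metis linorder_neqE_nat)
    have "i < j" "j < l" using i j l abc less by auto
    then show ?thesis using triplewise_nth[OF s(3)] i j l by auto
  qed
  have card: "card (set xs) = s + 2"
    using distinct_card[OF distinct_if_sorted_wrt_irrefl[OF s(2)]] xs(2) by simp
  have xsV: "set xs \<subseteq> V" using s(1) B(1) by blast
  from P show ?thesis
  proof
    assume "P = ?neg"
    then have "set xs \<in> caps (s + 2)" using all card xsV by (auto simp: caps_def cap_def)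
    then show ?thesis using s(1) by blast
  next
    assume "P = (\<lambda>a b c. \<not> ?neg a b c)"
    then have "orient a b c > 0" if "a \<in> set xs" "b \<in> set xs" "c \<in> set xs" "a \<lhd> b" "b \<lhd> c" for a b c
      using all[OF that] generic_lt[of a b c] that xsV by (auto simp: not_less le_less)
    then have "set xs \<in> planar.caps (- g) V (s + 2)"
      using card xsV by (auto simp: planar.caps_def[OF reflected] cap_reflected planar.lt_def[OF reflected] lt_def)
    then show ?thesis using s(1) by blast
  qed
qed

text \<open>All tuples of \<open>2 * t + 1\<close> points are compared with the caps and cups among them; of the exponent
\<open>2 * t + 1\<close> of \<open>card V\<close>, the choice of a frame takes \<open>t + 1\<close> and its two outermost cells take 2.\<close>

lemma card_bound:
  assumes t: "t \<ge> 3" and N: "card V \<ge> 4 ^ (2 * t)"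
    and no_polygon: "\<And>xs. distinct xs \<Longrightarrow> set xs \<subseteq> V \<Longrightarrow> triplewise (\<lambda>a b c. orient a b c > 0) xs \<Longrightarrow> length xs < k"
  shows "card V ^ (t - 2) \<le> 2 * ((2 * t + 1) * 4 ^ (2 * t)) ^ (2 * t + 1) * (2 ^ ((t - 1) * k) * k ^ (2 * k))"
proof -
  interpret refl: planar f "- g" V by (rule reflected)
  \<comment> \<open>A set of \<open>?m\<close> points contains a cap or a cup of \<open>?s\<close> points, as \<open>(4 * t - 2) choose (2 * t - 1)\<close> is
    less than \<open>?m\<close>.\<close>
  let ?N = "card V" and ?s = "2 * t + 1" and ?m = "4 ^ (2 * t) :: nat"
  let ?K = "2 ^ ((t - 1) * k) * k ^ (2 * k)"
  let ?F = "caps ?s \<union> refl.caps ?s"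
  have s_le: "?s \<le> ?m"
  proof -
    have "2 * t < 2 ^ (2 * t)" by (rule less_exp)
    also have "\<dots> \<le> ?m" by (rule power_mono) auto
    finally show ?thesis by simp
  qed
  have N0: "?N > 0" using N by (metis gr0I power_not_zero zero_neq_numeral le_0_eq)
  have "(?N choose ?s) \<le> card ?F * (?m choose ?s)"
  proof (rule supersaturation[OF finite_V _ _ s_le N])
    show "A \<subseteq> V \<and> card A = ?s" if "A \<in> ?F" for A
      using that by (auto simp: caps_def refl.caps_def)
    fix B assume B: "B \<subseteq> V" "card B = ?m"
    have "(2 * (2 * t - 1)) choose (2 * t - 1) \<le> 2 ^ (2 * (2 * t - 1))" by (rule binomial_le_pow2)
    also have "\<dots> < 2 ^ (2 * (2 * t))" by (rule power_strict_increasing) (use t in auto)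
    also have "\<dots> = ?m" by (simp add: power_mult)
    finally have "card B > (2 * (2 * t - 1)) choose (2 * t - 1)" using B(2) by simp
    from mono_subset[OF B(1) this] show "\<exists>A\<in>?F. A \<subseteq> B" using t by simp
  qed
  also have "\<dots> \<le> card ?F * ?m ^ ?s"
    by (rule mult_left_mono[OF binomial_le_pow[OF s_le]]) simp
  also have "card ?F \<le> card (caps ?s) + card (refl.caps ?s)" by (rule card_Un_le)
  also have "\<dots> \<le> ?N ^ (t + 3) * ?K + ?N ^ (t + 3) * ?K"
    by (rule add_mono[OF card_caps[OF t no_polygon] refl.card_caps[OF t no_polygon]])
  finally have choose: "(?N choose ?s) \<le> (?N ^ (t + 3) * ?K + ?N ^ (t + 3) * ?K) * ?m ^ ?s" by simp
  have "?N ^ ?s \<le> ?s ^ ?s * (?N choose ?s)" by (rule power_le_choose) (use s_le N in auto)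
  also have "\<dots> \<le> ?s ^ ?s * ((?N ^ (t + 3) * ?K + ?N ^ (t + 3) * ?K) * ?m ^ ?s)"
    by (rule mult_left_mono[OF choose]) simp
  also have "\<dots> = ?N ^ (t + 3) * (2 * (?s * ?m) ^ ?s * ?K)"
  proof -
    have "a ^ n * ((b * c + b * c) * d ^ n) = b * (2 * (a * d) ^ n * c)" for a b c d n :: nat
      by (simp add: power_mult_distrib algebra_simps)
    then show ?thesis .
  qed
  finally have "?N ^ (t + 3) * ?N ^ (t - 2) \<le> ?N ^ (t + 3) * (2 * (?s * ?m) ^ ?s * ?K)"
    using t by (simp flip: power_add)
  then show ?thesis using N0 by simp
qed

end

section \<open>Polygons in large sets of projective points\<close>

text \<open>The functionals \<open>(1, s, s\<^sup>2)\<close> on the moment curve vanish at a given nonzero vector for at most two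
values of \<open>s\<close>.\<close>

lemma exists_functional_avoiding_zeros:
  fixes W :: "(real^3) set"
  assumes "finite W" "0 \<notin> W"
  obtains f where "\<And>w. w \<in> W \<Longrightarrow> inner f w \<noteq> 0"
proof -
  define P where "P w = [:w$1, w$2, w$3:]" for w :: "real^3"
  have "P w \<noteq> 0" if "w \<in> W" for w
  proof -
    have "w \<noteq> 0" using that assms(2) by auto
    then show ?thesis by (auto simp: P_def vec_eq_iff forall_3)
  qed
  then have "finite (\<Union>w\<in>W. {s. poly (P w) s = 0})"
    using assms(1) poly_roots_finite by blast
  then obtain s where s: "s \<notin> (\<Union>w\<in>W. {s. poly (P w) s = 0})"
    using ex_new_if_finite[OF infinite_UNIV_char_0] by blast
  have "inner (vector [1, s, s * s]) w = poly (P w) s" for w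
    by (simp add: P_def inner_vec_def sum_3 algebra_simps)
  then show ?thesis using that[of "vector [1, s, s * s]"] s by auto
qed

lemma exists_planar_chart:
  assumes fin: "finite S" and gp: "general_position S"
  obtains f g where "S \<subseteq> plane_at f" "planar f g (chart f ` S)"
proof -
  have "\<exists>v. \<forall>p. v p \<noteq> 0 \<and> line_of p = span {v p}"
    by (rule choice) (metis line_of_spanned)
  then obtain v where v: "\<And>p. v p \<noteq> 0" "\<And>p. line_of p = span {v p}" by blast
  have "finite (v ` S)" using fin by simp
  moreover have "0 \<notin> v ` S" using v(1) by (metis imageE)
  ultimately obtain f where f: "\<And>w. w \<in> v ` S \<Longrightarrow> inner f w \<noteq> 0"
    using exists_functional_avoiding_zeros by blast
  have S: "S \<subseteq> plane_at f"
  proof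
    fix p assume "p \<in> S"
    then have "v p \<in> line_of p" "inner f (v p) \<noteq> 0" using f v(2) span_base[of "v p" "{v p}"] by auto
    then show "p \<in> plane_at f" by (auto simp: plane_at_def)
  qed
  let ?V = "chart f ` S"
  define W where "W = {a - b |a b. a \<in> ?V \<and> b \<in> ?V \<and> a \<noteq> b}"
  have "W \<subseteq> (\<lambda>(a, b). a - b) ` (?V \<times> ?V)" by (auto simp: W_def)
  then have "finite W" using fin finite_subset by blast
  moreover have "0 \<notin> W" by (auto simp: W_def)
  ultimately obtain g where g: "\<And>w. w \<in> W \<Longrightarrow> inner g w \<noteq> 0"
    using exists_functional_avoiding_zeros by blast
  have "planar f g ?V"
  proof
    show "finite ?V" using fin by simp
    show "inner f w = 1" if "w \<in> ?V" for w using that chart_props(1) S by blast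
    show "inj_on (inner g) ?V"
    proof (rule inj_onI, rule ccontr)
      fix a b assume ab: "a \<in> ?V" "b \<in> ?V" "inner g a = inner g b" "a \<noteq> b"
      then have "a - b \<in> W" by (auto simp: W_def)
      then show False using g[of "a - b"] ab(3) by (simp add: inner_diff_right)
    qed
    have "line_of p = span {chart f p}" if "p \<in> S" for p using chart_props(2) S that by blast
    then have gp': "\<forall>p\<in>S. \<forall>q\<in>S. \<forall>r\<in>S. distinct [p, q, r] \<longrightarrow> orient (chart f p) (chart f q) (chart f r) \<noteq> 0"
      using gp general_position_iff_orient[of S "chart f"] by blast
    show "orient a b c \<noteq> 0" if abc: "a \<in> ?V" "b \<in> ?V" "c \<in> ?V" "distinct [a, b, c]" for a b c
    proof -
      obtain p q r where pqr: "p \<in> S" "q \<in> S" "r \<in> S" "a = chart f p" "b = chart f q" "c = chart f r"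
        using abc(1-3) by blast
      moreover then have "distinct [p, q, r]" using abc(4) by auto
      ultimately show ?thesis using gp' by blast
    qed
  qed
  then show ?thesis using that S by blast
qed

lemma quad_pos_if_triplewise:
  assumes xs: "triplewise (\<lambda>a b c. orient a b c > 0) xs"
    and abcd: "{a, b, c, d} \<subseteq> set xs" "distinct [a, b, c, d]"
  shows "quad a b c d > 0"
proof -
  obtain i where i: "i < length xs" "xs ! i = a" using abcd(1) in_set_conv_nth[of a xs] by auto
  obtain j where j: "j < length xs" "xs ! j = b" using abcd(1) in_set_conv_nth[of b xs] by auto
  obtain k where k: "k < length xs" "xs ! k = c" using abcd(1) in_set_conv_nth[of c xs] by auto
  obtain l where l: "l < length xs" "xs ! l = d" using abcd(1) in_set_conv_nth[of d xs] by auto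
  have "quad (xs ! i) (xs ! j) (xs ! k) (xs ! l) > 0"
  proof (rule all_orders_if_sorted[where P = "\<lambda>i j k l. quad (xs ! i) (xs ! j) (xs ! k) (xs ! l) > 0" and n = "length xs"])
    show "quad (xs ! i) (xs ! j) (xs ! k) (xs ! l) > 0" if "i < j" "j < k" "k < l" "l < length xs" for i j k l
      using triplewise_nth[OF xs, of i j k] triplewise_nth[OF xs, of j k l]
        triplewise_nth[OF xs, of i k l] triplewise_nth[OF xs, of i j l] that
      by (simp add: quad_def)
  qed (use i j k l abcd(2) quad_swap in auto)
  then show ?thesis using i j k l by simp
qed

lemma proj_convex_position_if_triplewise:
  assumes S: "finite S" "S \<subseteq> plane_at f" and planar: "planar f g (chart f ` S)"
    and xs: "distinct xs" "set xs \<subseteq> chart f ` S" "triplewise (\<lambda>a b c. orient a b c > 0) xs"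
    and k: "k \<le> length xs" "k > 0"
  shows "\<exists>T\<subseteq>S. card T = k \<and> proj_convex_position T"
proof -
  let ?Y = "set (take k xs)"
  define T where "T = {p \<in> S. chart f p \<in> ?Y}"
  have T: "T \<subseteq> S" "T \<subseteq> plane_at f" using S by (auto simp: T_def)
  have Y: "?Y \<subseteq> set xs" by (rule set_take_subset)
  then have img: "chart f ` T = ?Y" using xs(2) by (auto simp: T_def)
  have "card T = card ?Y"
    using card_image[of "chart f" T] inj_on_subset[OF chart_inj T(2)] img by simp
  also have "\<dots> = k" using distinct_card[of "take k xs"] xs(1) k by simp
  finally have card: "card T = k" .
  interpret planar f g "chart f ` S" by (rule planar)
  have "convex_independent ?Y"
  proof (rule convex_independent_if_quad_pos)
    show "inner f y = 1" if "y \<in> ?Y" for y using that Y xs(2) on_plane by blast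
    show "orient a b c \<noteq> 0" if "a \<in> ?Y" "b \<in> ?Y" "c \<in> ?Y" "distinct [a, b, c]" for a b c
      using generic[of a b c] that Y xs(2) by blast
    show "quad a b c d > 0" if "a \<in> ?Y" "b \<in> ?Y" "c \<in> ?Y" "d \<in> ?Y" "distinct [a, b, c, d]" for a b c d
      using quad_pos_if_triplewise[OF xs(3)] that Y by blast
  qed simp
  then have "convex_position (chart f ` T)"
    using convex_position_iff_convex_independent[of ?Y] img by simp
  moreover have "f \<noteq> 0"
  proof -
    obtain p where "p \<in> T" using card k by fastforce
    then show ?thesis using T(2) by (auto simp: plane_at_def)
  qed
  ultimately have "proj_convex_position T"
    unfolding proj_convex_position_def convex_position_in_def
    using T euclidean_plane_at finite_subset[OF T(1) S(1)] by blast
  then show ?thesis using T(1) card by blast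
qed

lemma exists_proj_convex_if_large:
  assumes S: "finite S" "general_position S" and t: "t \<ge> 3" and k: "k > 0"
    and N: "card S \<ge> 4 ^ (2 * t)"
    and large: "card S ^ (t - 2) > 2 * ((2 * t + 1) * 4 ^ (2 * t)) ^ (2 * t + 1) * (2 ^ ((t - 1) * k) * k ^ (2 * k))"
  shows "\<exists>T\<subseteq>S. card T = k \<and> proj_convex_position T"
proof (rule ccontr)
  assume no: "\<not> ?thesis"
  obtain f g where fg: "S \<subseteq> plane_at f" "planar f g (chart f ` S)"
    by (rule exists_planar_chart[OF S])
  have card: "card (chart f ` S) = card S"
    by (rule card_image) (rule inj_on_subset[OF chart_inj fg(1)])
  have "length xs < k"
    if "distinct xs" "set xs \<subseteq> chart f ` S" "triplewise (\<lambda>a b c. orient a b c > 0) xs" for xs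
    using proj_convex_position_if_triplewise[OF S(1) fg that] no k by (meson not_less)
  from planar.card_bound[OF fg(2) t _ this] show False using N large card by simp
qed


section \<open>The upper bound\<close>

text \<open>Taking logarithms, the loss is \<open>O(t\<^sup>2) + O(k * log k)\<close>, divided by \<open>t - 2\<close>, which is at least
\<open>sqrt (k * log k)\<close>. The crude estimates used are \<open>t \<le> 4 * y\<close> and \<open>k \<le> y\<^sup>2\<close>, where \<open>y\<^sup>2 = k * log k\<close>.\<close>

lemma upper_arith:
  assumes k: "k \<ge> 2" and y: "y = sqrt (real k * log 2 (real k))" and t: "t = nat \<lceil>y\<rceil> + 3"
    and N: "real N \<ge> 2 powr (real k + 221 * y)"
  shows "N \<ge> 4 ^ (2 * t)"
    and "N ^ (t - 2) > 2 * ((2 * t + 1) * 4 ^ (2 * t)) ^ (2 * t + 1) * (2 ^ ((t - 1) * k) * k ^ (2 * k))"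
proof -
  have logk: "log 2 (real k) \<ge> 1" using k by simp
  have yy: "y * y = real k * log 2 (real k)" using y logk by simp
  have k_le: "real k \<le> y * y" unfolding yy using mult_left_mono[OF logk, of "real k"] by simp
  have y2: "y * y \<ge> 2" using k_le k by linarith
  have y_nonneg: "y \<ge> 0" using y logk by simp
  have y_ge: "y \<ge> 4 / 3"
  proof (rule ccontr)
    assume "\<not> y \<ge> 4 / 3"
    then have "y * y \<le> (4 / 3) * (4 / 3)" using y_nonneg by (intro mult_mono) auto
    then show False using y2 by simp
  qed
  have t_bounds: "real t \<ge> y + 3" "real t \<le> y + 4" using t y_nonneg by linarith+
  have t4: "real t \<le> 4 * y" using t_bounds y_ge by linarith
  have Npos: "real N > 0" using N by (smt (verit) powr_gt_zero)
  have logN: "log 2 (real N) \<ge> real k + 221 * y"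
    using N Npos by (simp add: le_log_iff)
  have "(2::real) powr (4 * real t) \<le> 2 powr (real k + 221 * y)"
    by (rule powr_mono) (use t4 y_nonneg in auto)
  also have "\<dots> \<le> real N" by (rule N)
  also have "(2::real) powr (4 * real t) = real (4 ^ (2 * t))"
  proof -
    have "(2::real) powr (4 * real t) = 2 powr real (4 * t)" by simp
    also have "\<dots> = 2 ^ (2 * (2 * t))" unfolding powr_realpow[OF zero_less_numeral] by simp
    also have "\<dots> = (2 ^ 2) ^ (2 * t)" by (rule power_mult)
    finally show ?thesis by simp
  qed
  finally show "N \<ge> 4 ^ (2 * t)" by (simp only: of_nat_le_iff)
  let ?s = "2 * t + 1"
  let ?R = "2 * (?s * 4 ^ (2 * t)) ^ ?s * (2 ^ ((t - 1) * k) * k ^ (2 * k))"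
  have kpos: "k > 0" using k by simp
  have "log 2 (real ?s) \<le> 2 * real t"
  proof -
    have "?s \<le> 2 ^ (2 * t)" by (metis Suc_eq_plus1 Suc_leI less_exp)
    then have "real ?s \<le> real (2 ^ (2 * t))" by (simp only: of_nat_le_iff)
    then have "real ?s \<le> 2 powr (2 * real t)" by (simp flip: powr_realpow)
    then show ?thesis by (simp add: log_le_iff)
  qed
  have log4: "log 2 (4 :: real) = 2" using log_pow_cancel[of 2 2] by simp
  have "log 2 (real ?R) = 1 + real ?s * (log 2 (real ?s) + real (2 * t) * 2) + (real ((t - 1) * k) + real (2 * k) * log 2 (real k))"
  proof -
    have eq: "log 2 (real (2 * (s * 4 ^ m) ^ n * (2 ^ a * k ^ b))) =
        1 + real n * (log 2 (real s) + real m * 2) + (real a + real b * log 2 (real k))"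
      if "s > 0" for s m n a b :: nat
      using kpos that by (simp add: log_mult log_nat_power log4)
    show ?thesis by (rule eq[of ?s "2 * t" ?s "(t - 1) * k" "2 * k"]) simp
  qed
  also have "\<dots> \<le> 1 + real ?s * (2 * real t + 4 * real t) + (real t - 1) * real k + 2 * (y * y)"
  proof -
    have "real ?s * (log 2 (real ?s) + real (2 * t) * 2) \<le> real ?s * (2 * real t + 4 * real t)"
      by (rule mult_left_mono) (use \<open>log 2 (real ?s) \<le> 2 * real t\<close> in auto)
    moreover have "real ((t - 1) * k) = (real t - 1) * real k" using t by (simp add: of_nat_diff algebra_simps)
    moreover have "real (2 * k) * log 2 (real k) = 2 * (y * y)" unfolding yy by simp
    ultimately show ?thesis by linarith
  qed
  also have "\<dots> = 1 + 12 * (real t * real t) + 6 * real t + (real t - 2) * real k + real k + 2 * (y * y)"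
    by (simp add: algebra_simps)
  also have "\<dots> \<le> 1 + 12 * (16 * (y * y)) + 24 * (y * y) + (real t - 2) * real k + y * y + 2 * (y * y)"
  proof -
    have "real t * real t \<le> (4 * y) * (4 * y)" using t4 y_nonneg by (intro mult_mono) auto
    moreover have "y \<le> y * y" using y_ge mult_left_mono[of 1 y y] by simp
    ultimately show ?thesis using t4 k_le by linarith
  qed
  also have "\<dots> < (real t - 2) * real k + 221 * (y * y)" using y2 by linarith
  also have "\<dots> \<le> (real t - 2) * (real k + 221 * y)"
  proof -
    have "y * y \<le> (real t - 2) * y" using t_bounds y_nonneg by (intro mult_right_mono) auto
    then show ?thesis by (simp add: algebra_simps)
  qed
  also have "\<dots> \<le> (real t - 2) * log 2 (real N)"
    using logN t_bounds y_nonneg by (intro mult_left_mono) auto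
  also have "real t - 2 = real (t - 2)" using t by (simp add: of_nat_diff)
  also have "real (t - 2) * log 2 (real N) = log 2 (real (N ^ (t - 2)))"
    using log_nat_power[OF less_imp_le[OF Npos], of 2 "t - 2"] by simp
  finally have "log 2 (real ?R) < log 2 (real (N ^ (t - 2)))" .
  moreover have "real ?R > 0"
  proof -
    have "2 * (s * 4 ^ m) ^ n * (2 ^ a * k ^ b) > 0" if "s > 0" for s m n a b :: nat
      using kpos that by simp
    from this[OF zero_less_Suc, of "2 * t" "2 * t" ?s "(t - 1) * k" "2 * k"] have "?R > 0" by (simp only: Suc_eq_plus1)
    then show ?thesis by (simp only: of_nat_0_less_iff)
  qed
  moreover have "real (N ^ (t - 2)) > 0" using Npos by simp
  ultimately have "real ?R < real (N ^ (t - 2))"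
    using log_less_cancel_iff[of 2 "real ?R" "real (N ^ (t - 2))"] by simp
  then show "N ^ (t - 2) > ?R" by (simp only: of_nat_less_iff)
qed

definition ES_bounds :: "nat \<Rightarrow> nat set" where
  "ES_bounds k = {N. 0 < N \<and> (\<forall>S. finite S \<and> general_position S \<and> N \<le> card S \<longrightarrow>
     (\<exists>T\<subseteq>S. card T = k \<and> proj_convex_position T))}"

lemma ESp_eq: "ESp k = Inf (ES_bounds k)"
  by (simp add: ESp_def ES_bounds_def)

lemma large_in_ES_bounds:
  assumes k: "k \<ge> 2" and N: "real N \<ge> 2 powr (real k + 221 * sqrt (real k * log 2 (real k)))"
  shows "N \<in> ES_bounds k"
  unfolding ES_bounds_def
proof (intro CollectI conjI allI impI)
  show "0 < N" using N by (metis gr0I not_le of_nat_0 powr_gt_zero zero_neq_numeral)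
  fix S :: "rp2 set" assume S: "finite S \<and> general_position S \<and> N \<le> card S"
  then have "real (card S) \<ge> 2 powr (real k + 221 * sqrt (real k * log 2 (real k)))" using N by linarith
  note arith = upper_arith[OF k refl refl this]
  show "\<exists>T\<subseteq>S. card T = k \<and> proj_convex_position T"
    by (rule exists_proj_convex_if_large[OF _ _ _ _ arith]) (use S k in auto)
qed

lemma ESp_upper:
  assumes k: "k \<ge> 2"
  shows "real (ESp k) \<le> 2 powr (real k + 222 * sqrt (real k * log 2 (real k)))"
proof -
  let ?y = "sqrt (real k * log 2 (real k))"
  let ?B = "2 powr (real k + 221 * ?y)"
  have "log 2 (real k) \<ge> 1" using k by simp
  then have "1 * 1 \<le> real k * log 2 (real k)" using k by (intro mult_mono) auto
  then have y1: "?y \<ge> 1" by simp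
  have "ESp k \<le> nat \<lceil>?B\<rceil>"
    unfolding ESp_eq by (rule wellorder_Inf_le1[OF large_in_ES_bounds[OF k]]) (simp add: real_nat_ceiling_ge)
  then have "real (ESp k) \<le> real (nat \<lceil>?B\<rceil>)" by (simp only: of_nat_le_iff)
  also have "\<dots> \<le> ?B + 1" by (simp add: of_nat_nat ceiling_correct)
  \<comment> \<open>Rounding up at most doubles the bound, which is compensated by \<open>222\<close> instead of \<open>221\<close>.\<close>
  also have "\<dots> \<le> 2 * ?B" using y1 ge_one_powr_ge_zero[of 2 "real k + 221 * ?y"] by simp
  also have "\<dots> = 2 powr (1 + (real k + 221 * ?y))" by (simp add: powr_add)
  also have "\<dots> \<le> 2 powr (real k + 222 * ?y)" using y1 by (intro powr_mono) auto
  finally show ?thesis .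
qed

section \<open>A configuration indexed by binary words\<close>

text \<open>The number whose binary digits are the letters of the word.\<close>

fun word_x :: "bool list \<Rightarrow> real" where
  "word_x [] = 0"
| "word_x (b # w) = (if b then 2 ^ length w else 0) + word_x w"

text \<open>An upper bound of \<open>word_y\<close> on words of length \<open>n\<close>. It grows so fast that raising a point by the
increment \<open>y_step n\<close> makes its lines to the points of the words of length \<open>n\<close> steeper than all lines
among the latter.\<close>

fun y_bound :: "nat \<Rightarrow> real" where
  "y_bound 0 = 0"
| "y_bound (Suc n) = y_bound n + ((2 ^ Suc n + 1) * y_bound n + 1)"

abbreviation y_step :: "nat \<Rightarrow> real" where
  "y_step n \<equiv> (2 ^ Suc n + 1) * y_bound n + 1"

fun word_y :: "bool list \<Rightarrow> real" where
  "word_y [] = 0"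
| "word_y (b # w) = (if b then y_step (length w) else 0) + word_y w"

definition word_point :: "bool list \<Rightarrow> real^3" where
  "word_point w = vector [1, word_x w, word_y w]"

abbreviation turn :: "bool list \<Rightarrow> bool list \<Rightarrow> bool list \<Rightarrow> real" where
  "turn u v w \<equiv> orient (word_point u) (word_point v) (word_point w)"

lemma turn_eq:
  "turn u v w = (word_x v - word_x u) * (word_y w - word_y u) - (word_x w - word_x u) * (word_y v - word_y u)"
  by (simp add: orient_expand word_point_def algebra_simps)

lemma y_bound_nonneg: "y_bound n \<ge> 0"
  by (induction n) auto

lemma word_x_bounds: "0 \<le> word_x w" "word_x w \<le> 2 ^ length w - 1"
  by (induction w) (auto simp: algebra_simps intro: order_trans)

lemma word_y_bounds: "0 \<le> word_y w \<and> word_y w \<le> y_bound (length w)"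
proof (induction w)
  case (Cons b w)
  have "0 \<le> y_step (length w)"
    using y_bound_nonneg[of "length w"] by (intro add_nonneg_nonneg mult_nonneg_nonneg) auto
  moreover have "y_bound (length (b # w)) = y_bound (length w) + y_step (length w)" by simp
  ultimately show ?case using Cons y_bound_nonneg[of "length w"] by (cases b) (simp_all only: word_y.simps if_True if_False, linarith+)
qed simp

lemma word_x_separated: "length u = length v \<Longrightarrow> u \<noteq> v \<Longrightarrow> \<bar>word_x u - word_x v\<bar> \<ge> 1"
proof (induction u v rule: list_induct2)
  case (Cons a u b v)
  show ?case
  proof (cases "a = b")
    case True then show ?thesis using Cons by simp
  next
    case False
    then show ?thesis using word_x_bounds[of u] word_x_bounds[of v] Cons(1) by auto
  qed
qed simp

lemma word_x_eq_iff: "length u = length v \<Longrightarrow> word_x u = word_x v \<longleftrightarrow> u = v"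
  using word_x_separated[of u v] by (cases "u = v") auto

lemma turn_Cons:
  "length u = length v \<Longrightarrow> length v = length w \<Longrightarrow> turn (b # u) (b # v) (b # w) = turn u v w"
  by (simp add: turn_eq)

text \<open>Different words of length \<open>n\<close> have abscissas at distance at least 1 and at most \<open>2 ^ n\<close>, so that the slope
of the line through two of their points is at most \<open>y_bound n\<close>; the points of words starting with
\<open>True\<close> are higher than those of words starting with \<open>False\<close> by at least \<open>y_step n - y_bound n\<close>, at a
horizontal distance of at most \<open>2 ^ (n + 1)\<close>.\<close>

lemma steep:
  assumes "length u = n" "length v = n" "length w = n" "word_x u < word_x v"
  shows "(word_x v - word_x u) * (y_step n + word_y w - word_y u) > (2 ^ n + word_x w - word_x u) * (word_y v - word_y u)"
    and "(word_x v - word_x u) * (y_step n + word_y v - word_y w) > (2 ^ n + word_x v - word_x w) * (word_y v - word_y u)"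
proof -
  have d: "word_x v - word_x u \<ge> 1" using word_x_separated[of u v] assms by auto
  have b: "word_y u \<ge> 0" "word_y v \<ge> 0" "word_y w \<ge> 0"
    "word_y u \<le> y_bound n" "word_y v \<le> y_bound n" "word_y w \<le> y_bound n"
    "word_x u \<ge> 0" "word_x v \<ge> 0" "word_x w \<ge> 0"
    "word_x u \<le> 2 ^ n - 1" "word_x v \<le> 2 ^ n - 1" "word_x w \<le> 2 ^ n - 1"
    using word_y_bounds[of u] word_y_bounds[of v] word_y_bounds[of w]
      word_x_bounds[of u] word_x_bounds[of v] word_x_bounds[of w] assms by auto
  have flat: "X * (word_y v - word_y u) \<le> 2 ^ Suc n * y_bound n" if "0 \<le> X" "X \<le> 2 ^ Suc n" for X :: real
  proof -
    have "X * (word_y v - word_y u) \<le> X * y_bound n" using that b by (intro mult_left_mono) auto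
    also have "\<dots> \<le> 2 ^ Suc n * y_bound n" using that y_bound_nonneg by (intro mult_right_mono) auto
    finally show ?thesis .
  qed
  have high: "(word_x v - word_x u) * Y > 2 ^ Suc n * y_bound n" if "Y \<ge> y_step n - y_bound n" for Y
  proof -
    have "2 ^ Suc n * y_bound n < Y" using that by (simp add: algebra_simps)
    moreover have "0 \<le> 2 ^ Suc n * y_bound n" using y_bound_nonneg by simp
    ultimately have "Y \<ge> 0" by linarith
    then have "1 * Y \<le> (word_x v - word_x u) * Y" using d by (intro mult_right_mono) auto
    then show ?thesis using \<open>2 ^ Suc n * y_bound n < Y\<close> by linarith
  qed
  show "(word_x v - word_x u) * (y_step n + word_y w - word_y u) > (2 ^ n + word_x w - word_x u) * (word_y v - word_y u)"
    by (rule le_less_trans[OF flat high]) (use b in auto)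
  show "(word_x v - word_x u) * (y_step n + word_y v - word_y w) > (2 ^ n + word_x v - word_x w) * (word_y v - word_y u)"
    by (rule le_less_trans[OF flat high]) (use b in auto)
qed

lemma turn_low_low_high:
  assumes "length u = n" "length v = n" "length w = n" "u \<noteq> v"
  shows "sgn (turn (False # u) (False # v) (True # w)) = sgn (word_x v - word_x u)"
proof -
  have *: "turn (False # u) (False # v) (True # w) > 0"
    if "length u = n" "length v = n" "word_x u < word_x v" for u v
    using steep(1)[OF that(1,2) assms(3) that(3)] that assms(3) by (simp add: turn_eq algebra_simps)
  have "word_x u \<noteq> word_x v" using word_x_eq_iff assms by simp
  then consider "word_x u < word_x v" | "word_x v < word_x u" by linarith
  then show ?thesis
  proof cases
    case 1 then show ?thesis using *[of u v] assms by simp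
  next
    case 2 then show ?thesis using *[of v u] assms
        orient_swap(1)[of "word_point (False # u)" "word_point (False # v)" "word_point (True # w)"] by simp
  qed
qed

lemma turn_low_high_high:
  assumes "length u = n" "length v = n" "length w = n" "v \<noteq> w"
  shows "sgn (turn (False # u) (True # v) (True # w)) = - sgn (word_x w - word_x v)"
proof -
  have *: "turn (False # u) (True # v) (True # w) < 0"
    if "length v = n" "length w = n" "word_x v < word_x w" for v w
    using steep(2)[OF that(1,2) assms(1) that(3)] that assms(1) by (simp add: turn_eq algebra_simps)
  have "word_x v \<noteq> word_x w" using word_x_eq_iff assms by simp
  then consider "word_x v < word_x w" | "word_x w < word_x v" by linarith
  then show ?thesis
  proof cases
    case 1 then show ?thesis using *[of v w] assms by simp
  next
    case 2 then show ?thesis using *[of w v] assms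
        orient_swap(2)[of "word_point (False # u)" "word_point (True # v)" "word_point (True # w)"] by simp
  qed
qed

lemma turn_nonzero:
  "length u = n \<Longrightarrow> length v = n \<Longrightarrow> length w = n \<Longrightarrow> distinct [u, v, w] \<Longrightarrow> turn u v w \<noteq> 0"
proof (induction n arbitrary: u v w)
  case (Suc n)
  have low: "turn (False # u) (False # v) (True # w) \<noteq> 0" if "length u = n" "length v = n" "length w = n" "u \<noteq> v" for u v w
    using turn_low_low_high[OF that] word_x_eq_iff that by (auto simp: sgn_0_0)
  have high: "turn (False # u) (True # v) (True # w) \<noteq> 0" if "length u = n" "length v = n" "length w = n" "v \<noteq> w" for u v w
    using turn_low_high_high[OF that] word_x_eq_iff that by (auto simp: sgn_0_0)
  obtain a u' where u: "u = a # u'" "length u' = n" using Suc.prems(1) by (auto simp: length_Suc_conv)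
  obtain b v' where v: "v = b # v'" "length v' = n" using Suc.prems(2) by (auto simp: length_Suc_conv)
  obtain c w' where w: "w = c # w'" "length w' = n" using Suc.prems(3) by (auto simp: length_Suc_conv)
  note w = u v w
  have rot: "turn v w u = turn u v w" "turn w u v = turn u v w"
    using orient_rotate by metis+
  show ?case
  proof (cases "a = b \<and> b = c")
    case True then show ?thesis using Suc.IH[of u' v' w'] Suc.prems w by (simp add: turn_Cons)
  next
    case False
    then consider "\<not> a" "\<not> b" c | "\<not> a" b "\<not> c" | a "\<not> b" "\<not> c" | "\<not> a" b c | a "\<not> b" c | a b "\<not> c" by blast
    then show ?thesis
    proof cases
      case 1 then show ?thesis using low[of u' v' w'] w Suc.prems by simp
    next
      case 2 then show ?thesis using low[of w' u' v'] w Suc.prems rot by auto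
    next
      case 3 then show ?thesis using low[of v' w' u'] w Suc.prems rot by auto
    next
      case 4 then show ?thesis using high[of u' v' w'] w Suc.prems by simp
    next
      case 5 then show ?thesis using high[of v' w' u'] w Suc.prems rot by auto
    next
      case 6 then show ?thesis using high[of w' u' v'] w Suc.prems rot by auto
    qed
  qed
qed simp

text \<open>The value is 1 if the three points form a cup and -1 if they form a cap. In contrast to \<open>turn\<close>, it
is invariant under permutations, as the signs of the differences of the abscissas compensate.\<close>

definition bend :: "bool list \<Rightarrow> bool list \<Rightarrow> bool list \<Rightarrow> real" where
  "bend u v w = sgn (turn u v w) * sgn (word_x v - word_x u) * sgn (word_x w - word_x u) * sgn (word_x w - word_x v)"

lemma sgn_minus_commute: "sgn (a - b :: real) = - sgn (b - a)"
  by (simp add: sgn_if)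

lemma bend_swap: "bend v u w = bend u v w" "bend u w v = bend u v w"
  using orient_swap(1)[of "word_point v" "word_point u" "word_point w"]
    orient_swap(2)[of "word_point u" "word_point w" "word_point v"]
    sgn_minus_commute[of "word_x u" "word_x v"] sgn_minus_commute[of "word_x v" "word_x w"]
  by (simp_all add: bend_def sgn_minus)

lemma bend_Cons:
  "length u = length v \<Longrightarrow> length v = length w \<Longrightarrow> bend (b # u) (b # v) (b # w) = bend u v w"
  by (simp add: bend_def turn_Cons)

lemma bend_cases:
  assumes "length u = n" "length v = n" "length w = n" "distinct [u, v, w]"
  shows "bend u v w = 1 \<or> bend u v w = - 1"
proof -
  have "turn u v w \<noteq> 0" using turn_nonzero assms by blast
  moreover have "word_x u \<noteq> word_x v" "word_x v \<noteq> word_x w" "word_x u \<noteq> word_x w"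
    using word_x_eq_iff assms by auto
  ultimately have "sgn (turn u v w) \<in> {1, - 1}" "sgn (word_x v - word_x u) \<in> {1, - 1}"
    "sgn (word_x w - word_x u) \<in> {1, - 1}" "sgn (word_x w - word_x v) \<in> {1, - 1}"
    by (simp_all add: sgn_if)
  then show ?thesis unfolding bend_def by (elim insertE emptyE) simp_all
qed

lemma sgn_cases: "x \<noteq> (0::real) \<Longrightarrow> sgn x = 1 \<or> sgn x = - 1"
  by (simp add: sgn_if)

lemma sgn_square_one: "x \<noteq> (0::real) \<Longrightarrow> sgn x * sgn x = 1"
  by (simp add: sgn_if)

lemma bend_low_high:
  assumes "length u = n" "length v = n" "length w = n"
  shows "u \<noteq> v \<Longrightarrow> bend (False # u) (False # v) (True # w) = 1"
    and "v \<noteq> w \<Longrightarrow> bend (False # u) (True # v) (True # w) = - 1"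
proof -
  have gap: "sgn (2 ^ n + word_x b - word_x a) = 1" if "length a = n" "length b = n" for a b
    using word_x_bounds[of a] word_x_bounds[of b] that by simp
  {
    assume "u \<noteq> v"
    then have "word_x v - word_x u \<noteq> 0" using word_x_eq_iff assms by auto
    then show "bend (False # u) (False # v) (True # w) = 1"
      using turn_low_low_high[OF assms \<open>u \<noteq> v\<close>] gap[of u w] gap[of v w] assms
      by (simp add: bend_def sgn_square_one)
  next
    assume "v \<noteq> w"
    then have "word_x w - word_x v \<noteq> 0" using word_x_eq_iff assms by auto
    then show "bend (False # u) (True # v) (True # w) = - 1"
      using turn_low_high_high[OF assms \<open>v \<noteq> w\<close>] gap[of u v] gap[of u w] assms
      by (simp add: bend_def sgn_square_one)
  }
qed


section \<open>Coherent sets of words\<close>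

definition words :: "nat \<Rightarrow> nat \<Rightarrow> bool list set" where
  "words n z = {w. length w = n \<and> count_list w False = z}"

definition tails :: "bool \<Rightarrow> bool list set \<Rightarrow> bool list set" where
  "tails b T = {w. b # w \<in> T}"

lemma finite_words: "T \<subseteq> words n z \<Longrightarrow> finite T"
  using finite_lists_length_eq[of "UNIV :: bool set" n] by (auto intro: finite_subset simp: words_def)

lemma card_tails:
  assumes "T \<subseteq> words (Suc n) z"
  shows "card T = card (tails False T) + card (tails True T)"
proof -
  have "T = Cons False ` tails False T \<union> Cons True ` tails True T"
  proof
    show "T \<subseteq> Cons False ` tails False T \<union> Cons True ` tails True T"
    proof
      fix w assume "w \<in> T"
      moreover then obtain b w' where "w = b # w'" using assms by (auto simp: words_def length_Suc_conv)
      ultimately show "w \<in> Cons False ` tails False T \<union> Cons True ` tails True T"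
        by (cases b) (auto simp: tails_def)
    qed
  qed (auto simp: tails_def)
  moreover have "finite T" using assms finite_words by blast
  ultimately have "card T = card (Cons False ` tails False T) + card (Cons True ` tails True T)"
    by (metis (no_types, lifting) card_Un_disjoint disjoint_iff finite_Un imageE list.inject)
  then show ?thesis by (simp add: card_image)
qed

lemma tails_words:
  assumes "T \<subseteq> words (Suc n) z"
  shows "tails True T \<subseteq> words n z" "tails False T \<subseteq> words n (z - 1)"
    "tails False T \<noteq> {} \<Longrightarrow> z > 0" "tails True T \<noteq> {} \<Longrightarrow> z \<le> n"
proof -
  show "tails True T \<subseteq> words n z" "tails False T \<subseteq> words n (z - 1)" "tails False T \<noteq> {} \<Longrightarrow> z > 0"
    using assms by (auto simp: words_def tails_def)
  then show "tails True T \<noteq> {} \<Longrightarrow> z \<le> n"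
    using count_le_length[of _ False] by (auto simp: words_def)
qed

lemma exists_two:
  assumes "card T \<ge> 2" obtains a b where "a \<in> T" "b \<in> T" "a \<noteq> b"
  using assms by (metis card_le_Suc0_iff_eq card.infinite not_less_eq_eq numeral_2_eq_2 zero_le)

text \<open>If both first letters occur, then only one word starts with \<open>True\<close>, since two of them and a word starting
with \<open>False\<close> form a cap; and the letter \<open>False\<close> in front of the others uses up one of the \<open>z\<close>.\<close>

lemma card_cup:
  assumes "T \<subseteq> words n z" "\<And>u v w. u \<in> T \<Longrightarrow> v \<in> T \<Longrightarrow> w \<in> T \<Longrightarrow> distinct [u, v, w] \<Longrightarrow> bend u v w = 1"
  shows "card T \<le> z + 1"
  using assms
proof (induction n arbitrary: T z)
  case 0
  then have "T \<subseteq> {[]}" by (auto simp: words_def)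
  then have "card T \<le> card {[] :: bool list}" by (intro card_mono) auto
  then show ?case by simp
next
  case (Suc n)
  note tw = tails_words[OF Suc.prems(1)]
  have len: "length w = n" if "w \<in> tails b T" for b w
    using that Suc.prems(1) by (auto simp: tails_def words_def)
  have sub: "bend u v w = 1" if "u \<in> tails b T" "v \<in> tails b T" "w \<in> tails b T" "distinct [u, v, w]" for b u v w
    using Suc.prems(2)[of "b # u" "b # v" "b # w"] that bend_Cons[of u v w b] len by (auto simp: tails_def)
  have T: "card (tails True T) \<le> z + 1" by (rule Suc.IH[OF tw(1)]) (use sub in blast)
  have F: "card (tails False T) \<le> (z - 1) + 1" by (rule Suc.IH[OF tw(2)]) (use sub in blast)
  show ?case
  proof (cases "tails False T = {}")
    case True then show ?thesis using T card_tails[OF Suc.prems(1)] by simp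
  next
    case False
    then obtain u where u: "u \<in> tails False T" by blast
    have "\<not> card (tails True T) \<ge> 2"
    proof
      assume "card (tails True T) \<ge> 2"
      then obtain v w where vw: "v \<in> tails True T" "w \<in> tails True T" "v \<noteq> w" by (rule exists_two)
      then have "bend (False # u) (True # v) (True # w) = - 1" using bend_low_high(2) len u by blast
      then show False using Suc.prems(2)[of "False # u" "True # v" "True # w"] u vw by (simp add: tails_def)
    qed
    then show ?thesis using F tw(3)[OF False] card_tails[OF Suc.prems(1)] by simp
  qed
qed

lemma card_cap:
  assumes "T \<subseteq> words n z" "\<And>u v w. u \<in> T \<Longrightarrow> v \<in> T \<Longrightarrow> w \<in> T \<Longrightarrow> distinct [u, v, w] \<Longrightarrow> bend u v w = - 1"
  shows "card T + z \<le> n + 1 \<or> T = {}"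
  using assms
proof (induction n arbitrary: T z)
  case 0
  then have "T \<subseteq> {[]}" by (auto simp: words_def)
  then have "card T \<le> card {[] :: bool list}" by (intro card_mono) auto
  moreover have "T = {} \<or> z = 0" using 0 \<open>T \<subseteq> {[]}\<close> by (auto simp: words_def subset_singleton_iff)
  ultimately show ?case by auto
next
  case (Suc n)
  note tw = tails_words[OF Suc.prems(1)]
  have len: "length w = n" if "w \<in> tails b T" for b w
    using that Suc.prems(1) by (auto simp: tails_def words_def)
  have sub: "bend u v w = - 1" if "u \<in> tails b T" "v \<in> tails b T" "w \<in> tails b T" "distinct [u, v, w]" for b u v w
    using Suc.prems(2)[of "b # u" "b # v" "b # w"] that bend_Cons[of u v w b] len by (auto simp: tails_def)
  have T: "card (tails True T) + z \<le> n + 1 \<or> tails True T = {}" by (rule Suc.IH[OF tw(1)]) (use sub in blast)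
  have F: "card (tails False T) + (z - 1) \<le> n + 1 \<or> tails False T = {}" by (rule Suc.IH[OF tw(2)]) (use sub in blast)
  have card: "card T = card (tails False T) + card (tails True T)" by (rule card_tails[OF Suc.prems(1)])
  have fin: "finite T" using Suc.prems(1) finite_words by blast
  show ?case
  proof (cases "tails True T = {}")
    case True then show ?thesis using F tw(3) card fin by auto
  next
    case False
    then obtain w where w: "w \<in> tails True T" by blast
    have "\<not> card (tails False T) \<ge> 2"
    proof
      assume "card (tails False T) \<ge> 2"
      then obtain u v where uv: "u \<in> tails False T" "v \<in> tails False T" "u \<noteq> v" by (rule exists_two)
      then have "bend (False # u) (False # v) (True # w) = 1" using bend_low_high(1) len w by blast
      then show False using Suc.prems(2)[of "False # u" "False # v" "True # w"] w uv by (simp add: tails_def)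
    qed
    then show ?thesis using T False card by auto
  qed
qed

text \<open>The value is -1 iff the lines from \<open>p\<close> to \<open>q\<close> and to \<open>r\<close> separate those to \<open>s\<close> and to \<open>t\<close> in the pencil
of lines through \<open>p\<close>, for pairwise different words of equal length.\<close>

definition separation :: "bool list \<Rightarrow> bool list \<Rightarrow> bool list \<Rightarrow> bool list \<Rightarrow> bool list \<Rightarrow> real" where
  "separation p q r s t = sgn (turn p q s) * sgn (turn p q t) * sgn (turn p r s) * sgn (turn p r t)"

text \<open>The points of a convex polygon see each other in the same cyclic order.\<close>

definition coherent :: "bool list set \<Rightarrow> bool" where
  "coherent T \<longleftrightarrow> (\<forall>p\<in>T. \<forall>p'\<in>T. \<forall>q\<in>T. \<forall>r\<in>T. \<forall>s\<in>T. \<forall>t\<in>T. distinct [p, p', q, r, s, t] \<longrightarrow>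
     separation p q r s t = separation p' q r s t)"

lemma coherent_tails:
  assumes "T \<subseteq> words (Suc n) z" "coherent T" shows "coherent (tails b T)"
proof -
  have len: "length w = n" if "w \<in> tails b T" for b w
    using that assms(1) by (auto simp: tails_def words_def)
  have "separation (b # p) (b # q) (b # r) (b # s) (b # t) = separation p q r s t"
    if "p \<in> tails b T" "q \<in> tails b T" "r \<in> tails b T" "s \<in> tails b T" "t \<in> tails b T" for p q r s t
    using that len by (simp add: separation_def turn_Cons)
  moreover have "separation (b # p) (b # q) (b # r) (b # s) (b # t) = separation (b # p') (b # q) (b # r) (b # s) (b # t)"
    if "p \<in> tails b T" "p' \<in> tails b T" "q \<in> tails b T" "r \<in> tails b T" "s \<in> tails b T" "t \<in> tails b T"
      "distinct [p, p', q, r, s, t]" for p p' q r s t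
    using assms(2)[unfolded coherent_def, rule_format, of "b # p" "b # p'" "b # q" "b # r" "b # s" "b # t"] that
    by (auto simp: tails_def)
  ultimately show ?thesis unfolding coherent_def by simp
qed

context
  fixes T :: "bool list set" and n z :: nat
  assumes T: "T \<subseteq> words (Suc n) z" and coh: "coherent T"
begin

lemma tail_length: "w \<in> tails b T \<Longrightarrow> length w = n"
  using T by (auto simp: tails_def words_def)

lemma sgn_turn_low_high_low:
  assumes "u \<in> tails False T" "v \<in> tails False T" "w \<in> tails True T" "u \<noteq> v"
  shows "sgn (turn (False # u) (False # v) (True # w)) = sgn (word_x v - word_x u)"
    "sgn (turn (False # u) (True # w) (False # v)) = - sgn (word_x v - word_x u)"
    "sgn (turn (True # w) (False # u) (False # v)) = sgn (word_x v - word_x u)"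
  using turn_low_low_high[of u n v w] tail_length assms
    orient_swap(2)[of "word_point (False # u)" "word_point (True # w)" "word_point (False # v)"]
    orient_rotate[of "word_point (False # u)" "word_point (False # v)" "word_point (True # w)"]
  by (auto simp: sgn_minus)

lemma sgn_turn_high_low_high:
  assumes "u \<in> tails False T" "v \<in> tails True T" "w \<in> tails True T" "v \<noteq> w"
  shows "sgn (turn (False # u) (True # v) (True # w)) = - sgn (word_x w - word_x v)"
    "sgn (turn (True # v) (False # u) (True # w)) = sgn (word_x w - word_x v)"
    "sgn (turn (True # v) (True # w) (False # u)) = - sgn (word_x w - word_x v)"
  using turn_low_high_high[of u n v w] tail_length assms
    orient_swap(1)[of "word_point (True # v)" "word_point (False # u)" "word_point (True # w)"]
    orient_rotate[of "word_point (True # v)" "word_point (True # w)" "word_point (False # u)"]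
    orient_rotate[of "word_point (False # u)" "word_point (True # v)" "word_point (True # w)"]
  by (auto simp: sgn_minus)

lemma coherentD:
  "{p, p', q, r, s, t} \<subseteq> T \<Longrightarrow> distinct [p, p', q, r, s, t] \<Longrightarrow> separation p q r s t = separation p' q r s t"
  using coh[unfolded coherent_def, rule_format, of p p' q r s t] by simp

lemma x_diff_nonzero: "u \<in> tails b T \<Longrightarrow> v \<in> tails b T \<Longrightarrow> u \<noteq> v \<Longrightarrow> word_x v - word_x u \<noteq> 0"
  using word_x_eq_iff[of u v] tail_length by auto

text \<open>Two words starting with \<open>True\<close> are seen from \<open>p\<close> and from \<open>p'\<close> in the same way. Comparing separations
of these and of \<open>a\<close> and \<open>b\<close> therefore leaves only the bends of the triples.\<close>

lemma bend_low_exchange: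
  assumes "r \<in> tails True T" "r' \<in> tails True T" "r \<noteq> r'"
    and L: "p \<in> tails False T" "p' \<in> tails False T" "a \<in> tails False T" "b \<in> tails False T" "distinct [p, p', a, b]"
  shows "bend p a b = bend p' a b"
proof -
  have sep: "separation (False # p) (True # r) (False # a) (True # r') (False # b) =
      sgn (word_x r' - word_x r) * sgn (word_x b - word_x a) * bend p a b"
    if "p \<in> tails False T" "p \<noteq> a" "p \<noteq> b" for p
  proof -
    have "sgn (turn (False # p) (False # a) (False # b)) = sgn (turn p a b)"
      using turn_Cons[of p a b False] tail_length that L by simp
    then have "separation (False # p) (True # r) (False # a) (True # r') (False # b) =
        sgn (word_x r' - word_x r) * sgn (word_x b - word_x p) * sgn (word_x a - word_x p) * sgn (turn p a b)"
      using sgn_turn_high_low_high(1)[of p r r'] sgn_turn_low_high_low(2)[of p b r]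
        sgn_turn_low_high_low(1)[of p a r'] assms that
      by (simp add: separation_def)
    moreover have "sgn (word_x b - word_x a) * sgn (word_x b - word_x a) = 1"
      using sgn_square_one x_diff_nonzero L by auto
    ultimately show ?thesis by (simp add: bend_def mult_ac)
  qed
  have ne: "p \<noteq> a" "p \<noteq> b" "p' \<noteq> a" "p' \<noteq> b" using L(5) by auto
  have "separation (False # p) (True # r) (False # a) (True # r') (False # b) =
      separation (False # p') (True # r) (False # a) (True # r') (False # b)"
    by (rule coherentD) (use assms in \<open>auto simp: tails_def\<close>)
  then have "sgn (word_x r' - word_x r) * sgn (word_x b - word_x a) * bend p a b =
      sgn (word_x r' - word_x r) * sgn (word_x b - word_x a) * bend p' a b"
    by (simp only: sep[OF L(1) ne(1,2)] sep[OF L(2) ne(3,4)])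
  moreover have "word_x r' - word_x r \<noteq> 0" "word_x b - word_x a \<noteq> 0" using x_diff_nonzero assms by auto
  ultimately show ?thesis by (auto simp: sgn_0_0)
qed

lemma bend_high_exchange:
  assumes "l \<in> tails False T" "l' \<in> tails False T" "l \<noteq> l'"
    and R: "p \<in> tails True T" "p' \<in> tails True T" "a \<in> tails True T" "b \<in> tails True T" "distinct [p, p', a, b]"
  shows "bend p a b = bend p' a b"
proof -
  have sep: "separation (True # p) (False # l) (True # a) (False # l') (True # b) =
      - sgn (word_x l' - word_x l) * sgn (word_x b - word_x a) * bend p a b"
    if "p \<in> tails True T" "p \<noteq> a" "p \<noteq> b" for p
  proof -
    have "sgn (turn (True # p) (True # a) (True # b)) = sgn (turn p a b)"
      using turn_Cons[of p a b True] tail_length that R by simp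
    then have "separation (True # p) (False # l) (True # a) (False # l') (True # b) =
        - sgn (word_x l' - word_x l) * sgn (word_x b - word_x p) * sgn (word_x a - word_x p) * sgn (turn p a b)"
      using sgn_turn_low_high_low(3)[of l l' p] sgn_turn_high_low_high(2)[of l p b]
        sgn_turn_high_low_high(3)[of l' p a] assms that
      by (simp add: separation_def)
    moreover have "sgn (word_x b - word_x a) * sgn (word_x b - word_x a) = 1"
      using sgn_square_one x_diff_nonzero R by auto
    ultimately show ?thesis by (simp add: bend_def mult_ac)
  qed
  have ne: "p \<noteq> a" "p \<noteq> b" "p' \<noteq> a" "p' \<noteq> b" using R(5) by auto
  have "separation (True # p) (False # l) (True # a) (False # l') (True # b) =
      separation (True # p') (False # l) (True # a) (False # l') (True # b)"
    by (rule coherentD) (use assms in \<open>auto simp: tails_def\<close>)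
  then have "sgn (word_x l' - word_x l) * sgn (word_x b - word_x a) * bend p a b =
      sgn (word_x l' - word_x l) * sgn (word_x b - word_x a) * bend p' a b"
    by (simp only: sep[OF R(1) ne(1,2)] sep[OF R(2) ne(3,4)])
  moreover have "word_x l' - word_x l \<noteq> 0" "word_x b - word_x a \<noteq> 0" using x_diff_nonzero assms by auto
  ultimately show ?thesis by (auto simp: sgn_0_0)
qed

text \<open>Here the separations at words starting with different letters are compared. Apart from the two bends,
all triples involved contain words of both halves, and they contribute opposite signs.\<close>

lemma bend_opposite:
  assumes L: "p \<in> tails False T" "a \<in> tails False T" "b \<in> tails False T" "distinct [p, a, b]"
    and R: "p' \<in> tails True T" "c \<in> tails True T" "d \<in> tails True T" "distinct [p', c, d]"
  shows "bend p a b = - bend p' c d"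
proof -
  have nz: "word_x a - word_x p \<noteq> 0" "word_x b - word_x p \<noteq> 0" "word_x b - word_x a \<noteq> 0"
      "word_x c - word_x p' \<noteq> 0" "word_x d - word_x p' \<noteq> 0" "word_x d - word_x c \<noteq> 0"
    using x_diff_nonzero L R by auto
  have "sgn (turn (False # p) (False # a) (False # b)) = sgn (turn p a b)"
    "sgn (turn (True # p') (True # c) (True # d)) = sgn (turn p' c d)"
    using turn_Cons[of p a b False] turn_Cons[of p' c d True] tail_length L R by auto
  then have "separation (False # p) (True # c) (False # a) (True # d) (False # b) =
      sgn (word_x d - word_x c) * sgn (word_x b - word_x p) * sgn (word_x a - word_x p) * sgn (turn p a b)"
    and "separation (True # p') (True # c) (False # a) (True # d) (False # b) =
      - sgn (word_x b - word_x a) * sgn (word_x c - word_x p') * sgn (word_x d - word_x p') * sgn (turn p' c d)"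
    using sgn_turn_high_low_high(1)[of p c d] sgn_turn_low_high_low(2)[of p b c] sgn_turn_low_high_low(1)[of p a d]
      sgn_turn_high_low_high(3)[of b p' c] sgn_turn_high_low_high(2)[of a p' d] sgn_turn_low_high_low(3)[of a b p']
      L R
    by (auto simp: separation_def)
  moreover have "sgn (word_x b - word_x a) * sgn (word_x b - word_x a) = 1"
    "sgn (word_x d - word_x c) * sgn (word_x d - word_x c) = 1"
    using sgn_square_one nz by auto
  ultimately have "separation (False # p) (True # c) (False # a) (True # d) (False # b) =
      sgn (word_x d - word_x c) * sgn (word_x b - word_x a) * bend p a b"
    and "separation (True # p') (True # c) (False # a) (True # d) (False # b) =
      - (sgn (word_x d - word_x c) * sgn (word_x b - word_x a) * bend p' c d)"
    by (simp_all add: bend_def mult_ac)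
  moreover have "separation (False # p) (True # c) (False # a) (True # d) (False # b) =
      separation (True # p') (True # c) (False # a) (True # d) (False # b)"
    by (rule coherentD) (use L R in \<open>auto simp: tails_def\<close>)
  ultimately have "sgn (word_x d - word_x c) * sgn (word_x b - word_x a) * (bend p a b + bend p' c d) = 0"
    by (simp add: algebra_simps)
  then have "bend p a b + bend p' c d = 0" using nz by (auto simp: sgn_0_0)
  then show ?thesis by simp
qed

end

text \<open>Any triple can be transformed into any other one by exchanging one element at a time.\<close>

lemma bend_constant_if_exchange:
  assumes T: "T \<subseteq> words n z"
    and exch: "\<And>p p' a b. p \<in> T \<Longrightarrow> p' \<in> T \<Longrightarrow> a \<in> T \<Longrightarrow> b \<in> T \<Longrightarrow> distinct [p, p', a, b] \<Longrightarrow>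
      bend p a b = bend p' a b"
  shows "(\<forall>u\<in>T. \<forall>v\<in>T. \<forall>w\<in>T. distinct [u, v, w] \<longrightarrow> bend u v w = 1) \<or>
    (\<forall>u\<in>T. \<forall>v\<in>T. \<forall>w\<in>T. distinct [u, v, w] \<longrightarrow> bend u v w = - 1)"
proof (cases "\<exists>a\<in>T. \<exists>b\<in>T. \<exists>c\<in>T. distinct [a, b, c]")
  case False then show ?thesis by blast
next
  case True
  then obtain a b c where abc: "a \<in> T" "b \<in> T" "c \<in> T" "distinct [a, b, c]" by blast
  define \<sigma> where "\<sigma> = bend c a b"
  have swap: "bend v u w = bend u v w" "bend u w v = bend u v w" for u v w
    by (rule bend_swap)+
  have with_ab: "bend w a b = \<sigma>" if "w \<in> T" "w \<noteq> a" "w \<noteq> b" for w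
    using exch[of w c a b] that abc by (cases "w = c") (auto simp: \<sigma>_def)
  have with_a: "bend a v w = \<sigma>" if vw: "v \<in> T" "w \<in> T" "v \<noteq> a" "w \<noteq> a" "v \<noteq> w" for v w
  proof -
    consider "v = b" | "w = b" | "v \<noteq> b" "w \<noteq> b" by blast
    then show ?thesis
    proof cases
      case 1 then show ?thesis using with_ab[of w] vw swap by metis
    next
      case 2 then show ?thesis using with_ab[of v] vw swap by metis
    next
      case 3
      have "bend v a w = bend b a w" using exch[of v b a w] vw abc 3 by auto
      also have "\<dots> = bend w a b" using swap by metis
      finally show ?thesis using with_ab[of w] vw 3 swap by metis
    qed
  qed
  have "bend u v w = \<sigma>" if uvw: "u \<in> T" "v \<in> T" "w \<in> T" "distinct [u, v, w]" for u v w
  proof -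
    consider "u = a" | "v = a" | "w = a" | "u \<noteq> a" "v \<noteq> a" "w \<noteq> a" by blast
    then show ?thesis
    proof cases
      case 1 then show ?thesis using with_a[of v w] uvw by auto
    next
      case 2 then show ?thesis using with_a[of u w] uvw swap by auto
    next
      case 3 then show ?thesis using with_a[of u v] uvw swap by (metis distinct_length_2_or_more)
    next
      case 4
      have "bend u v w = bend a v w" using exch[of u a v w] uvw abc 4 by auto
      then show ?thesis using with_a[of v w] uvw 4 by auto
    qed
  qed
  moreover have "\<sigma> = 1 \<or> \<sigma> = - 1"
    using bend_cases[of c n a b] T abc by (auto simp: \<sigma>_def words_def)
  ultimately show ?thesis by auto
qed

lemma exists_three:
  assumes "card T \<ge> 3" obtains a b c where "a \<in> T" "b \<in> T" "c \<in> T" "distinct [a, b, c]"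
proof -
  obtain B where "B \<subseteq> T" "card B = 3" using obtain_subset_with_card_n[OF assms] by blast
  then show ?thesis using that by (auto simp: card_3_iff)
qed

text \<open>If one half has at most one element, induction applies to the other one, which has one letter
fewer. Otherwise both halves are cups or caps; if one of them has only two elements the bound
for the other one suffices, and else they are of different kinds, so that the numbers of letters
\<open>False\<close> and \<open>True\<close> add up.\<close>

lemma card_coherent: "T \<subseteq> words n z \<Longrightarrow> coherent T \<Longrightarrow> card T \<le> n + 3"
proof (induction n arbitrary: T z)
  case 0
  then have "T \<subseteq> {[]}" by (auto simp: words_def)
  then have "card T \<le> card {[] :: bool list}" by (intro card_mono) auto
  then show ?case by simp
next
  case (Suc n)
  let ?L = "tails False T" and ?R = "tails True T"
  note tw = tails_words[OF Suc.prems(1)]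
  have card: "card T = card ?L + card ?R" by (rule card_tails[OF Suc.prems(1)])
  have L: "card ?L \<le> n + 3" by (rule Suc.IH[OF tw(2) coherent_tails[OF Suc.prems]])
  have R: "card ?R \<le> n + 3" by (rule Suc.IH[OF tw(1) coherent_tails[OF Suc.prems]])
  show ?case
  proof (cases "card ?L \<ge> 2 \<and> card ?R \<ge> 2")
    case False then show ?thesis using L R card by linarith
  next
    case True
    obtain l l' where l: "l \<in> ?L" "l' \<in> ?L" "l \<noteq> l'" using True exists_two[of ?L] by blast
    obtain r r' where r: "r \<in> ?R" "r' \<in> ?R" "r \<noteq> r'" using True exists_two[of ?R] by blast
    have z: "0 < z" "z \<le> n" using tw(3,4) l r by auto
    have cupL: "card ?L \<le> z" if "\<forall>u\<in>?L. \<forall>v\<in>?L. \<forall>w\<in>?L. distinct [u, v, w] \<longrightarrow> bend u v w = 1"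
      using card_cup[OF tw(2)] that z by simp
    have capL: "card ?L + z \<le> n + 2" if "\<forall>u\<in>?L. \<forall>v\<in>?L. \<forall>w\<in>?L. distinct [u, v, w] \<longrightarrow> bend u v w = - 1"
      using card_cap[OF tw(2)] that z l by auto
    have cupR: "card ?R \<le> z + 1" if "\<forall>u\<in>?R. \<forall>v\<in>?R. \<forall>w\<in>?R. distinct [u, v, w] \<longrightarrow> bend u v w = 1"
      using card_cup[OF tw(1)] that by simp
    have capR: "card ?R + z \<le> n + 1" if "\<forall>u\<in>?R. \<forall>v\<in>?R. \<forall>w\<in>?R. distinct [u, v, w] \<longrightarrow> bend u v w = - 1"
      using card_cap[OF tw(1)] that r by auto
    have monoL: "(\<forall>u\<in>?L. \<forall>v\<in>?L. \<forall>w\<in>?L. distinct [u, v, w] \<longrightarrow> bend u v w = 1) \<or>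
        (\<forall>u\<in>?L. \<forall>v\<in>?L. \<forall>w\<in>?L. distinct [u, v, w] \<longrightarrow> bend u v w = - 1)"
      by (rule bend_constant_if_exchange[OF tw(2)]) (rule bend_low_exchange[OF Suc.prems r])
    have monoR: "(\<forall>u\<in>?R. \<forall>v\<in>?R. \<forall>w\<in>?R. distinct [u, v, w] \<longrightarrow> bend u v w = 1) \<or>
        (\<forall>u\<in>?R. \<forall>v\<in>?R. \<forall>w\<in>?R. distinct [u, v, w] \<longrightarrow> bend u v w = - 1)"
      by (rule bend_constant_if_exchange[OF tw(1)]) (rule bend_high_exchange[OF Suc.prems l])
    show ?thesis
    proof (cases "card ?L \<ge> 3 \<and> card ?R \<ge> 3")
      case False
      then have "card ?L = 2 \<or> card ?R = 2" using True by linarith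
      then show ?thesis using monoL monoR cupL capL cupR capR z card by linarith
    next
      case True
      obtain p a b where pab: "p \<in> ?L" "a \<in> ?L" "b \<in> ?L" "distinct [p, a, b]" using True exists_three[of ?L] by blast
      obtain q c d where qcd: "q \<in> ?R" "c \<in> ?R" "d \<in> ?R" "distinct [q, c, d]" using True exists_three[of ?R] by blast
      have opp: "bend p a b = - bend q c d" by (rule bend_opposite[OF Suc.prems pab qcd])
      from monoL show ?thesis
      proof
        assume 1: "\<forall>u\<in>?L. \<forall>v\<in>?L. \<forall>w\<in>?L. distinct [u, v, w] \<longrightarrow> bend u v w = 1"
        then have "bend q c d \<noteq> 1" using opp pab by force
        then have "card ?R + z \<le> n + 1" using monoR capR qcd by blast
        then show ?thesis using cupL[OF 1] card by linarith
      next
        assume 1: "\<forall>u\<in>?L. \<forall>v\<in>?L. \<forall>w\<in>?L. distinct [u, v, w] \<longrightarrow> bend u v w = - 1"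
        then have "bend q c d \<noteq> - 1" using opp pab by force
        then have "card ?R \<le> z + 1" using monoR cupR qcd by blast
        then show ?thesis using capL[OF 1] card by linarith
      qed
    qed
  qed
qed


section \<open>The lower bound\<close>

definition word_line :: "bool list \<Rightarrow> rp2" where
  "word_line w = Abs_rp2 (span {word_point w})"

lemma line_of_word_line: "line_of (word_line w) = span {word_point w}"
proof -
  have "word_point w $ 1 = 1" by (simp add: word_point_def)
  then have "word_point w \<noteq> 0" by auto
  then show ?thesis unfolding word_line_def by (rule line_of_Abs)
qed

lemma word_line_inj: "inj_on word_line (words n z)"
proof (rule inj_onI)
  fix u v assume uv: "u \<in> words n z" "v \<in> words n z" "word_line u = word_line v"
  then have "span {word_point u} = span {word_point v}" using line_of_word_line by metis
  then have "word_point u \<in> span {word_point v}" using span_base by auto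
  then obtain c where c: "word_point u = c *\<^sub>R word_point v" by (auto simp: span_singleton)
  from arg_cong[OF c, of "\<lambda>x. x $ 1"] have "c = 1" by (simp add: word_point_def)
  with arg_cong[OF c, of "\<lambda>x. x $ 2"] have "word_x u = word_x v" by (simp add: word_point_def)
  then show "u = v" using word_x_eq_iff uv by (simp add: words_def)
qed

lemma general_position_words: "general_position (word_line ` words n z)"
proof -
  let ?W = "words n z"
  define v where "v = word_point \<circ> the_inv_into ?W word_line"
  have v: "v (word_line w) = word_point w" if "w \<in> ?W" for w
    using the_inv_into_f_f[OF word_line_inj that] by (simp add: v_def)
  have "line_of p = span {v p}" if "p \<in> word_line ` ?W" for p
    using that v line_of_word_line by auto
  then show ?thesis
  proof (subst general_position_iff_orient)
    show "\<forall>p\<in>word_line ` ?W. \<forall>q\<in>word_line ` ?W. \<forall>r\<in>word_line ` ?W. distinct [p, q, r] \<longrightarrow> orient (v p) (v q) (v r) \<noteq> 0"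
    proof (intro ballI impI)
      fix p q r assume pqr: "p \<in> word_line ` ?W" "q \<in> word_line ` ?W" "r \<in> word_line ` ?W" "distinct [p, q, r]"
      then obtain a b c where abc: "a \<in> ?W" "b \<in> ?W" "c \<in> ?W" "p = word_line a" "q = word_line b" "r = word_line c"
        by blast
      then have "distinct [a, b, c]" using pqr(4) by auto
      then have "turn a b c \<noteq> 0" using turn_nonzero[of a n b c] abc by (simp add: words_def)
      then show "orient (v p) (v q) (v r) \<noteq> 0" using v abc by simp
    qed
  qed
qed

text \<open>In the chart in which the points are convex, positivity of \<open>quad\<close> for \<open>p\<close>, \<open>p'\<close>, \<open>x\<close>, \<open>y\<close> says that the
orientations of \<open>p\<close>, \<open>x\<close>, \<open>y\<close> and of \<open>p'\<close>, \<open>x\<close>, \<open>y\<close> differ by a factor that splits into a part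
depending on \<open>x\<close> and one depending on \<open>y\<close>. In the product of the two separations each of these parts
occurs twice. Passing from the chart to the points of the words multiplies each vector by a
nonzero factor, which only changes these parts and a common sign.\<close>

lemma coherent_if_proj_convex:
  assumes T: "T \<subseteq> words n z" and conv: "proj_convex_position (word_line ` T)"
  shows "coherent T"
proof -
  obtain a where a: "word_line ` T \<subseteq> plane_at a" "convex_position (chart a ` word_line ` T)"
    using conv unfolding proj_convex_position_def convex_position_in_def by blast
  define c where "c w = chart a (word_line w)" for w
  have "\<exists>s. s \<noteq> 0 \<and> c w = s *\<^sub>R word_point w" if "w \<in> T" for w
  proof -
    have "word_line w \<in> plane_at a" using a that by blast
    then have "c w \<in> span {word_point w}" "c w \<noteq> 0"
      using chart_props[of "word_line w" a] line_of_word_line[of w] span_base[of "c w" "{c w}"] by (auto simp: c_def)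
    then show ?thesis by (auto simp: span_singleton)
  qed
  then obtain s where s: "\<And>w. w \<in> T \<Longrightarrow> s w \<noteq> 0" "\<And>w. w \<in> T \<Longrightarrow> c w = s w *\<^sub>R word_point w" by metis
  have len: "length w = n" if "w \<in> T" for w using that T by (auto simp: words_def)
  have orient_c: "orient (c u) (c v) (c w) = s u * s v * s w * turn u v w" if "u \<in> T" "v \<in> T" "w \<in> T" for u v w
    using s(2) that by (simp add: orient_linear)
  have nz: "turn u v w \<noteq> 0" if "u \<in> T" "v \<in> T" "w \<in> T" "distinct [u, v, w]" for u v w
    using turn_nonzero[of u n v w] len that by blast
  have "finite T" using finite_words[OF T] .
  then have ci: "convex_independent (c ` T)"
    using a(2) convex_position_iff_convex_independent[of "c ` T"] by (simp add: c_def image_image)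
  have f: "inner a (c w) = 1" if "w \<in> T" for w
    using chart_props(1)[of "word_line w" a] a(1) that by (auto simp: c_def)
  have inj: "c u \<noteq> c v" if "u \<in> T" "v \<in> T" "u \<noteq> v" for u v
  proof
    assume "c u = c v"
    then have "word_line u = word_line v"
      using inj_onD[OF chart_inj[of a]] a(1) that by (auto simp: c_def)
    then show False using inj_onD[OF word_line_inj] T that by blast
  qed
  have four: "sgn (turn p x y) * sgn (turn p' x y) =
      (sgn (s p) * sgn (s p')) * (sgn (turn p p' x) * sgn (s x)) * (sgn (turn p p' y) * sgn (s y))"
    if mem: "p \<in> T" "p' \<in> T" "x \<in> T" "y \<in> T" and dist: "distinct [p, p', x, y]" for p p' x y
  proof -
    have "orient (c u) (c v) (c w) \<noteq> 0" if "u \<in> T" "v \<in> T" "w \<in> T" "distinct [u, v, w]" for u v w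
      using orient_c[of u v w] nz[of u v w] s(1) that by simp
    then have "quad (c p) (c p') (c x) (c y) \<noteq> 0"
      using mem dist by (simp add: quad_def)
    then have "quad (c p) (c p') (c x) (c y) > 0"
      using quad_pos_if_convex_independent[OF ci, of "c p" "c p'" "c x" "c y" a] f mem dist inj by auto
    then have "sgn (quad (c p) (c p') (c x) (c y)) = 1" by simp
    then have prod: "(sgn (s p') * sgn (s x) * sgn (s y) * sgn (turn p' x y)) * (sgn (s p) * sgn (s p') * sgn (s x) * sgn (turn p p' x)) *
       (sgn (s p) * sgn (s x) * sgn (s y) * sgn (turn p x y)) * (sgn (s p) * sgn (s p') * sgn (s y) * sgn (turn p p' y)) = 1"
      using mem by (simp add: quad_def orient_c sgn_mult)
    have "sgn (s p) = 1 \<or> sgn (s p) = - 1" "sgn (s p') = 1 \<or> sgn (s p') = - 1"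
      "sgn (s x) = 1 \<or> sgn (s x) = - 1" "sgn (s y) = 1 \<or> sgn (s y) = - 1"
      using s(1) mem sgn_cases by auto
    moreover have "sgn (turn p' x y) = 1 \<or> sgn (turn p' x y) = - 1" "sgn (turn p p' x) = 1 \<or> sgn (turn p p' x) = - 1"
      "sgn (turn p x y) = 1 \<or> sgn (turn p x y) = - 1" "sgn (turn p p' y) = 1 \<or> sgn (turn p p' y) = - 1"
      using nz mem dist by (auto intro!: sgn_cases)
    ultimately show ?thesis using prod by (elim disjE) simp_all
  qed
  show ?thesis
    unfolding coherent_def
  proof (intro ballI impI)
    fix p p' q r u t
    assume mem: "p \<in> T" "p' \<in> T" "q \<in> T" "r \<in> T" "u \<in> T" "t \<in> T" and dist: "distinct [p, p', q, r, u, t]"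
    define K where "K = sgn (s p) * sgn (s p')"
    define G where "G x = sgn (turn p p' x) * sgn (s x)" for x
    have E: "sgn (turn p x y) * sgn (turn p' x y) = K * G x * G y"
      if "x \<in> {q, r, u, t}" "y \<in> {q, r, u, t}" "x \<noteq> y" for x y
      using four[of p p' x y] mem dist that unfolding K_def G_def by auto
    have K: "K * K = 1"
    proof -
      have "sgn (s p) = 1 \<or> sgn (s p) = - 1" "sgn (s p') = 1 \<or> sgn (s p') = - 1"
        using s(1) mem by (auto intro!: sgn_cases)
      then show ?thesis unfolding K_def by (elim disjE) simp_all
    qed
    have G: "G x * G x = 1" if "x \<in> {q, r, u, t}" for x
    proof -
      have "sgn (turn p p' x) = 1 \<or> sgn (turn p p' x) = - 1" "sgn (s x) = 1 \<or> sgn (s x) = - 1"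
        using nz[of p p' x] s(1)[of x] mem dist that by (auto intro!: sgn_cases)
      then show ?thesis unfolding G_def by (elim disjE) simp_all
    qed
    have "separation p q r u t * separation p' q r u t =
      (sgn (turn p q u) * sgn (turn p' q u)) * (sgn (turn p q t) * sgn (turn p' q t)) *
      (sgn (turn p r u) * sgn (turn p' r u)) * (sgn (turn p r t) * sgn (turn p' r t))"
      by (simp add: separation_def mult_ac)
    also have "\<dots> = (K * G q * G u) * (K * G q * G t) * (K * G r * G u) * (K * G r * G t)"
      using E dist by auto
    also have "\<dots> = (K * K) * (K * K) * (G q * G q) * (G r * G r) * (G u * G u) * (G t * G t)"
      by (simp only: mult_ac)
    also have "\<dots> = 1" using K G by simp
    finally have prod: "separation p q r u t * separation p' q r u t = 1" .
    have "separation p' q r u t = 1 \<or> separation p' q r u t = - 1"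
    proof -
      have "separation p' q r u t \<noteq> 0" using prod by auto
      then have "separation p' q r u t = sgn (separation p' q r u t)"
        by (simp add: separation_def sgn_mult)
      then show ?thesis using sgn_cases \<open>separation p' q r u t \<noteq> 0\<close> by metis
    qed
    then show "separation p q r u t = separation p' q r u t" using prod by auto
  qed
qed

text \<open>There are \<open>n + 1\<close> possible numbers of letters \<open>False\<close>.\<close>

lemma exists_many_words: "\<exists>z. 2 ^ n \<le> (n + 1) * card (words n z)"
proof (rule ccontr)
  assume "\<not> ?thesis"
  then have less: "(n + 1) * card (words n z) < 2 ^ n" for z by (simp add: not_le)
  have "{w :: bool list. length w = n} = (\<Union>z\<in>{..n}. words n z)"
    using count_le_length[of _ False] by (auto simp: words_def)
  then have "card {w :: bool list. length w = n} = (\<Sum>z\<in>{..n}. card (words n z))"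
    by (simp, intro card_UN_disjoint) (auto simp: finite_words[OF order_refl], auto simp: words_def)
  moreover have "card {w :: bool list. length w = n} = 2 ^ n"
    using card_lists_length_eq[of "UNIV :: bool set" n] by simp
  ultimately have "2 ^ n = (\<Sum>z\<in>{..n}. card (words n z))" by simp
  then have "(n + 1) * 2 ^ n = (n + 1) * (\<Sum>z\<in>{..n}. card (words n z))" by (rule arg_cong)
  also have "\<dots> = (\<Sum>z\<in>{..n}. (n + 1) * card (words n z))" by (rule sum_distrib_left)
  also have "\<dots> < (\<Sum>z\<in>{..n}. 2 ^ n)" by (rule sum_strict_mono) (use less in auto)
  finally show False by simp
qed

lemma ESp_in_bounds: assumes "k \<ge> 2" shows "ESp k \<in> ES_bounds k"
  unfolding ESp_eq
  by (rule Inf_nat_def1)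
    (use large_in_ES_bounds[OF assms real_nat_ceiling_ge] in blast)

text \<open>With words of length \<open>n = k - 4\<close>, at most \<open>k - 1\<close> points are in projective convex position. For
\<open>k < 4\<close> the bound is at most 1, and \<open>ESp k\<close> is positive by the existence part of the upper bound.\<close>

lemma ESp_lower:
  assumes k: "k \<ge> 2"
  shows "2 powr (real k - 3 * log 2 (real k)) \<le> real (ESp k)"
proof (cases "k \<ge> 4")
  case False
  then have "k = 2 \<or> k = 3" using k by linarith
  moreover have "log 2 (3::real) \<ge> 1" by simp
  ultimately have "real k - 3 * log 2 (real k) \<le> 0" by auto
  then have "2 powr (real k - 3 * log 2 (real k)) \<le> 2 powr 0" by (intro powr_mono) auto
  moreover have "ESp k \<ge> 1" using ESp_in_bounds[OF k] by (simp add: ES_bounds_def)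
  ultimately show ?thesis by simp
next
  case True
  define n where "n = k - 4"
  obtain z where z: "2 ^ n \<le> (n + 1) * card (words n z)" using exists_many_words by blast
  let ?S = "word_line ` words n z"
  have fin: "finite (words n z)" by (rule finite_words[OF order_refl])
  have card: "card ?S = card (words n z)" by (rule card_image[OF word_line_inj])
  have "\<not> ESp k \<le> card ?S"
  proof
    assume "ESp k \<le> card ?S"
    then obtain U where U: "U \<subseteq> ?S" "card U = k" "proj_convex_position U"
      using ESp_in_bounds[OF k] general_position_words fin unfolding ES_bounds_def by blast
    then obtain T where T: "T \<subseteq> words n z" "U = word_line ` T" by (meson subset_imageE)
    have "card T = k" using card_image[OF inj_on_subset[OF word_line_inj T(1)]] T(2) U(2) by simp
    moreover have "card T \<le> n + 3"
      using card_coherent[OF T(1)] coherent_if_proj_convex[OF T(1)] U(3) T(2) by simp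
    ultimately show False using True n_def by simp
  qed
  then have "card (words n z) \<le> ESp k" using card by simp
  then have "2 ^ n \<le> (n + 1) * ESp k" using z by (meson mult_le_mono2 order_trans)
  also have "\<dots> \<le> k * ESp k" by (rule mult_right_mono) (use True n_def in auto)
  finally have "real (2 ^ n) \<le> real (k * ESp k)" by (simp only: of_nat_le_iff)
  then have le: "2 powr real n \<le> real k * real (ESp k)" by (simp add: powr_realpow)
  have log2: "log 2 (real k) \<ge> 2" using True by (simp add: le_log_iff)
  have "2 powr (real k - 3 * log 2 (real k)) \<le> 2 powr (real n - log 2 (real k))"
    using log2 True by (intro powr_mono) (auto simp: n_def of_nat_diff)
  also have "\<dots> = 2 powr real n / real k" using k by (simp add: powr_diff)
  also have "\<dots> \<le> real (ESp k)" using le k by (simp add: field_simps)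
  finally show ?thesis .
qed

theorem theorem1:
  "\<exists>c c' :: real. c > 0 \<and> c' > 0 \<and>
     (\<forall>k::nat. k \<ge> 2 \<longrightarrow>
        2 powr (real k - c * log 2 (real k)) \<le> real (ESp k) \<and>
        real (ESp k) \<le> 2 powr (real k + c' * sqrt (real k * log 2 (real k))))"
  using ESp_lower ESp_upper by (intro exI[of _ "3::real"] exI[of _ "222::real"]) auto

end
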